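(* As $n\to\infty$, $$\sup_{r>0}\Delta_{\mathbb{H}^n}(r)\le 2^{-(c+o(1))n},$$ where $c=0.5990\ldots$ is the Kabatiansky-Levenshtein constant $$c=-\min_{0<\theta<\pi/2}\left[\log_2\sin\frac{\theta}{2}+\frac{1+\sin\theta}{2\sin\theta}\log_2\frac{1+\sin\theta}{2\sin\theta}-\frac{1-\sin\theta}{2\sin\theta}\log_2\frac{1-\sin\theta}{2\sin\theta}\right],$$ the minimum being attained at $\theta=1.0995\ldots$.
   Context: $\mathbb{H}^n$ is $n$-dimensional hyperbolic space (curvature $-1$). $\Delta_{\mathbb{H}^n}(r)$ is the optimal packing density, in the sense of Bowen and Radin, for balls of radius $r$ in $\mathbb{H}^n$, defined as follows. Let $S_r$ be the space of relatively dense packings of $\mathbb{H}^n$ by closed balls of radius $r$: collections of closed balls of radius $r$ with pairwise disjoint interiors such that any additional ball of radius $r$ would intersect a ball of the packing. $S_r$ carries a natural metric making it compact; it induces the topology of local Hausdorff convergence (uniform convergence on compact sets) of packings, and its Borel $\sigma$-algebra is the one generated by the functions counting the sphere centers of a packing lying in a given Borel subset of $\mathbb{H}^n$. The isometry group $G$ of $\mathbb{H}^n$ acts on $S_r$. For a $G$-invariant Borel probability measure $\mu$ on $S_r$, the density of $\mu$ is the probability that a fixed origin in $\mathbb{H}^n$ is contained in one of the balls of a $\mu$-random packing (by $G$-invariance this does not depend on the origin). $\Delta_{\mathbb{H}^n}(r)$ is the least upper bound of the densities of all $G$-invariant Borel probability measures on $S_r$. *)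

theory Defs
  imports "HOL-Analysis.Analysis" "HOL-Probability.Probability" "HOL-Library.Landau_Symbols"
begin

section \<open>Hyperbolic space\<close>

text \<open>
  The hyperboloid model, with the dimension \<open>n\<close> as a term so that it can tend to infinity.
  Coordinates are indexed by \<open>0, \<dots>, n\<close>; the coordinates beyond \<open>n\<close> are fixed to be \<open>0\<close>, so that
  distinct functions represent distinct points.
\<close>

definition lorentz :: "nat \<Rightarrow> (nat \<Rightarrow> real) \<Rightarrow> (nat \<Rightarrow> real) \<Rightarrow> real" where
  "lorentz n x y = x 0 * y 0 - (\<Sum>i=1..n. x i * y i)"

definition hyp_space :: "nat \<Rightarrow> (nat \<Rightarrow> real) set" where
  "hyp_space n = {x. (\<forall>i>n. x i = 0) \<and> x 0 > 0 \<and> lorentz n x x = 1}"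

text \<open>
  The distance is set to \<open>0\<close> off the hyperboloid because \<^locale>\<open>Metric_space\<close> requires
  it to be nonnegative and symmetric on the whole type.
\<close>

definition hyp_dist :: "nat \<Rightarrow> (nat \<Rightarrow> real) \<Rightarrow> (nat \<Rightarrow> real) \<Rightarrow> real" where
  "hyp_dist n x y =
     (if x \<in> hyp_space n \<and> y \<in> hyp_space n then arcosh (lorentz n x y) else 0)"

lemma lorentz_ge_1:
  assumes "x \<in> hyp_space n" "y \<in> hyp_space n"
  shows "lorentz n x y \<ge> 1" and "lorentz n x y = 1 \<Longrightarrow> x = y"
proof -
  define s where "s = (\<Sum>i=1..n. x i * y i)"
  have x: "x 0 > 0" "(\<Sum>i=1..n. (x i)\<^sup>2) = (x 0)\<^sup>2 - 1" "\<And>i. i > n \<Longrightarrow> x i = 0"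
    and y: "y 0 > 0" "(\<Sum>i=1..n. (y i)\<^sup>2) = (y 0)\<^sup>2 - 1" "\<And>i. i > n \<Longrightarrow> y i = 0"
    using assms by (auto simp: hyp_space_def lorentz_def power2_eq_square)
  have sq1: "(x 0)\<^sup>2 \<ge> 1" "(y 0)\<^sup>2 \<ge> 1"
    using x(2) y(2) sum_nonneg[of "{1..n}" "\<lambda>i. (x i)\<^sup>2"] sum_nonneg[of "{1..n}" "\<lambda>i. (y i)\<^sup>2"]
    by auto
  have ge1: "x 0 \<ge> 1" "y 0 \<ge> 1"
    using sq1 x(1) y(1) power_less_one_iff[of "x 0" 2] power_less_one_iff[of "y 0" 2] by force+
  have xy1: "x 0 * y 0 \<ge> 1"
    using mult_mono[OF ge1] x(1) by simp
  have cs: "s\<^sup>2 \<le> ((x 0)\<^sup>2 - 1) * ((y 0)\<^sup>2 - 1)"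
    using Cauchy_Schwarz_ineq_sum[of x y "{1..n}"] x(2) y(2) by (simp add: s_def)
  have eq: "((x 0)\<^sup>2 - 1) * ((y 0)\<^sup>2 - 1) = (x 0 * y 0 - 1)\<^sup>2 - (x 0 - y 0)\<^sup>2"
    by (simp add: power2_eq_square algebra_simps)
  have "s\<^sup>2 \<le> (x 0 * y 0 - 1)\<^sup>2"
    using cs eq zero_le_power2[of "x 0 - y 0"] by linarith
  then have "s \<le> x 0 * y 0 - 1"
    using xy1 by (metis diff_ge_0_iff_ge power2_le_imp_le)
  then show "lorentz n x y \<ge> 1"
    by (simp add: lorentz_def s_def)
  assume "lorentz n x y = 1"
  then have s: "s = x 0 * y 0 - 1"
    by (simp add: lorentz_def s_def)
  then have "(x 0 - y 0)\<^sup>2 \<le> 0"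
    using cs eq by simp
  then have 0: "x 0 = y 0"
    by simp
  have "(\<Sum>i=1..n. (x i - y i)\<^sup>2)
      = (\<Sum>i=1..n. (x i)\<^sup>2) + (\<Sum>i=1..n. (y i)\<^sup>2) - 2 * s"
    by (simp add: s_def power2_diff sum.distrib sum_subtractf sum_distrib_left mult.assoc)
  also have "\<dots> = 0"
    using x(2) y(2) s 0 by (simp add: power2_eq_square)
  finally have "\<forall>i\<in>{1..n}. x i = y i"
    by (subst (asm) sum_nonneg_eq_0_iff) auto
  then have "x i = y i" for i
    using 0 x(3)[of i] y(3)[of i] by (cases "i = 0"; cases "i > n") auto
  then show "x = y"
    by auto
qed

lemma lorentz_orth:
  assumes "y \<in> hyp_space n" "lorentz n u y = 0"
  shows "lorentz n u u \<le> 0"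
proof -
  have y: "y 0 > 0" "(\<Sum>i=1..n. (y i)\<^sup>2) = (y 0)\<^sup>2 - 1"
    using assms by (auto simp: hyp_space_def lorentz_def power2_eq_square)
  have U: "(\<Sum>i=1..n. (u i)\<^sup>2) \<ge> 0"
    by (simp add: sum_nonneg)
  have "(u 0 * y 0)\<^sup>2 \<le> (\<Sum>i=1..n. (u i)\<^sup>2) * ((y 0)\<^sup>2 - 1)"
    using Cauchy_Schwarz_ineq_sum[of u y "{1..n}"] assms(2) y(2) by (simp add: lorentz_def)
  also have "\<dots> \<le> (\<Sum>i=1..n. (u i)\<^sup>2) * (y 0)\<^sup>2"
    using U by (intro mult_left_mono) auto
  finally have "(u 0)\<^sup>2 \<le> (\<Sum>i=1..n. (u i)\<^sup>2)"
    using y(1) by (simp add: power_mult_distrib)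
  then show ?thesis
    by (simp add: lorentz_def power2_eq_square)
qed

lemma lorentz_lin:
  "lorentz n (\<lambda>i. u i + t * v i) w = lorentz n u w + t * lorentz n v w"
  by (simp add: lorentz_def algebra_simps sum.distrib sum_distrib_left)

lemma lorentz_commute: "lorentz n x y = lorentz n y x"
  by (simp add: lorentz_def mult.commute)

lemma hyp_dist_triangle:
  assumes "x \<in> hyp_space n" "y \<in> hyp_space n" "z \<in> hyp_space n"
  shows "hyp_dist n x z \<le> hyp_dist n x y + hyp_dist n y z"
proof -
  let ?L = "lorentz n"
  define a b where "a = hyp_dist n x y" and "b = hyp_dist n y z"
  have L1: "?L x y \<ge> 1" "?L y z \<ge> 1" "?L x z \<ge> 1"
    using assms lorentz_ge_1 by auto
  have ab: "cosh a = ?L x y" "cosh b = ?L y z" "a \<ge> 0" "b \<ge> 0"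
    using assms L1 by (auto simp: a_def b_def hyp_dist_def)
  define u where "u = (\<lambda>i. x i + (- cosh a) * y i)"
  define v where "v = (\<lambda>i. z i + (- cosh b) * y i)"
  have nrm: "?L x x = 1" "?L y y = 1" "?L z z = 1"
    using assms by (auto simp: hyp_space_def)
  have Lu: "?L u p = ?L x p - cosh a * ?L y p" and Lv: "?L v p = ?L z p - cosh b * ?L y p" for p
    using lorentz_lin[of n x "- cosh a" y p] lorentz_lin[of n z "- cosh b" y p]
    unfolding u_def v_def by simp_all
  have sym: "?L y x = ?L x y" "?L z y = ?L y z" "?L z x = ?L x z"
    by (rule lorentz_commute)+
  have uy: "?L u y = 0" and vy: "?L v y = 0"
    using nrm ab sym by (simp_all add: Lu Lv)
  have xu: "?L x u = 1 - (cosh a)\<^sup>2" and zv: "?L z v = 1 - (cosh b)\<^sup>2"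
    and xv: "?L x v = ?L x z - cosh a * cosh b"
    using nrm ab sym Lu[of x] Lv[of z] Lv[of x]
    by (simp_all add: lorentz_commute[of n x u] lorentz_commute[of n z v]
        lorentz_commute[of n x v] power2_eq_square mult.commute)
  have uu: "?L u u = - (sinh a)\<^sup>2"
    using Lu[of u] uy xu lorentz_commute[of n u y] cosh_square_eq[of a] by simp
  have vv: "?L v v = - (sinh b)\<^sup>2"
    using Lv[of v] vy zv lorentz_commute[of n v y] cosh_square_eq[of b] by simp
  have uv: "?L u v = ?L x z - cosh a * cosh b"
    using Lu[of v] vy xv lorentz_commute[of n v y] by simp
  have quad: "s * (s * ?L u u + t * ?L u v) + t * (s * ?L u v + t * ?L v v) \<le> 0" for s t
  proof -
    define w where "w = (\<lambda>i. (0 + s * u i) + t * v i)"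
    have w: "?L w p = s * ?L u p + t * ?L v p" for p
      using lorentz_lin[of n "\<lambda>i. 0 + s * u i" t v p] lorentz_lin[of n "\<lambda>i. 0" s u p]
      by (simp add: w_def lorentz_def)
    have "?L w w \<le> 0"
      using uy vy by (intro lorentz_orth[OF assms(2)]) (simp add: w)
    then show ?thesis
      using w[of w] w[of u] w[of v] lorentz_commute[of n] by metis
  qed
  have "?L u v \<le> sinh a * sinh b"
  proof (cases "sinh a = 0 \<or> sinh b = 0")
    case True
    have "?L u v \<le> 0"
    proof (rule ccontr)
      assume pos: "\<not> ?L u v \<le> 0"
      from True show False
      proof
        assume a0: "sinh a = 0"
        show False
          using quad[of "((sinh b)\<^sup>2 + 1) / ?L u v" 1] uu vv a0 pos
            zero_le_power2[of "sinh b"] by simp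
      next
        assume b0: "sinh b = 0"
        show False
          using quad[of 1 "((sinh a)\<^sup>2 + 1) / ?L u v"] uu vv b0 pos
            zero_le_power2[of "sinh a"] by simp
      qed
    qed
    then show ?thesis using True by auto
  next
    case False
    then have p: "sinh a * sinh b > 0"
      using ab by (simp add: order_less_le)
    have "2 * (sinh a * sinh b) * (?L u v - sinh a * sinh b) \<le> 0"
      using quad[of "sinh b" "sinh a"] uu vv by (simp add: power2_eq_square algebra_simps)
    then show ?thesis
      using p mult_pos_pos[of "2 * (sinh a * sinh b)" "?L u v - sinh a * sinh b"]
      by (meson diff_gt_0_iff_gt mult_pos_pos not_le zero_less_numeral)
  qed
  then have "?L x z \<le> cosh (a + b)"
    using uv by (simp add: cosh_add)
  then have "cosh (hyp_dist n x z) \<le> cosh (a + b)"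
    using assms L1 by (simp add: hyp_dist_def)
  moreover have "hyp_dist n x z \<ge> 0"
    using assms L1 by (simp add: hyp_dist_def)
  ultimately show ?thesis
    using ab cosh_real_nonneg_le_iff[of "hyp_dist n x z" "a + b"] by (simp add: a_def b_def)
qed

lemma Metric_space_hyp: "Metric_space (hyp_space n) (hyp_dist n)"
proof
  fix x y z
  show "0 \<le> hyp_dist n x y"
    using lorentz_ge_1(1)[of x n y] by (auto simp: hyp_dist_def)
  show "hyp_dist n x y = hyp_dist n y x"
    by (auto simp: hyp_dist_def lorentz_commute)
  show "hyp_dist n x y = 0 \<longleftrightarrow> x = y" if "x \<in> hyp_space n" "y \<in> hyp_space n"
  proof
    assume "hyp_dist n x y = 0"
    then have "cosh (arcosh (lorentz n x y)) = 1"
      using that by (simp add: hyp_dist_def)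
    then show "x = y"
      using that lorentz_ge_1[of x n y] by simp
  next
    assume "x = y"
    then show "hyp_dist n x y = 0"
      using that by (simp add: hyp_dist_def) (simp add: hyp_space_def)
  qed
qed (rule hyp_dist_triangle)

abbreviation hyp_topology :: "nat \<Rightarrow> (nat \<Rightarrow> real) topology" where
  "hyp_topology n \<equiv> Metric_space.mtopology (hyp_space n) (hyp_dist n)"

abbreviation hyp_cball :: "nat \<Rightarrow> (nat \<Rightarrow> real) \<Rightarrow> real \<Rightarrow> (nat \<Rightarrow> real) set" where
  "hyp_cball n \<equiv> Metric_space.mcball (hyp_space n) (hyp_dist n)"

definition hyp_borel :: "nat \<Rightarrow> (nat \<Rightarrow> real) measure" where
  "hyp_borel n = sigma (hyp_space n) {U. openin (hyp_topology n) U}"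

definition hyp_isometries :: "nat \<Rightarrow> ((nat \<Rightarrow> real) \<Rightarrow> (nat \<Rightarrow> real)) set" where
  "hyp_isometries n = {g. bij_betw g (hyp_space n) (hyp_space n) \<and>
     (\<forall>x\<in>hyp_space n. \<forall>y\<in>hyp_space n. hyp_dist n (g x) (g y) = hyp_dist n x y)}"

definition hyp_origin :: "nat \<Rightarrow> real" where
  "hyp_origin = (\<lambda>i. if i = 0 then 1 else 0)"

lemma hyp_origin_in_hyp_space: "hyp_origin \<in> hyp_space n"
  by (simp add: hyp_space_def hyp_origin_def lorentz_def)


section \<open>The space of relatively dense packings\<close>

text \<open>A packing is a set of closed balls, i.e. a set of sets of points.\<close>

definition rel_dense_packings :: "nat \<Rightarrow> real \<Rightarrow> (nat \<Rightarrow> real) set set set" where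
  "rel_dense_packings n r = {P.
     P \<subseteq> (\<lambda>x. hyp_cball n x r) ` hyp_space n \<and>
     (\<forall>B\<in>P. \<forall>B'\<in>P. B \<noteq> B' \<longrightarrow>
        (hyp_topology n interior_of B) \<inter> (hyp_topology n interior_of B') = {}) \<and>
     (\<forall>x\<in>hyp_space n. hyp_cball n x r \<notin> P \<longrightarrow> (\<exists>B\<in>P. hyp_cball n x r \<inter> B \<noteq> {}))}"

text \<open>The number of sphere centers in \<open>A\<close>; it may be infinite.\<close>

definition center_count ::
  "nat \<Rightarrow> real \<Rightarrow> (nat \<Rightarrow> real) set \<Rightarrow> (nat \<Rightarrow> real) set set \<Rightarrow> ennreal" where
  "center_count n r A P =
     emeasure (count_space UNIV) {x \<in> hyp_space n. x \<in> A \<and> hyp_cball n x r \<in> P}"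

text \<open>
  The measurable space of packings: the \<open>\<sigma>\<close>-algebra generated by the counting functions, which is
  the Borel \<open>\<sigma>\<close>-algebra of the topology of local Hausdorff convergence.
\<close>

definition packing_space :: "nat \<Rightarrow> real \<Rightarrow> (nat \<Rightarrow> real) set set measure" where
  "packing_space n r = sigma (rel_dense_packings n r)
     {center_count n r A -` T \<inter> rel_dense_packings n r | A T.
        A \<in> sets (hyp_borel n) \<and> T \<in> sets borel}"

definition move_packing ::
  "((nat \<Rightarrow> real) \<Rightarrow> (nat \<Rightarrow> real)) \<Rightarrow> (nat \<Rightarrow> real) set set \<Rightarrow> (nat \<Rightarrow> real) set set" where
  "move_packing g P = (\<lambda>B. g ` B) ` P"

definition invariant_prob_measures :: "nat \<Rightarrow> real \<Rightarrow> (nat \<Rightarrow> real) set set measure set" where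
  "invariant_prob_measures n r = {\<mu>. sets \<mu> = sets (packing_space n r) \<and> prob_space \<mu> \<and>
     (\<forall>g\<in>hyp_isometries n. distr \<mu> \<mu> (move_packing g) = \<mu>)}"


section \<open>Optimal packing density\<close>

definition packing_density :: "(nat \<Rightarrow> real) set set measure \<Rightarrow> ennreal" where
  "packing_density \<mu> = emeasure \<mu> {P \<in> space \<mu>. hyp_origin \<in> \<Union>P}"

text \<open>Suprema are taken in \<^typ>\<open>ennreal\<close>, where they always exist; all densities are at most \<open>1\<close>.\<close>

definition optimal_density :: "nat \<Rightarrow> real \<Rightarrow> ennreal" where
  "optimal_density n r = (SUP \<mu>\<in>invariant_prob_measures n r. packing_density \<mu>)"


section \<open>The Kabatiansky--Levenshtein constant\<close>

definition KL_fun :: "real \<Rightarrow> real" where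
  "KL_fun \<theta> = log 2 (sin (\<theta> / 2))
     + (1 + sin \<theta>) / (2 * sin \<theta>) * log 2 ((1 + sin \<theta>) / (2 * sin \<theta>))
     - (1 - sin \<theta>) / (2 * sin \<theta>) * log 2 ((1 - sin \<theta>) / (2 * sin \<theta>))"

definition KL_const :: real where
  "KL_const = - (INF \<theta>\<in>{0<..<pi/2}. KL_fun \<theta>)"

end

theory Submission
  imports Defs
begin

text \<open>
  Following Cohn and Zhao, put \<open>sinh R = sinh r / sin (\<theta> / 2)\<close> with \<open>\<theta> \<ge> \<pi> / 3\<close>. By the hyperbolic law of cosines
  the centers of a packing that lie in a ball of radius \<open>R\<close> are seen from its center under
  pairwise angles at least \<open>\<theta>\<close>, so there are at most as many of them as points in a spherical code of angle \<open>\<theta>\<close>.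
  The expected number of centers in a set is an isometry-invariant measure, hence proportional
  to volume, and the volumes of the balls of radius \<open>r\<close> and \<open>R\<close> have ratio at most \<open>sin (\<theta> / 2) ^ (n - 1)\<close>.

  For codes, Delsarte's inequality is applied to \<open>(t - s) F(t)\<^sup>2\<close>, \<open>s = cos \<theta>\<close>. Here
  \<open>F = \<Sum> \<phi>\<^sub>i Q\<^sub>i\<close> is a combination of Gegenbauer polynomials \<open>Q\<^sub>i\<close>, where \<open>\<phi> \<ge> 0\<close> is an approximate Perron eigenvector,
  with eigenvalue exceeding \<open>s\<close>, of the Jacobi matrix of multiplication by \<open>t\<close>;
  then \<open>(t - s) F\<close> also has nonnegative coefficients. Degrees near \<open>n (1 - sin \<theta>) / (2 sin \<theta>)\<close> suffice,
  and the bound is essentially the dimension of the polynomials of that degree.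

  Up to a positive factor the derivative of the exponent is \<open>tan \<theta> + sin \<theta> - ln ((1 + sin \<theta>) / (1 - sin \<theta>))\<close>,
  which first decreases from \<open>0\<close> and then increases, so it has a single zero.
\<close>

section \<open>Zonal harmonic polynomials\<close>

text \<open>Neither the code bound nor the volume ratio depends on \<open>r\<close>, so the supremum
  over \<open>r\<close> costs nothing. The condition \<theta> \<ge> \<pi> / 3 forces R < 2 r: a
  center in the middle of the ball then excludes all others, which matters because it has no
  direction. The condition is harmless since the optimal angle \<open>1.0995...\<close> exceeds
  \<pi> / 3.

  The usual theory of spherical harmonics integrates over the sphere. Here it is replaced by algebra
  on coefficients: \<open>gegen n i\<close> is exhibited as a Gram kernel of explicit vectors of
  length \<open>card (mindex n i)\<close>. Counting all monomials instead of a basis of the harmonic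
  polynomials does not change the exponent.

  Likewise no volume on \<open>hyp_space\<close> is defined. A solvable group of isometries acts
  simply transitively, so the intensity becomes a left invariant measure on that group, and the
  classical Fubini argument for the uniqueness of Haar measure compares it with an explicit Lebesgue
  measure. The intensity is only known to be finite on one ball, so the argument is kept local to
  that ball.\<close>

definition mindex :: "nat \<Rightarrow> nat \<Rightarrow> (nat \<Rightarrow> nat) set" where
  "mindex n d = {m. (\<forall>i. i \<notin> {1..n} \<longrightarrow> m i = 0) \<and> (\<Sum>i=1..n. m i) = d}"

lemma mindex_0: "mindex 0 d = (if d = 0 then {\<lambda>_. 0} else {})"
  by (auto simp: mindex_def)

lemma mindex_Suc: "mindex (Suc n) d = (\<Union>j\<le>d. (\<lambda>m. m(Suc n := j)) ` mindex n (d - j))"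
proof (intro equalityI subsetI)
  fix m assume a: "m \<in> mindex (Suc n) d"
  have s: "(\<Sum>i=1..n. m i) + m (Suc n) = d"
    using a by (simp add: mindex_def)
  have "(\<Sum>i=1..n. (m(Suc n := 0)) i) = (\<Sum>i=1..n. m i)"
    by (intro sum.cong) auto
  then have "m(Suc n := 0) \<in> mindex n (d - m (Suc n))"
    using a s by (auto simp: mindex_def)
  moreover have "m = (m(Suc n := 0))(Suc n := m (Suc n))" by simp
  ultimately show "m \<in> (\<Union>j\<le>d. (\<lambda>m. m(Suc n := j)) ` mindex n (d - j))"
    using s by (intro UN_I[of "m (Suc n)"] image_eqI) auto
next
  fix m assume "m \<in> (\<Union>j\<le>d. (\<lambda>m. m(Suc n := j)) ` mindex n (d - j))"
  then obtain j \<beta> where j: "j \<le> d" "\<beta> \<in> mindex n (d - j)" "m = \<beta>(Suc n := j)"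
    by auto
  have "(\<Sum>i=1..n. m i) = (\<Sum>i=1..n. \<beta> i)"
    using j by (intro sum.cong) auto
  then show "m \<in> mindex (Suc n) d"
    using j by (auto simp: mindex_def)
qed

lemma finite_mindex: "finite (mindex n d)"
  by (induction n arbitrary: d) (auto simp: mindex_0 mindex_Suc)

text \<open>A generating function bound; the choice \<open>x = a / (1 + a)\<close> turns it into the exponent of Kabatiansky and Levenshtein.\<close>

lemma card_mindex_le:
  fixes x :: real
  assumes x: "0 < x" "x < 1"
  shows "real (card (mindex n d)) * x ^ d * (1 - x) ^ n \<le> 1"
proof (induction n arbitrary: d)
  case 0
  then show ?case by (simp add: mindex_0)
next
  case (Suc n)
  have "real (card (mindex (Suc n) d)) \<le> (\<Sum>j\<le>d. real (card (mindex n (d - j))))"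
  proof -
    have "card (mindex (Suc n) d) \<le> (\<Sum>j\<le>d. card ((\<lambda>m. m(Suc n := j)) ` mindex n (d - j)))"
      unfolding mindex_Suc by (rule card_UN_le) simp
    also have "\<dots> \<le> (\<Sum>j\<le>d. card (mindex n (d - j)))"
      by (intro sum_mono card_image_le finite_mindex)
    finally show ?thesis
      by (metis of_nat_le_iff of_nat_sum)
  qed
  then have "real (card (mindex (Suc n) d)) * x ^ d * (1 - x) ^ Suc n
      \<le> (\<Sum>j\<le>d. real (card (mindex n (d - j)))) * x ^ d * (1 - x) ^ Suc n"
    using x by (intro mult_right_mono) auto
  also have "\<dots> = (\<Sum>j\<le>d. (real (card (mindex n (d - j))) * x ^ (d - j) * (1 - x) ^ n) * (x ^ j * (1 - x)))"
    unfolding sum_distrib_right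
  proof (intro sum.cong refl)
    fix j assume "j \<in> {..d}"
    then have "x ^ d = x ^ (d - j) * x ^ j"
      by (simp flip: power_add)
    then show "real (card (mindex n (d - j))) * x ^ d * (1 - x) ^ Suc n =
         real (card (mindex n (d - j))) * x ^ (d - j) * (1 - x) ^ n * (x ^ j * (1 - x))"
      by simp
  qed
  \<comment> \<open>After the induction hypothesis only a truncated geometric series
    remains.\<close>
  also have "\<dots> \<le> (\<Sum>j\<le>d. 1 * (x ^ j * (1 - x)))"
    using x by (intro sum_mono mult_right_mono Suc.IH) auto
  also have "\<dots> = 1 - x ^ Suc d"
    using sum_gp_basic[of x d] by (simp add: sum_distrib_right mult.commute flip: sum_distrib_left)
  also have "\<dots> \<le> 1" using x by simp
  finally show ?case .
qed

text \<open>Indexed from \<open>1\<close> on, like the spatial coordinates in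
  \<open>lorentz\<close>, so that directions of packing centers can be used as they are.\<close>

abbreviation dotp :: "nat \<Rightarrow> (nat \<Rightarrow> real) \<Rightarrow> (nat \<Rightarrow> real) \<Rightarrow> real" where
  "dotp n x y \<equiv> \<Sum>j=1..n. x j * y j"

text \<open>Polynomials are coefficient functions on exponents. The operators \<open>mulX\<close>, \<open>mulE\<close>, \<open>mulR\<close> multiply by
  a variable, by the linear form of \<open>y\<close> and by the squared norm.\<close>

type_synonym mpol = "(nat \<Rightarrow> nat) \<Rightarrow> real"

definition mulX :: "nat \<Rightarrow> mpol \<Rightarrow> mpol" where
  "mulX j c = (\<lambda>m. if m j = 0 then 0 else c (m(j := m j - 1)))"

text \<open>The formal partial derivative; \<open>dE\<close> and \<open>lap\<close> are the
  derivative in direction \<open>y\<close> and the Laplacian built from it.\<close>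

definition dX :: "nat \<Rightarrow> mpol \<Rightarrow> mpol" where
  "dX j c = (\<lambda>m. real (m j + 1) * c (m(j := m j + 1)))"

definition mone :: mpol where
  "mone = (\<lambda>m. if m = (\<lambda>_. 0) then 1 else 0)"

definition mulE :: "nat \<Rightarrow> (nat \<Rightarrow> real) \<Rightarrow> mpol \<Rightarrow> mpol" where
  "mulE n y c = (\<lambda>m. \<Sum>j=1..n. y j * mulX j c m)"

definition dE :: "nat \<Rightarrow> (nat \<Rightarrow> real) \<Rightarrow> mpol \<Rightarrow> mpol" where
  "dE n y c = (\<lambda>m. \<Sum>j=1..n. y j * dX j c m)"

definition mulR :: "nat \<Rightarrow> mpol \<Rightarrow> mpol" where
  "mulR n c = (\<lambda>m. \<Sum>j=1..n. mulX j (mulX j c) m)"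

definition lap :: "nat \<Rightarrow> mpol \<Rightarrow> mpol" where
  "lap n c = (\<lambda>m. \<Sum>j=1..n. dX j (dX j c) m)"

section \<open>Commutation relations between multiplication and differentiation\<close>

lemma dX_mulX: "dX j (mulX k c) m = mulX k (dX j c) m + (if j = k then c m else 0)"
proof (cases "j = k")
  case True
  then show ?thesis
    by (cases "m k") (auto simp: dX_def mulX_def algebra_simps fun_upd_idem)
next
  case False
  then show ?thesis
    by (auto simp: dX_def mulX_def fun_upd_twist)
qed

lemma dX_commute: "dX j (dX k c) = dX k (dX j c)"
  by (cases "j = k") (auto simp: dX_def fun_upd_twist fun_eq_iff)

text \<open>The number operator of one variable; summed over \<open>j\<close> it becomes Euler's
  identity for homogeneous polynomials, used in \<open>lap_mulR\<close>.\<close>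

lemma mulX_dX: "mulX j (dX j c) m = real (m j) * c m"
  by (auto simp: dX_def mulX_def)

lemma op_lin:
  "mulX j (\<lambda>m. \<Sum>k\<in>K. f k m) m = (\<Sum>k\<in>K. mulX j (f k) m)"
  "dX j (\<lambda>m. \<Sum>k\<in>K. f k m) m = (\<Sum>k\<in>K. dX j (f k) m)"
  "mulX j (\<lambda>m. p m + q m) m = mulX j p m + mulX j q m"
  "dX j (\<lambda>m. p m + q m) m = dX j p m + dX j q m"
  "mulX j (\<lambda>m. a * p m) m = a * mulX j p m"
  "dX j (\<lambda>m. a * p m) m = a * dX j p m"
  by (simp_all add: mulX_def dX_def sum_distrib_left algebra_simps)

lemma dX_mone [simp]: "dX j mone = (\<lambda>_. 0)"
  by (auto simp: dX_def mone_def fun_eq_iff)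

lemma dX_mulE:
  assumes "j \<in> {1..n}"
  shows "dX j (mulE n y c) = (\<lambda>m. mulE n y (dX j c) m + y j * c m)"
proof
  fix m
  have "dX j (mulE n y c) m = (\<Sum>k=1..n. y k * mulX k (dX j c) m + (if j = k then y k * c m else 0))"
    unfolding mulE_def op_lin by (intro sum.cong) (auto simp: dX_mulX algebra_simps)
  then show "dX j (mulE n y c) m = mulE n y (dX j c) m + y j * c m"
    using assms by (simp add: mulE_def sum.distrib)
qed

lemma dX_mulR:
  assumes "j \<in> {1..n}"
  shows "dX j (mulR n c) = (\<lambda>m. mulR n (dX j c) m + 2 * mulX j c m)"
proof
  fix m
  have "dX j (mulX k (mulX k c)) m = mulX k (mulX k (dX j c)) m + (if j = k then 2 * mulX k c m else 0)" for k
  proof -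
    have "dX j (mulX k c) = (\<lambda>m. mulX k (dX j c) m + (if j = k then 1 else 0) * c m)"
      by (auto simp: dX_mulX)
    then have "mulX k (dX j (mulX k c)) m = mulX k (mulX k (dX j c)) m + (if j = k then 1 else 0) * mulX k c m"
      by (simp only: op_lin)
    then show ?thesis by (simp add: dX_mulX)
  qed
  then show "dX j (mulR n c) m = mulR n (dX j c) m + 2 * mulX j c m"
    using assms by (auto simp: mulR_def op_lin sum.distrib)
qed

lemma mulE_lin: "mulE n y (\<lambda>m. a * f m + b * g m) = (\<lambda>m. a * mulE n y f m + b * mulE n y g m)"
  by (auto simp: mulE_def op_lin algebra_simps sum.distrib sum_distrib_left)

lemma dE_lin: "dE n y (\<lambda>m. a * f m + b * g m) = (\<lambda>m. a * dE n y f m + b * dE n y g m)"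
  by (auto simp: dE_def op_lin algebra_simps sum.distrib sum_distrib_left)

lemma mulR_lin: "mulR n (\<lambda>m. a * f m + b * g m) = (\<lambda>m. a * mulR n f m + b * mulR n g m)"
proof -
  have "mulX j (\<lambda>m. a * f m + b * g m) = (\<lambda>m. a * mulX j f m + b * mulX j g m)" for j
    by (auto simp: op_lin)
  then show ?thesis
  by (auto simp: mulR_def op_lin algebra_simps sum.distrib sum_distrib_left)
qed

lemma lap_lin: "lap n (\<lambda>m. a * f m + b * g m) = (\<lambda>m. a * lap n f m + b * lap n g m)"
proof -
  have "dX j (\<lambda>m. a * f m + b * g m) = (\<lambda>m. a * dX j f m + b * dX j g m)" for j
    by (auto simp: op_lin)
  then show ?thesis
  by (auto simp: lap_def op_lin algebra_simps sum.distrib sum_distrib_left)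
qed

lemma dE_mulE: "dE n y (mulE n z c) = (\<lambda>m. mulE n z (dE n y c) m + dotp n y z * c m)"
proof
  fix m
  have "dE n y (mulE n z c) m = (\<Sum>j=1..n. y j * (mulE n z (dX j c) m + z j * c m))"
    unfolding dE_def by (intro sum.cong) (auto simp: dX_mulE)
  moreover have "mulE n z (dE n y c) m = (\<Sum>j=1..n. y j * mulE n z (dX j c) m)"
    by (simp add: mulE_def dE_def op_lin sum_distrib_left) (subst sum.swap, simp add: ac_simps)
  ultimately show "dE n y (mulE n z c) m = mulE n z (dE n y c) m + dotp n y z * c m"
    by (simp add: algebra_simps sum.distrib sum_distrib_left)
qed

lemma dE_mulR: "dE n y (mulR n c) = (\<lambda>m. mulR n (dE n y c) m + 2 * mulE n y c m)"
proof
  fix m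
  have 1: "dE n y (mulR n c) m = (\<Sum>j=1..n. y j * (mulR n (dX j c) m + 2 * mulX j c m))"
    unfolding dE_def by (intro sum.cong) (auto simp: dX_mulR)
  have "mulX k (dE n y c) = (\<lambda>m. \<Sum>j=1..n. y j * mulX k (dX j c) m)" for k
    by (auto simp: dE_def op_lin)
  then have 2: "mulR n (dE n y c) m = (\<Sum>j=1..n. y j * mulR n (dX j c) m)"
    by (simp add: mulR_def op_lin sum_distrib_left) (subst sum.swap, simp)
  show "dE n y (mulR n c) m = mulR n (dE n y c) m + 2 * mulE n y c m"
    unfolding 1 2 by (simp add: mulE_def algebra_simps sum.distrib sum_distrib_left)
qed

lemma lap_mulE: "lap n (mulE n y c) = (\<lambda>m. mulE n y (lap n c) m + 2 * dE n y c m)"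
proof
  fix m
  have 1: "dX j (dX j (mulE n y c)) m = mulE n y (dX j (dX j c)) m + 2 * y j * dX j c m"
    if "j \<in> {1..n}" for j
    using that by (simp add: dX_mulE op_lin)
  have 2: "lap n (mulE n y c) m = (\<Sum>j=1..n. mulE n y (dX j (dX j c)) m + 2 * y j * dX j c m)"
    unfolding lap_def by (intro sum.cong) (auto simp: 1)
  have 3: "mulE n y (lap n c) m = (\<Sum>j=1..n. mulE n y (dX j (dX j c)) m)"
    by (simp add: mulE_def lap_def op_lin sum_distrib_left) (subst sum.swap, simp)
  show "lap n (mulE n y c) m = mulE n y (lap n c) m + 2 * dE n y c m"
    unfolding 2 3 by (simp add: dE_def algebra_simps sum.distrib sum_distrib_left)
qed

definition homog :: "nat \<Rightarrow> nat \<Rightarrow> mpol \<Rightarrow> bool" where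
  "homog n d c \<longleftrightarrow> (\<forall>m. m \<notin> mindex n d \<longrightarrow> c m = 0)"

text \<open>Commuting both derivatives past the squared norm leaves four times the Euler operator,
  which multiplies a homogeneous polynomial by its degree, and a constant \<open>2\<close> for each
  variable.\<close>

lemma lap_mulR:
  assumes "homog n d c"
  shows "lap n (mulR n c) = (\<lambda>m. mulR n (lap n c) m + (4 * real d + 2 * real n) * c m)"
proof
  fix m
  have 1: "dX j (dX j (mulR n c)) m = mulR n (dX j (dX j c)) m + 4 * (real (m j) * c m) + 2 * c m"
    if "j \<in> {1..n}" for j
    using that by (simp add: dX_mulR op_lin dX_mulX mulX_dX)
  have 2: "lap n (mulR n c) m = (\<Sum>j=1..n. mulR n (dX j (dX j c)) m + 4 * (real (m j) * c m) + 2 * c m)"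
    unfolding lap_def by (intro sum.cong) (auto simp: 1)
  have "mulX k (lap n c) = (\<lambda>m. \<Sum>j=1..n. mulX k (dX j (dX j c)) m)" for k
    by (auto simp: lap_def op_lin)
  then have 3: "mulR n (lap n c) m = (\<Sum>j=1..n. mulR n (dX j (dX j c)) m)"
    by (simp add: mulR_def op_lin sum_distrib_left) (subst sum.swap, simp)
  have 4: "(\<Sum>j=1..n. real (m j)) * c m = real d * c m"
    using assms by (cases "m \<in> mindex n d") (auto simp: homog_def mindex_def simp flip: of_nat_sum)
  have 5: "(\<Sum>j=1..n. 4 * (real (m j) * c m)) = 4 * (real d * c m)"
    by (simp only: 4[symmetric] sum_distrib_left sum_distrib_right)
  show "lap n (mulR n c) m = mulR n (lap n c) m + (4 * real d + 2 * real n) * c m"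
    unfolding 2 3 sum.distrib 5 by (simp add: algebra_simps)
qed

lemma lap_dE: "lap n (dE n y c) = dE n y (lap n c)"
proof
  fix m
  have 1: "dX j (dE n y c) = (\<lambda>m. \<Sum>k=1..n. y k * dX k (dX j c) m)" for j
    by (auto simp: dE_def op_lin dX_commute[of j])
  have "lap n (dE n y c) m = (\<Sum>j=1..n. \<Sum>k=1..n. y k * dX k (dX j (dX j c)) m)"
    unfolding lap_def 1 by (simp add: op_lin dX_commute)
  also have "\<dots> = dE n y (lap n c) m"
    by (subst sum.swap) (simp add: dE_def lap_def op_lin sum_distrib_left)
  finally show "lap n (dE n y c) m = dE n y (lap n c) m" .
qed

lemma dE_mone [simp]: "dE n y mone = (\<lambda>_. 0)"
  by (simp add: dE_def)

lemma lap_mone [simp]: "lap n mone = (\<lambda>_. 0)"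
  by (simp add: lap_def) (simp add: dX_def)

lemma op_zero [simp]: "mulE n y (\<lambda>_. 0) = (\<lambda>_. 0)" "dE n y (\<lambda>_. 0) = (\<lambda>_. 0)" "mulR n (\<lambda>_. 0) = (\<lambda>_. 0)"
  by (simp_all add: mulE_def dE_def mulR_def mulX_def dX_def)

lemma mindex_upd_Suc:
  assumes "j \<in> {1..n}"
  shows "m(j := m j + 1) \<in> mindex n (Suc d) \<longleftrightarrow> m \<in> mindex n d"
proof -
  have "(\<Sum>i=1..n. (m(j := m j + 1)) i) = Suc (\<Sum>i=1..n. m i)"
  proof -
    have "(\<Sum>i=1..n. (m(j := m j + 1)) i) = (\<Sum>i=1..n. m i + (if i = j then 1 else 0))"
      by (intro sum.cong) auto
    then show ?thesis using assms by (simp add: sum.distrib)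
  qed
  then show ?thesis using assms by (auto simp: mindex_def)
qed

lemma homog_mulX:
  assumes "homog n d c" "j \<in> {1..n}"
  shows "homog n (Suc d) (mulX j c)"
  unfolding homog_def
proof (intro allI impI)
  fix m assume a: "m \<notin> mindex n (Suc d)"
  show "mulX j c m = 0"
  proof (cases "m j")
    case 0
    then show ?thesis by (simp add: mulX_def)
  next
    case (Suc k)
    define \<beta> where "\<beta> = m(j := k)"
    have "m = \<beta>(j := \<beta> j + 1)" using Suc by (auto simp: \<beta>_def)
    then have "\<beta> \<notin> mindex n d" using a mindex_upd_Suc[OF assms(2), of \<beta> d] by auto
    then show ?thesis using assms Suc by (auto simp: mulX_def homog_def \<beta>_def)
  qed
qed

lemma homog_mulE: "homog n d c \<Longrightarrow> homog n (Suc d) (mulE n y c)"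
  using homog_mulX by (auto simp: homog_def mulE_def intro!: sum.neutral)

lemma homog_mulR: "homog n d c \<Longrightarrow> homog n (Suc (Suc d)) (mulR n c)"
  using homog_mulX[OF homog_mulX] by (auto simp: homog_def mulR_def intro!: sum.neutral)

lemma homog_lin: "homog n d f \<Longrightarrow> homog n d g \<Longrightarrow> homog n d (\<lambda>m. a * f m + b * g m)"
  by (auto simp: homog_def)

lemma homog_mone: "homog n 0 mone"
  by (auto simp: homog_def mone_def mindex_def)

text \<open>Fischer's inner product, which makes \<open>mulX\<close> and \<open>dX\<close> adjoint.\<close>

definition fisch :: "nat \<Rightarrow> nat \<Rightarrow> mpol \<Rightarrow> mpol \<Rightarrow> real" where
  "fisch n d c q = (\<Sum>m\<in>mindex n d. (\<Prod>i=1..n. fact (m i)) * c m * q m)"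

lemma fisch_commute: "fisch n d c q = fisch n d q c"
  by (simp add: fisch_def ac_simps)

lemma fisch_lin: "fisch n d (\<lambda>m. a * f m + b * g m) q = a * fisch n d f q + b * fisch n d g q"
  by (simp add: fisch_def algebra_simps sum.distrib sum_distrib_left)

lemma fisch_sum: "fisch n d (\<lambda>m. \<Sum>k\<in>K. y k * f k m) q = (\<Sum>k\<in>K. y k * fisch n d (f k) q)"
  by (simp add: fisch_def sum_distrib_left sum_distrib_right ac_simps sum.swap[of _ K])

text \<open>Raising the \<open>j\<close>-th exponent multiplies the factorial weight by
  \<open>m j + 1\<close>, exactly the factor that \<open>dX\<close> produces; exponents with
  \<open>m j = 0\<close> contribute nothing on the left.\<close>

lemma fisch_mulX:
  assumes j: "j \<in> {1..n}"
  shows "fisch n (Suc d) (mulX j c) q = fisch n d c (dX j q)"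
proof -
  define up where "up = (\<lambda>m::nat \<Rightarrow> nat. m(j := m j + 1))"
  have inj: "inj up"
  proof (rule injI)
    fix m \<beta> assume e: "up m = up \<beta>"
    have "m i = \<beta> i" for i
      using fun_cong[OF e, of i] by (auto simp: up_def split: if_splits)
    then show "m = \<beta>" by auto
  qed
  have "fisch n (Suc d) (mulX j c) q =
      (\<Sum>m\<in>up ` mindex n d. (\<Prod>i=1..n. fact (m i)) * mulX j c m * q m)"
    unfolding fisch_def
  proof (rule sum.mono_neutral_right)
    show "up ` mindex n d \<subseteq> mindex n (Suc d)"
      using mindex_upd_Suc[OF j] by (auto simp: up_def)
    show "\<forall>i\<in>mindex n (Suc d) - up ` mindex n d. (\<Prod>ia = 1..n. fact (i ia)) * mulX j c i * q i = 0"
    proof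
      fix m assume a: "m \<in> mindex n (Suc d) - up ` mindex n d"
      have "m j = 0"
      proof (rule ccontr)
        assume "m j \<noteq> 0"
        then have "m = up (m(j := m j - 1))" by (auto simp: up_def)
        moreover from this have "m(j := m j - 1) \<in> mindex n d"
          using a mindex_upd_Suc[OF j, of "m(j := m j - 1)" d] unfolding up_def by (metis DiffD1)
        ultimately show False using a by blast
      qed
      then show "(\<Prod>ia = 1..n. fact (m ia)) * mulX j c m * q m = 0" by (simp add: mulX_def)
    qed
  qed (rule finite_mindex)
  also have "\<dots> = (\<Sum>m\<in>mindex n d. (\<Prod>i=1..n. fact (up m i)) * mulX j c (up m) * q (up m))"
    by (subst sum.reindex) (auto intro: inj_on_subset[OF inj])
  also have "\<dots> = (\<Sum>m\<in>mindex n d. (\<Prod>i=1..n. fact (m i)) * c m * dX j q m)"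
  proof (intro sum.cong refl)
    fix m
    have "(\<Prod>i=1..n. fact (up m i) :: real) = real (m j + 1) * (\<Prod>i=1..n. fact (m i))"
    proof -
      have "(\<Prod>i=1..n. fact (up m i) :: real) = (\<Prod>i=1..n. fact (m i) * (if i = j then real (m j + 1) else 1))"
        by (intro prod.cong) (auto simp: up_def)
      then show ?thesis using j by (simp add: prod.distrib)
    qed
    moreover have "mulX j c (up m) = c m" by (simp add: mulX_def up_def)
    ultimately show "(\<Prod>i=1..n. fact (up m i)) * mulX j c (up m) * q (up m) =
       (\<Prod>i=1..n. fact (m i)) * c m * dX j q m"
      by (simp add: dX_def up_def)
  qed
  finally show ?thesis by (simp add: fisch_def)
qed

lemma fisch_mulE: "fisch n (Suc d) (mulE n y c) q = fisch n d c (dE n y q)"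
proof -
  have "fisch n (Suc d) (mulE n y c) q = (\<Sum>j=1..n. y j * fisch n d c (dX j q))"
    unfolding mulE_def fisch_sum by (intro sum.cong) (auto simp: fisch_mulX)
  also have "\<dots> = fisch n d c (dE n y q)"
    unfolding fisch_commute[of n d c] dE_def fisch_sum ..
  finally show ?thesis .
qed

lemma fisch_mulR: "fisch n (Suc (Suc d)) (mulR n c) q = fisch n d c (lap n q)"
proof -
  have "fisch n (Suc (Suc d)) (mulR n c) q = (\<Sum>j=1..n. 1 * fisch n (Suc (Suc d)) (mulX j (mulX j c)) q)"
    unfolding fisch_sum[symmetric] by (simp add: mulR_def)
  also have "\<dots> = (\<Sum>j=1..n. 1 * fisch n d (dX j (dX j q)) c)"
    by (intro sum.cong) (auto simp: fisch_mulX fisch_commute[of n d c])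
  also have "\<dots> = fisch n d c (lap n q)"
    unfolding fisch_sum[symmetric] fisch_commute[of n d c] by (simp add: lap_def)
  finally show ?thesis .
qed

text \<open>The Gegenbauer polynomials \<open>Q\<^sub>i\<close> with \<open>Q\<^sub>i(1) = 1\<close> satisfy \<open>t Q\<^sub>i = A\<^sub>i Q\<^sub>i\<^sub>+\<^sub>1 + B\<^sub>i Q\<^sub>i\<^sub>-\<^sub>1\<close>.\<close>

definition gA :: "nat \<Rightarrow> nat \<Rightarrow> real" where
  "gA n i = (real i + real n - 2) / (2 * real i + real n - 2)"

definition gB :: "nat \<Rightarrow> nat \<Rightarrow> real" where
  "gB n i = real i / (2 * real i + real n - 2)"

text \<open>For \<open>i = 0\<close> the term with index \<open>i - 1\<close> is junk, but its coefficient \<open>gB n 0\<close> vanishes.\<close>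

fun gegen :: "nat \<Rightarrow> nat \<Rightarrow> real \<Rightarrow> real" where
  "gegen n 0 t = 1"
| "gegen n (Suc i) t = (t * gegen n i t - gB n i * gegen n (i - 1) t) / gA n i"

text \<open>The homogenization of \<open>gegen\<close>: as a function of \<open>x\<close> this is
  \<open>|x|^i * gegen n i (\<langle>x, y\<rangle> / |x|)\<close>.\<close>

fun zonal :: "nat \<Rightarrow> (nat \<Rightarrow> real) \<Rightarrow> nat \<Rightarrow> mpol" where
  "zonal n y 0 = mone"
| "zonal n y (Suc i) = (\<lambda>m. (1 / gA n i) * mulE n y (zonal n y i) m
      + (- gB n i / gA n i) * mulR n (zonal n y (i - 1)) m)"

section \<open>Recurrences and harmonicity of the zonal polynomials\<close>

lemma gA_pos: "n \<ge> 3 \<Longrightarrow> gA n i > 0"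
  by (auto simp: gA_def)

lemma gB_nonneg: "n \<ge> 3 \<Longrightarrow> gB n i \<ge> 0"
  by (auto simp: gB_def)

lemma gA_gB: "n \<ge> 3 \<Longrightarrow> gA n i + gB n i = 1"
  by (simp add: gA_def gB_def flip: add_divide_distrib)

lemma gA_0: "n \<ge> 3 \<Longrightarrow> gA n 0 = 1" and gB_0: "gB n 0 = 0"
  by (auto simp: gA_def gB_def)

lemma gegen_1: "n \<ge> 3 \<Longrightarrow> gegen n i 1 = 1"
proof (induction n i "1::real" rule: gegen.induct)
  case (2 n i)
  then show ?case using gA_gB[of n i] gA_pos[of n i] by (simp add: field_simps)
qed auto

lemma homog_zonal: "homog n i (zonal n y i)"
proof (induction i rule: less_induct)
  case (less i)
  consider "i = 0" | "i = 1" | k where "i = Suc (Suc k)"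
    by (metis One_nat_def not0_implies_Suc)
  then show ?case
  proof cases
    case 2
    have "homog n 1 (mulE n y mone)" using homog_mulE[OF homog_mone] by simp
    then show ?thesis using 2 by (simp add: gB_0 homog_def)
  next
    case (3 k)
    then show ?thesis
      unfolding 3 zonal.simps(2)[of n y "Suc k"] diff_Suc_1
      by (intro homog_lin homog_mulE homog_mulR less.IH) (simp_all add: 3)
  qed (simp add: homog_mone)
qed

lemma gegen_rec:
  assumes "n \<ge> 3"
  shows "t * gegen n i t = gA n i * gegen n (Suc i) t + gB n i * gegen n (i - 1) t"
  using gA_pos[OF assms, of i] by (simp add: field_simps)

lemma mulE_zonal:
  assumes "n \<ge> 3"
  shows "mulE n y (zonal n y i) m = gA n i * zonal n y (Suc i) m + gB n i * mulR n (zonal n y (i - 1)) m"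
  using gA_pos[OF assms, of i] by (simp add: field_simps)

text \<open>Differentiating along the axis lowers the degree within the same family;
  \<open>lap_zonal\<close> relies on this to compare the two terms of the recursion.\<close>

lemma dE_zonal:
  assumes n: "n \<ge> 3" and y: "dotp n y y = 1"
  shows "dE n y (zonal n y i) = (\<lambda>m. real i * zonal n y (i - 1) m)"
proof (induction i rule: less_induct)
  case (less i)
  show ?case
  proof (cases i)
    case (Suc k)
    let ?z = "zonal n y"
    have ih: "dE n y (?z k) = (\<lambda>m. real k * ?z (k - 1) m + 0 * mone m)"
      "dE n y (?z (k - 1)) = (\<lambda>m. real (k - 1) * ?z (k - 1 - 1) m + 0 * mone m)"
      using less.IH[of k] less.IH[of "k - 1"] Suc by simp_all
    have A: "gA n k > 0" by (rule gA_pos[OF n])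
    show ?thesis
    proof
      fix m
      have "dE n y (?z i) m = (1 / gA n k) * ((real k * mulE n y (?z (k - 1)) m + ?z k m)
          - gB n k * (real (k - 1) * mulR n (?z (k - 1 - 1)) m + 2 * mulE n y (?z (k - 1)) m))"
        unfolding Suc zonal.simps(2)[of n y k] dE_lin dE_mulR dE_mulE ih mulE_lin mulR_lin using y A
        by (simp add: field_simps del: zonal.simps)
      also have "\<dots> = real i * ?z k m"
      proof (cases k)
        case 0
        then show ?thesis using Suc n by (simp add: gA_0 gB_0)
      next
        case (Suc l)
        define d where "d = 2 * real l + real n"
        have d: "d > 2" "real n = d - 2 * real l" using n by (auto simp: d_def)
        have AB: "gB n k = (1 + real l) / d" "gB n l = real l / (d - 2)"
          "gA n k = (d - real l - 1) / d" "gA n l = (d - real l - 2) / (d - 2)"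
          by (simp_all add: gA_def gB_def Suc d_def)
        \<comment> \<open>The fact \<open>rec\<close> below trades \<open>mulE\<close> of the lower
          polynomial for \<open>?z k\<close> and a \<open>mulR\<close> term. Then \<open>c1\<close>
          makes the \<open>mulR\<close> terms cancel and \<open>c2\<close> identifies the
          coefficient of \<open>?z k\<close>.\<close>
        have c1: "(real k - 2 * gB n k) * gB n l = gB n k * real l"
          unfolding AB using d(1) by (simp add: Suc divide_simps) (simp add: algebra_simps)
        have c2: "1 + (real k - 2 * gB n k) * gA n l = real i * gA n k"
          unfolding AB using d(1) by (simp add: Suc \<open>i = Suc k\<close> divide_simps) (simp add: algebra_simps)
        have rec: "mulE n y (?z (k - 1)) m = gA n l * ?z k m + gB n l * mulR n (?z (k - 1 - 1)) m"
          using mulE_zonal[OF n, of y l m] Suc by simp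
        have "real k * mulE n y (?z (k - 1)) m + ?z k m
          - gB n k * (real (k - 1) * mulR n (?z (k - 1 - 1)) m + 2 * mulE n y (?z (k - 1)) m)
          = (1 + (real k - 2 * gB n k) * gA n l) * ?z k m
          + ((real k - 2 * gB n k) * gB n l - gB n k * real l) * mulR n (?z (k - 1 - 1)) m"
          unfolding rec using Suc by (simp add: algebra_simps del: zonal.simps)
        then show ?thesis unfolding c1 c2 using A by simp
      qed
      finally show "dE n y (?z i) m = real i * ?z (i - 1) m" using Suc by simp
    qed
  qed simp
qed

text \<open>The linear factor contributes \<open>2 * dE\<close> and the squared norm contributes its
  Euler term. Their cancellation is the identity \<open>c\<close>, and it is what determines the
  coefficient \<open>gB n k\<close>.\<close>

lemma lap_zonal:
  assumes n: "n \<ge> 3" and y: "dotp n y y = 1"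
  shows "lap n (zonal n y i) = (\<lambda>_. 0)"
proof (induction i rule: less_induct)
  case (less i)
  show ?case
  proof (cases i)
    case (Suc k)
    have ih: "lap n (zonal n y k) = (\<lambda>_. 0)" "lap n (zonal n y (k - 1)) = (\<lambda>_. 0)"
      using less.IH Suc by auto
    have c: "2 * real k = gB n k * (4 * real (k - 1) + 2 * real n)"
      using n by (cases k) (auto simp: gB_def field_simps)
    show ?thesis
    proof
      fix m
      have "lap n (zonal n y i) m = (1 / gA n k) * ((2 * real k) * zonal n y (k - 1) m
         - gB n k * (4 * real (k - 1) + 2 * real n) * zonal n y (k - 1) m)"
        unfolding Suc zonal.simps(2)[of n y k] lap_lin lap_mulR[OF homog_zonal] lap_mulE ih dE_zonal[OF n y]
        using gA_pos[OF n, of k] by (simp add: field_simps del: zonal.simps)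
      also have "\<dots> = 0" unfolding c by simp
      finally show "lap n (zonal n y i) m = 0" .
    qed
  qed simp
qed

text \<open>Multiplication by the squared norm is adjoint to the Laplacian, so against a harmonic
  polynomial all \<open>mulR\<close> terms of the recursion vanish. Only the pure power of the
  linear form survives, up to its leading coefficient.\<close>

lemma fisch_zonal_harmonic:
  assumes n: "n \<ge> 3" and q: "lap n q = (\<lambda>_. 0)"
  shows "(\<Prod>j<i. gA n j) * fisch n i (zonal n y i) q = fisch n i ((mulE n y ^^ i) mone) q"
  using q
proof (induction i arbitrary: q)
  case (Suc i)
  have d: "lap n (dE n y q) = (\<lambda>_. 0)" by (simp add: lap_dE Suc.prems)
  have "gA n i * fisch n (Suc i) (zonal n y (Suc i)) q = fisch n i (zonal n y i) (dE n y q)"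
  proof (cases i)
    case 0
    then show ?thesis using fisch_mulE[of n 0 y mone q] gA_0[OF n] by (simp add: gB_0)
  next
    case (Suc k)
    have z: "fisch n k c (\<lambda>_. 0) = 0" for c by (simp add: fisch_def)
    show ?thesis unfolding Suc zonal.simps(2)[of n y "Suc k"] diff_Suc_1 fisch_lin fisch_mulE fisch_mulR Suc.prems z
      using gA_pos[OF n, of "Suc k"] by (simp add: field_simps del: zonal.simps)
  qed
  then have "(\<Prod>j<Suc i. gA n j) * fisch n (Suc i) (zonal n y (Suc i)) q
      = (\<Prod>j<i. gA n j) * fisch n i (zonal n y i) (dE n y q)"
    by (simp add: algebra_simps)
  also have "\<dots> = fisch n (Suc i) ((mulE n y ^^ Suc i) mone) q"
    unfolding Suc.IH[OF d] by (simp add: fisch_mulE)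
  finally show ?case .
qed simp

lemma dE_power: "dE n y ((mulE n z ^^ Suc i) mone) = (\<lambda>m. real (Suc i) * dotp n y z * (mulE n z ^^ i) mone m)"
proof (induction i)
  case 0
  then show ?case by (simp add: dE_mulE)
next
  case (Suc i)
  have "dE n y ((mulE n z ^^ Suc (Suc i)) mone) =
     (\<lambda>m. mulE n z (dE n y ((mulE n z ^^ Suc i) mone)) m + dotp n y z * (mulE n z ^^ Suc i) mone m)"
    by (simp add: dE_mulE)
  also have "mulE n z (dE n y ((mulE n z ^^ Suc i) mone)) =
     (\<lambda>m. real (Suc i) * dotp n y z * (mulE n z ^^ Suc i) mone m)"
    unfolding Suc using mulE_lin[of n z "real (Suc i) * (dotp n y z)" _ 0] by simp
  finally show ?case by (auto simp: algebra_simps)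
qed

lemma lap_power:
  assumes z: "dotp n z z = 1"
  shows "lap n ((mulE n z ^^ Suc (Suc i)) mone) = (\<lambda>m. real (Suc (Suc i)) * real (Suc i) * (mulE n z ^^ i) mone m)"
proof (induction i)
  case 0
  then show ?case using z by (simp add: lap_mulE dE_mulE)
next
  case (Suc i)
  have "lap n ((mulE n z ^^ Suc (Suc (Suc i))) mone) =
     (\<lambda>m. mulE n z (lap n ((mulE n z ^^ Suc (Suc i)) mone)) m + 2 * dE n z ((mulE n z ^^ Suc (Suc i)) mone) m)"
    by (simp add: lap_mulE)
  also have "mulE n z (lap n ((mulE n z ^^ Suc (Suc i)) mone)) =
     (\<lambda>m. real (Suc (Suc i)) * real (Suc i) * (mulE n z ^^ Suc i) mone m)"
    unfolding Suc using mulE_lin[of n z "real (Suc (Suc i)) * real (Suc i)" _ 0] by simp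
  finally show ?case unfolding dE_power using z by (auto simp: algebra_simps)
qed

text \<open>Pairing with the \<open>i\<close>-th power of the form of \<open>z\<close> is
  \<open>fact i\<close> times evaluation at \<open>z\<close>. Instead of defining evaluation, both
  sides are shown to obey the same recursion.\<close>

lemma fisch_power_zonal:
  assumes n: "n \<ge> 3" and z: "dotp n z z = 1"
  shows "fisch n i (zonal n y i) ((mulE n z ^^ i) mone) = fact i * gegen n i (dotp n y z)"
proof (induction i rule: less_induct)
  case (less i)
  have sc: "fisch n k c (\<lambda>m. a * q m) = a * fisch n k c q" for k c a q
    by (simp add: fisch_def sum_distrib_left ac_simps)
  have base: "fisch n 0 mone mone = 1"
  proof -
    have "mindex n 0 = {\<lambda>_. 0}"
      by (auto simp: mindex_def) (metis atLeastAtMost_iff not_less_eq_eq not_gr0 One_nat_def Suc_leI)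
    then show ?thesis by (simp add: fisch_def mone_def)
  qed
  consider "i = 0" | "i = 1" | k where "i = Suc (Suc k)"
    by (metis One_nat_def not0_implies_Suc)
  then show ?case
  proof cases
    case 1
    then show ?thesis by (simp add: base)
  next
    case 2
    have z1: "zonal n y (Suc 0) = mulE n y mone" using n by (simp add: gA_0 gB_0)
    show ?thesis unfolding 2 One_nat_def z1 fisch_mulE dE_power sc using n by (simp add: base gA_0 gB_0)
  next
    case (3 k)
    have ih: "fisch n (Suc k) (zonal n y (Suc k)) ((mulE n z ^^ Suc k) mone) = fact (Suc k) * gegen n (Suc k) (dotp n y z)"
      "fisch n k (zonal n y k) ((mulE n z ^^ k) mone) = fact k * gegen n k (dotp n y z)"
      by (rule less.IH, simp add: 3)+
    show ?thesis
      unfolding 3 zonal.simps(2)[of n y "Suc k"] gegen.simps(2)[of n "Suc k"] diff_Suc_1 fisch_lin fisch_mulE fisch_mulR dE_power lap_power[OF z] sc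
      using gA_pos[OF n, of "Suc k"] ih by (simp add: field_simps del: gegen.simps zonal.simps)
  qed
qed

text \<open>Replaces the addition theorem: it gives positive definiteness and bounds the rank.\<close>

theorem gegen_gram:
  assumes n: "n \<ge> 3"
  obtains Y :: "(nat \<Rightarrow> real) \<Rightarrow> (nat \<Rightarrow> nat) \<Rightarrow> real" where
    "\<And>y z. dotp n y y = 1 \<Longrightarrow> dotp n z z = 1 \<Longrightarrow>
       gegen n i (dotp n y z) = (\<Sum>m\<in>mindex n i. Y y m * Y z m)"
proof
  define C where "C = (\<Prod>j<i. gA n j) / fact i"
  have C: "C > 0" unfolding C_def using gA_pos[OF n] by (intro divide_pos_pos prod_pos) auto
  fix y z :: "nat \<Rightarrow> real"
  assume y: "dotp n y y = 1" and z: "dotp n z z = 1"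
  \<comment> \<open>As \<open>zonal n y i\<close> is harmonic, \<open>zonal n z i\<close> may be
    replaced by a pure power, whose pairing is a value of \<open>gegen\<close>.\<close>
  have "(\<Prod>j<i. gA n j) * fisch n i (zonal n z i) (zonal n y i) = fact i * gegen n i (dotp n y z)"
    unfolding fisch_zonal_harmonic[OF n lap_zonal[OF n y]] fisch_commute[of n i "(mulE n z ^^ i) mone"]
    by (rule fisch_power_zonal[OF n z])
  then have "gegen n i (dotp n y z) = C * fisch n i (zonal n y i) (zonal n z i)"
    by (simp add: C_def field_simps fisch_commute)
  \<comment> \<open>The positive weight is split as a product of two square roots, one for each
    argument, which makes the kernel a Gram kernel.\<close>
  also have "\<dots> = (\<Sum>m\<in>mindex n i. (sqrt (C * (\<Prod>i=1..n. fact (m i))) * zonal n y i m) *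
       (sqrt (C * (\<Prod>i=1..n. fact (m i))) * zonal n z i m))"
  proof -
    have r: "(r * a) * (r * b) = r * r * (a * b)" for r a b :: real by (simp only: ac_simps)
    have "0 \<le> C * (\<Prod>i=1..n. fact (m i))" for m :: "nat \<Rightarrow> nat"
      using C by (intro mult_nonneg_nonneg prod_nonneg) auto
    then have "(sqrt (C * (\<Prod>i=1..n. fact (m i))) * a) * (sqrt (C * (\<Prod>i=1..n. fact (m i))) * b)
        = C * ((\<Prod>i=1..n. fact (m i)) * a * b)" for m :: "nat \<Rightarrow> nat" and a b
      unfolding r by (simp add: mult.assoc)
    then show ?thesis unfolding fisch_def sum_distrib_left by (intro sum.cong refl) (rule sym)
  qed
  finally show "gegen n i (dotp n y z) = (\<Sum>m\<in>mindex n i.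
       (\<lambda>y m. sqrt (C * (\<Prod>i=1..n. fact (m i))) * zonal n y i m) y m *
       (\<lambda>y m. sqrt (C * (\<Prod>i=1..n. fact (m i))) * zonal n y i m) z m)" .
qed

section \<open>The linear programming bound for spherical codes\<close>

text \<open>The entrywise product of two Gram matrices is the Gram matrix of the tensor products
  \<open>Y x p * Z x q\<close> (Schur), and its entries add up to the squared norm of the sum of
  these tensors.\<close>

lemma gram_product_sum:
  fixes Y :: "'a \<Rightarrow> 'b \<Rightarrow> real" and Z :: "'a \<Rightarrow> 'c \<Rightarrow> real"
  shows "(\<Sum>x\<in>X. \<Sum>y\<in>X. (\<Sum>p\<in>I. Y x p * Y y p) * (\<Sum>q\<in>J. Z x q * Z y q))
    = (\<Sum>p\<in>I. \<Sum>q\<in>J. (\<Sum>x\<in>X. Y x p * Z x q)\<^sup>2)"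
proof -
  have "(\<Sum>p\<in>I. \<Sum>q\<in>J. (\<Sum>x\<in>X. Y x p * Z x q)\<^sup>2)
    = (\<Sum>p\<in>I. \<Sum>q\<in>J. \<Sum>x\<in>X. \<Sum>y\<in>X. (Y x p * Y y p) * (Z x q * Z y q))"
    by (simp add: power2_eq_square sum_product mult_ac)
  also have "\<dots> = (\<Sum>p\<in>I. \<Sum>x\<in>X. \<Sum>q\<in>J. \<Sum>y\<in>X. (Y x p * Y y p) * (Z x q * Z y q))"
    by (intro sum.cong refl sum.swap)
  also have "\<dots> = (\<Sum>p\<in>I. \<Sum>x\<in>X. \<Sum>y\<in>X. \<Sum>q\<in>J. (Y x p * Y y p) * (Z x q * Z y q))"
    by (intro sum.cong refl sum.swap)
  also have "\<dots> = (\<Sum>x\<in>X. \<Sum>p\<in>I. \<Sum>y\<in>X. \<Sum>q\<in>J. (Y x p * Y y p) * (Z x q * Z y q))"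
    by (rule sum.swap)
  also have "\<dots> = (\<Sum>x\<in>X. \<Sum>y\<in>X. \<Sum>p\<in>I. \<Sum>q\<in>J. (Y x p * Y y p) * (Z x q * Z y q))"
    by (intro sum.cong refl sum.swap)
  finally show ?thesis by (simp add: sum_product)
qed

lemma sum_gegen_product_nonneg:
  assumes n: "n \<ge> 3" and X: "\<And>x. x \<in> X \<Longrightarrow> dotp n x x = 1"
  shows "(\<Sum>x\<in>X. \<Sum>y\<in>X. gegen n i (dotp n x y) * gegen n k (dotp n x y)) \<ge> 0"
proof -
  obtain Y where Y: "\<And>y z. dotp n y y = 1 \<Longrightarrow> dotp n z z = 1 \<Longrightarrow>
       gegen n i (dotp n y z) = (\<Sum>m\<in>mindex n i. Y y m * Y z m)"
    by (rule gegen_gram[OF n, where i = i]) blast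
  obtain Z where Z: "\<And>y z. dotp n y y = 1 \<Longrightarrow> dotp n z z = 1 \<Longrightarrow>
       gegen n k (dotp n y z) = (\<Sum>m\<in>mindex n k. Z y m * Z z m)"
    by (rule gegen_gram[OF n, where i = k]) blast
  have "(\<Sum>x\<in>X. \<Sum>y\<in>X. gegen n i (dotp n x y) * gegen n k (dotp n x y))
      = (\<Sum>x\<in>X. \<Sum>y\<in>X. (\<Sum>p\<in>mindex n i. Y x p * Y y p) * (\<Sum>q\<in>mindex n k. Z x q * Z y q))"
    by (intro sum.cong refl arg_cong2[where f = "(*)"] Y Z X)
  then show ?thesis unfolding gram_product_sum by (simp add: sum_nonneg)
qed

text \<open>Plays the part of the constant coefficient \<open>1 / h\<^sub>i\<close> of \<open>Q\<^sub>i\<^sup>2\<close>: a positive semidefinite matrix of rank at most \<open>h\<^sub>i\<close>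
  and trace \<open>N\<close> has squared Frobenius norm at least \<open>N\<^sup>2 / h\<^sub>i\<close>.\<close>

lemma sum_gegen_square_ge:
  assumes n: "n \<ge> 3" and X: "\<And>x. x \<in> X \<Longrightarrow> dotp n x x = 1"
  shows "(\<Sum>x\<in>X. \<Sum>y\<in>X. (gegen n i (dotp n x y))\<^sup>2) \<ge> (real (card X))\<^sup>2 / real (card (mindex n i))"
proof -
  obtain Y where Y: "\<And>y z. dotp n y y = 1 \<Longrightarrow> dotp n z z = 1 \<Longrightarrow>
       gegen n i (dotp n y z) = (\<Sum>m\<in>mindex n i. Y y m * Y z m)"
    by (rule gegen_gram[OF n, where i = i]) blast
  let ?I = "mindex n i"
  have "real (card X) = (\<Sum>x\<in>X. gegen n i (dotp n x x))"
    using X gegen_1[OF n] by simp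
  also have "\<dots> = (\<Sum>x\<in>X. \<Sum>p\<in>?I. Y x p * Y x p)"
    by (intro sum.cong refl Y X)
  \<comment> \<open>The matrix of the sums \<open>\<Sum>x\<in>X. Y x p * Y x q\<close>, indexed by
    \<open>?I\<close>, has the same trace and Frobenius norm as the Gram matrix on \<open>X\<close>;
    Cauchy-Schwarz on its \<open>card ?I\<close> diagonal entries suffices.\<close>
  also have "\<dots> = (\<Sum>p\<in>?I. 1 * (\<Sum>x\<in>X. Y x p * Y x p))"
    by (subst sum.swap) simp
  finally have "(real (card X))\<^sup>2 \<le> (\<Sum>p\<in>?I. 1\<^sup>2) * (\<Sum>p\<in>?I. (\<Sum>x\<in>X. Y x p * Y x p)\<^sup>2)"
    using Cauchy_Schwarz_ineq_sum[of "\<lambda>_. 1" "\<lambda>p. \<Sum>x\<in>X. Y x p * Y x p" ?I] by simp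
  also have "(\<Sum>p\<in>?I. (\<Sum>x\<in>X. Y x p * Y x p)\<^sup>2) \<le> (\<Sum>p\<in>?I. \<Sum>q\<in>?I. (\<Sum>x\<in>X. Y x p * Y x q)\<^sup>2)"
  proof (rule sum_mono)
    fix p assume "p \<in> ?I"
    then show "(\<Sum>x\<in>X. Y x p * Y x p)\<^sup>2 \<le> (\<Sum>q\<in>?I. (\<Sum>x\<in>X. Y x p * Y x q)\<^sup>2)"
      using member_le_sum[of p ?I "\<lambda>q. (\<Sum>x\<in>X. Y x p * Y x q)\<^sup>2"] finite_mindex by simp
  qed
  also have "\<dots> = (\<Sum>x\<in>X. \<Sum>y\<in>X. (\<Sum>p\<in>?I. Y x p * Y y p) * (\<Sum>q\<in>?I. Y x q * Y y q))"
    by (rule gram_product_sum[symmetric])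
  also have "\<dots> = (\<Sum>x\<in>X. \<Sum>y\<in>X. (gegen n i (dotp n x y))\<^sup>2)"
    unfolding power2_eq_square by (intro sum.cong refl arg_cong2[where f = "(*)"] Y[symmetric] X)
  finally have "(real (card X))\<^sup>2 \<le> real (card ?I) * (\<Sum>x\<in>X. \<Sum>y\<in>X. (gegen n i (dotp n x y))\<^sup>2)"
    by (simp add: mult_left_mono)
  moreover have "(\<Sum>x\<in>X. \<Sum>y\<in>X. (gegen n i (dotp n x y))\<^sup>2) \<ge> 0"
    by (simp add: sum_nonneg)
  ultimately show ?thesis
    by (cases "card ?I = 0") (auto simp: field_simps)
qed

text \<open>The function \<open>(t - s) * F(t)\<^sup>2\<close> is summed over all pairs of code
  points. Off the diagonal it is nonpositive. Expanded into products of two Gegenbauer polynomials,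
  the sum is bounded below by the squares alone, because the mixed products have nonnegative
  sums.\<close>

lemma delsarte_bound:
  fixes p g :: "nat \<Rightarrow> real"
  assumes n: "n \<ge> 3" and fin: "finite X"
    and X: "\<And>x. x \<in> X \<Longrightarrow> dotp n x x = 1"
    and sep: "\<And>x y. x \<in> X \<Longrightarrow> y \<in> X \<Longrightarrow> x \<noteq> y \<Longrightarrow> dotp n x y \<le> s"
    and p: "\<And>i. p i \<ge> 0" and g: "\<And>i. g i \<ge> 0"
    and eq: "\<And>t. (t - s) * (\<Sum>i\<le>k. p i * gegen n i t) = (\<Sum>i\<le>k. g i * gegen n i t)"
  shows "real (card X) * (\<Sum>i\<le>k. g i * p i / card (mindex n i)) \<le> (1 - s) * (\<Sum>i\<le>k. p i)\<^sup>2"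
proof (cases "X = {}")
  \<comment> \<open>For the empty code the right side must be shown nonnegative; its sign comes from
    the coefficient identity at \<open>t = 1\<close>.\<close>
  case True
  have "(1 - s) * (\<Sum>i\<le>k. p i) = (\<Sum>i\<le>k. g i)"
    using eq[of 1] gegen_1[OF n] by simp
  then have "(1 - s) * (\<Sum>i\<le>k. p i)\<^sup>2 = (\<Sum>i\<le>k. g i) * (\<Sum>i\<le>k. p i)"
    by (simp add: power2_eq_square flip: mult.assoc)
  also have "\<dots> \<ge> 0" by (intro mult_nonneg_nonneg sum_nonneg g p)
  finally show ?thesis using True by simp
next
  case False
  define N where "N = real (card X)"
  have N: "N > 0" using False fin by (simp add: N_def card_gt_0_iff)
  define F where "F = (\<lambda>t. \<Sum>i\<le>k. p i * gegen n i t)"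
  have "N\<^sup>2 * (\<Sum>i\<le>k. g i * p i / card (mindex n i))
      = (\<Sum>i\<le>k. g i * p i * (N\<^sup>2 / card (mindex n i)))"
    by (simp add: sum_distrib_left mult_ac)
  also have "\<dots> \<le> (\<Sum>i\<le>k. g i * p i * (\<Sum>x\<in>X. \<Sum>y\<in>X. gegen n i (dotp n x y) * gegen n i (dotp n x y)))"
    unfolding N_def using sum_gegen_square_ge[OF n X]
    by (intro sum_mono mult_left_mono mult_nonneg_nonneg g p) (auto simp: power2_eq_square)
  also have "\<dots> \<le> (\<Sum>i\<le>k. \<Sum>l\<le>k. g i * p l * (\<Sum>x\<in>X. \<Sum>y\<in>X. gegen n i (dotp n x y) * gegen n l (dotp n x y)))"
  proof (rule sum_mono)
    fix i assume i: "i \<in> {..k}"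
    show "g i * p i * (\<Sum>x\<in>X. \<Sum>y\<in>X. gegen n i (dotp n x y) * gegen n i (dotp n x y)) \<le>
       (\<Sum>l\<le>k. g i * p l * (\<Sum>x\<in>X. \<Sum>y\<in>X. gegen n i (dotp n x y) * gegen n l (dotp n x y)))"
      using i sum_gegen_product_nonneg[OF n X]
      by (intro member_le_sum[where f = "\<lambda>l. g i * p l * (\<Sum>x\<in>X. \<Sum>y\<in>X. gegen n i (dotp n x y) * gegen n l (dotp n x y))"])
         (auto intro!: mult_nonneg_nonneg g p)
  qed
  also have "\<dots> = (\<Sum>x\<in>X. \<Sum>y\<in>X. (\<Sum>i\<le>k. g i * gegen n i (dotp n x y)) * F (dotp n x y))"
  proof -
    have "(\<Sum>x\<in>X. \<Sum>y\<in>X. (\<Sum>i\<le>k. g i * gegen n i (dotp n x y)) * F (dotp n x y))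
      = (\<Sum>x\<in>X. \<Sum>y\<in>X. \<Sum>i\<le>k. \<Sum>l\<le>k. g i * p l * (gegen n i (dotp n x y) * gegen n l (dotp n x y)))"
      unfolding F_def sum_product by (intro sum.cong refl) (simp add: mult_ac)
    also have "\<dots> = (\<Sum>x\<in>X. \<Sum>i\<le>k. \<Sum>l\<le>k. \<Sum>y\<in>X. g i * p l * (gegen n i (dotp n x y) * gegen n l (dotp n x y)))"
      by (intro sum.cong refl) (subst sum.swap, intro sum.cong refl sum.swap)
    also have "\<dots> = (\<Sum>i\<le>k. \<Sum>l\<le>k. \<Sum>x\<in>X. \<Sum>y\<in>X. g i * p l * (gegen n i (dotp n x y) * gegen n l (dotp n x y)))"
      by (subst sum.swap, intro sum.cong refl sum.swap)
    finally show ?thesis by (simp add: sum_distrib_left)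
  qed
  also have "\<dots> = (\<Sum>x\<in>X. \<Sum>y\<in>X. (dotp n x y - s) * (F (dotp n x y))\<^sup>2)"
    by (simp add: eq[symmetric] power2_eq_square mult.assoc F_def)
  also have "\<dots> \<le> (\<Sum>x\<in>X. \<Sum>y\<in>X. if y = x then (1 - s) * (F 1)\<^sup>2 else 0)"
  proof (intro sum_mono)
    fix x y assume xy: "x \<in> X" "y \<in> X"
    show "(dotp n x y - s) * (F (dotp n x y))\<^sup>2 \<le> (if y = x then (1 - s) * (F 1)\<^sup>2 else 0)"
    proof (cases "y = x")
      case True
      then show ?thesis using X xy by simp
    next
      case False
      then have "dotp n x y \<le> s" using sep xy by metis
      then show ?thesis using False by (simp add: mult_nonpos_nonneg)
    qed
  qed
  also have "\<dots> = N * ((1 - s) * (F 1)\<^sup>2)"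
    using fin by (simp add: N_def sum.delta)
  also have "F 1 = (\<Sum>i\<le>k. p i)" by (simp add: F_def gegen_1[OF n])
  finally have "N * (N * (\<Sum>i\<le>k. g i * p i / card (mindex n i))) \<le> N * ((1 - s) * (\<Sum>i\<le>k. p i)\<^sup>2)"
    by (simp add: power2_eq_square mult.assoc)
  then show ?thesis using N by (simp add: N_def)
qed

text \<open>The new coefficients are those of the transposed Jacobi matrix minus \<open>s\<close>,
  applied to \<open>p\<close>. Since \<open>p\<close> vanishes from index \<open>k\<close> on,
  multiplication by \<open>t\<close> stays within degree \<open>k\<close>.\<close>

lemma gegen_expansion:
  assumes n: "n \<ge> 3" and p: "\<And>i. i \<ge> k \<Longrightarrow> p i = 0"
  shows "(t - s) * (\<Sum>i\<le>k. p i * gegen n i t) =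
    (\<Sum>i\<le>k. ((if i = 0 then 0 else gA n (i - 1) * p (i - 1)) + gB n (Suc i) * p (Suc i) - s * p i) * gegen n i t)"
proof -
  have "t * (\<Sum>i\<le>k. p i * gegen n i t) = (\<Sum>i\<le>k. p i * (gA n i * gegen n (Suc i) t + gB n i * gegen n (i - 1) t))"
    unfolding gegen_rec[OF n, symmetric] by (simp add: sum_distrib_left mult_ac)
  also have "\<dots> = (\<Sum>i\<le>k. p i * gA n i * gegen n (Suc i) t) + (\<Sum>i\<le>k. p i * gB n i * gegen n (i - 1) t)"
    by (simp add: algebra_simps sum.distrib)
  also have "(\<Sum>i\<le>k. p i * gA n i * gegen n (Suc i) t) = (\<Sum>i\<le>k. (if i = 0 then 0 else gA n (i - 1) * p (i - 1)) * gegen n i t)"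
  proof -
    have "(\<Sum>i\<le>k. p i * gA n i * gegen n (Suc i) t) = (\<Sum>i\<le>Suc k. (if i = 0 then 0 else gA n (i - 1) * p (i - 1)) * gegen n i t)"
      by (subst sum.atMost_Suc_shift) (simp add: mult_ac)
    then show ?thesis using p[of k] by simp
  qed
  also have "(\<Sum>i\<le>k. p i * gB n i * gegen n (i - 1) t) = (\<Sum>i\<le>k. gB n (Suc i) * p (Suc i) * gegen n i t)"
  proof -
    have "(\<Sum>i\<le>k. p i * gB n i * gegen n (i - 1) t) = (\<Sum>i\<le>Suc k. p i * gB n i * gegen n (i - 1) t)"
      using p[of "Suc k"] by simp
    also have "\<dots> = (\<Sum>i\<le>k. gB n (Suc i) * p (Suc i) * gegen n i t)"
      by (subst sum.atMost_Suc_shift) (simp add: mult_ac gB_def)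
    finally show ?thesis .
  qed
  finally show ?thesis
    by (simp add: algebra_simps sum.distrib sum_subtractf sum_distrib_left)
qed

section \<open>Comparison with a Jacobi matrix of constant entries\<close>

lemma gA_antimono: "n \<ge> 3 \<Longrightarrow> i \<le> j \<Longrightarrow> gA n j \<le> gA n i"
proof -
  assume n: "n \<ge> 3" and ij: "i \<le> j"
  have "gA n l = 1 / 2 + (real n - 2) / 2 / (2 * real l + real n - 2)" for l
    using n by (simp add: gA_def field_simps)
  then show ?thesis using n ij by (auto intro!: divide_left_mono mult_pos_pos)
qed

lemma gB_mono: "n \<ge> 3 \<Longrightarrow> i \<le> j \<Longrightarrow> gB n i \<le> gB n j"
  using gA_antimono[of n i j] gA_gB[of n i] gA_gB[of n j] by linarith

lemma card_mindex_pos: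
  assumes "n \<ge> 1"
  shows "card (mindex n d) > 0"
proof -
  have "(\<lambda>i. if i = 1 then d else 0) \<in> mindex n d"
    using assms by (auto simp: mindex_def)
  then show ?thesis using finite_mindex card_gt_0_iff by blast
qed

text \<open>Inside the window \<open>{k-L..k}\<close> the true Jacobi entries dominate the constants
  \<open>a\<close> and \<open>b\<close> by monotonicity, so the Perron vector of the constant matrix
  satisfies \<open>g i \<ge> \<eta> * p i\<close>. Once \<open>g\<close> is replaced by
  \<open>\<eta> * p\<close>, the weighted norm \<open>P\<close> occurs on both sides of Delsarte's
  inequality and cancels.\<close>

lemma code_card_bound:
  fixes a b s \<eta> :: real
  assumes n: "n \<ge> 3" and fin: "finite X"
    and X: "\<And>x. x \<in> X \<Longrightarrow> dotp n x x = 1"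
    and sep: "\<And>x y. x \<in> X \<Longrightarrow> y \<in> X \<Longrightarrow> x \<noteq> y \<Longrightarrow> dotp n x y \<le> s"
    and L: "2 \<le> L" "L \<le> k" and s: "s \<le> 1"
    and a: "0 < a" "a \<le> gA n k" and b: "0 < b" "b \<le> gB n (k - L)"
    and \<eta>: "0 < \<eta>" "s + \<eta> \<le> 2 * sqrt (a * b) * cos (pi / real L)"
  shows "real (card X) \<le> (1 - s) / \<eta> * (\<Sum>i\<in>{k-L..k}. real (card (mindex n i)))"
proof -
  \<comment> \<open>Conjugation by powers of \<open>\<rho>\<close> makes the constant matrix
    symmetric, with both off-diagonal entries equal to \<open>sqrt (a * b)\<close>; this is the
    content of \<open>r1\<close> and \<open>r2\<close>.\<close>
  define \<rho> where "\<rho> = sqrt (a / b)"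
  have \<rho>: "\<rho> > 0" using a b by (simp add: \<rho>_def)
  have r1: "a / \<rho> = sqrt (a * b)"
    using a b by (simp add: \<rho>_def real_sqrt_divide real_sqrt_mult field_simps)
  have r2: "b * \<rho> = sqrt (a * b)"
    using a b by (simp add: \<rho>_def real_sqrt_divide real_sqrt_mult field_simps)
  \<comment> \<open>the Perron vector of the tridiagonal matrix with constant off-diagonal entries \<open>a\<close> and \<open>b\<close>\<close>
  define p where "p = (\<lambda>i. if k - L \<le> i \<and> i \<le> k then \<rho> ^ i * sin (pi * (real i + real L - real k) / real L) else 0)"
  define h where "h = (\<lambda>i. real (card (mindex n i)))"
  have h: "h i > 0" for i using card_mindex_pos[of n i] n by (simp add: h_def)
  have ang: "0 \<le> pi * (real i + real L - real k) / real L \<and> pi * (real i + real L - real k) / real L \<le> pi"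
    if "k - L \<le> i" "i \<le> k" for i
    using that L by (auto simp: divide_le_eq intro!: mult_left_mono divide_nonneg_nonneg mult_nonneg_nonneg)
  have p0: "p i \<ge> 0" for i
    unfolding p_def using ang[of i] \<rho> by (auto intro!: mult_nonneg_nonneg sin_ge_zero)
  have pk: "p i = 0" if "i \<ge> k" for i
    using that L by (auto simp: p_def)
  have pl: "p i = 0" if "i \<le> k - L" for i
    using that L by (auto simp: p_def of_nat_diff)
  define g where "g = (\<lambda>i. (if i = 0 then 0 else gA n (i - 1) * p (i - 1)) + gB n (Suc i) * p (Suc i) - s * p i)"
  have gge: "g i \<ge> \<eta> * p i" for i
  proof (cases "k - L < i \<and> i < k")
    case True
    define \<beta> where "\<beta> = pi * (real i + real L - real k) / real L"
    define \<kappa> where "\<kappa> = pi / real L"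
    have i0: "i \<noteq> 0" using True by auto
    have e0: "p i = \<rho> ^ i * sin \<beta>" using True by (simp add: p_def \<beta>_def)
    have em: "p (i - 1) = \<rho> ^ i / \<rho> * sin (\<beta> - \<kappa>)"
    proof -
      have "pi * (real (i - 1) + real L - real k) / real L = \<beta> - \<kappa>"
        using i0 L by (simp add: \<beta>_def \<kappa>_def of_nat_diff field_simps)
      moreover have "\<rho> ^ (i - 1) = \<rho> ^ i / \<rho>"
        using i0 \<rho> by (cases i) auto
      moreover have "k - L \<le> i - 1 \<and> i - 1 \<le> k" using True by auto
      ultimately show ?thesis by (simp add: p_def)
    qed
    have ep: "p (Suc i) = \<rho> ^ i * \<rho> * sin (\<beta> + \<kappa>)"
    proof -
      have "pi * (real (Suc i) + real L - real k) / real L = \<beta> + \<kappa>"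
        using L by (simp add: \<beta>_def \<kappa>_def field_simps)
      then show ?thesis using True by (simp add: p_def)
    qed
    have "(s + \<eta>) * p i \<le> 2 * sqrt (a * b) * cos \<kappa> * p i"
      using \<eta>(2) p0 by (intro mult_right_mono) (auto simp: \<kappa>_def)
    also have "\<dots> = \<rho> ^ i * (a / \<rho> * sin (\<beta> - \<kappa>) + b * \<rho> * sin (\<beta> + \<kappa>))"
      unfolding r1 r2 e0 by (simp add: sin_add sin_diff algebra_simps)
    also have "\<dots> = a * p (i - 1) + b * p (Suc i)"
      unfolding em ep by (simp add: algebra_simps)
    also have "\<dots> \<le> gA n (i - 1) * p (i - 1) + gB n (Suc i) * p (Suc i)"
    proof -
      have "gA n k \<le> gA n (i - 1)" "gB n (k - L) \<le> gB n (Suc i)"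
        using True gA_antimono[OF n, of "i - 1" k] gB_mono[OF n, of "k - L" "Suc i"] by linarith+
      then show ?thesis using a b by (intro add_mono mult_right_mono p0) linarith+
    qed
    finally show ?thesis using i0 by (simp add: g_def algebra_simps)
  next
    case False
    \<comment> \<open>The sine vanishes at both ends of the window, so outside its interior
      \<open>g i \<ge> 0\<close> is enough.\<close>
    then have "p i = 0" using pk pl by (metis not_less)
    then show ?thesis
      using p0 gA_pos[OF n] gB_nonneg[OF n] by (auto simp: g_def less_imp_le)
  qed
  have g0: "g i \<ge> 0" for i
    using gge[of i] p0[of i] \<eta>(1) by (meson less_imp_le mult_nonneg_nonneg order_trans)
  define P where "P = (\<Sum>i\<le>k. (p i)\<^sup>2 / h i)"
  \<comment> \<open>The index \<open>k - 1\<close> is interior to the window because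
    \<open>L \<ge> 2\<close>.\<close>
  have Ppos: "P > 0"
  proof -
    have p1: "pi * (real (k - 1) + real L - real k) / real L < pi" "pi * (real (k - 1) + real L - real k) / real L > 0"
      using L by (auto simp: field_simps of_nat_diff)
    have "p (k - 1) > 0"
      using L sin_gt_zero[OF p1(2,1)] \<rho> by (auto simp: p_def intro!: mult_pos_pos)
    then have "(p (k - 1))\<^sup>2 / h (k - 1) > 0" using h by simp
    moreover have "(p (k - 1))\<^sup>2 / h (k - 1) \<le> P"
      unfolding P_def using h by (intro member_le_sum[where f="\<lambda>i. (p i)\<^sup>2 / h i"]) (auto intro!: divide_nonneg_pos)
    ultimately show ?thesis by simp
  qed
  have "real (card X) * (\<eta> * P) \<le> real (card X) * (\<Sum>i\<le>k. g i * p i / h i)"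
  proof (intro mult_left_mono)
    have "\<eta> * P = (\<Sum>i\<le>k. \<eta> * p i * p i / h i)"
      by (simp add: P_def sum_distrib_left power2_eq_square mult_ac)
    also have "\<dots> \<le> (\<Sum>i\<le>k. g i * p i / h i)"
      using h by (intro sum_mono divide_right_mono mult_right_mono gge p0) (auto intro: less_imp_le)
    finally show "\<eta> * P \<le> (\<Sum>i\<le>k. g i * p i / h i)" .
  qed auto
  also have "\<dots> \<le> (1 - s) * (\<Sum>i\<le>k. p i)\<^sup>2"
    unfolding h_def by (rule delsarte_bound[OF n fin X sep p0 g0]) (auto simp: g_def gegen_expansion[OF n pk])
  also have "\<dots> \<le> (1 - s) * (P * (\<Sum>i\<in>{k-L..k}. h i))"
  proof (rule mult_left_mono)
    have "(\<Sum>i\<le>k. p i) = (\<Sum>i\<in>{k-L..k}. p i)"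
      by (rule sum.mono_neutral_right) (auto simp: p_def)
    \<comment> \<open>The weights \<open>sqrt (h i)\<close> are chosen so that Cauchy-Schwarz
      produces the same \<open>P\<close> as the left side.\<close>
    also have "\<dots> = (\<Sum>i\<in>{k-L..k}. (p i / sqrt (h i)) * sqrt (h i))"
      using h by (intro sum.cong refl) (simp add: less_imp_neq[THEN not_sym])
    finally have "(\<Sum>i\<le>k. p i)\<^sup>2 \<le> (\<Sum>i\<in>{k-L..k}. (p i / sqrt (h i))\<^sup>2) * (\<Sum>i\<in>{k-L..k}. (sqrt (h i))\<^sup>2)"
      using Cauchy_Schwarz_ineq_sum[of "\<lambda>i. p i / sqrt (h i)" "\<lambda>i. sqrt (h i)" "{k-L..k}"] by simp
    also have "\<dots> = (\<Sum>i\<in>{k-L..k}. (p i)\<^sup>2 / h i) * (\<Sum>i\<in>{k-L..k}. h i)"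
      using h by (simp add: power_divide less_imp_le)
    also have "(\<Sum>i\<in>{k-L..k}. (p i)\<^sup>2 / h i) = P"
      unfolding P_def by (rule sum.mono_neutral_left) (auto simp: p_def)
    finally show "(\<Sum>i\<le>k. p i)\<^sup>2 \<le> P * (\<Sum>i\<in>{k-L..k}. h i)" .
  qed (use s in auto)
  finally have "real (card X) * \<eta> * P \<le> (1 - s) * (\<Sum>i\<in>{k-L..k}. h i) * P"
    by (simp add: mult_ac)
  then have "real (card X) * \<eta> \<le> (1 - s) * (\<Sum>i\<in>{k-L..k}. h i)"
    using Ppos by simp
  then show ?thesis using \<eta>(1) by (simp add: h_def field_simps)
qed

section \<open>Asymptotics of the code bound\<close>

definition spherical_code :: "nat \<Rightarrow> real \<Rightarrow> (nat \<Rightarrow> real) set \<Rightarrow> bool" where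
  "spherical_code n s X \<longleftrightarrow> finite X \<and> (\<forall>x\<in>X. dotp n x x = 1) \<and>
     (\<forall>x\<in>X. \<forall>y\<in>X. x \<noteq> y \<longrightarrow> dotp n x y \<le> s)"

text \<open>For degrees near \<open>b * n\<close> the Jacobi matrix tends to one with constant
  entries and spectral radius \<open>2 * sqrt (a0 * b0)\<close>. The ratio \<open>a\<close> is the
  one at which this equals \<open>cos \<theta>\<close>; any \<open>b > a\<close> leaves a
  gap.\<close>

theorem kabatiansky_levenshtein:
  fixes \<theta> b :: real
  assumes \<theta>: "0 < \<theta>" "\<theta> < pi / 2"
  defines "a \<equiv> (1 - sin \<theta>) / (2 * sin \<theta>)"
  assumes b: "a < b"
  shows "\<exists>C>0. \<forall>\<^sub>F n in sequentially. \<forall>X. spherical_code n (cos \<theta>) X \<longrightarrow>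
     real (card X) \<le> C * (1 + a) ^ n * ((1 + a) / a) powr (b * real n)"
proof -
  define s where "s = cos \<theta>"
  have sin: "0 < sin \<theta>" "sin \<theta> < 1"
    using \<theta> sin_gt_zero sin_monotone_2pi[of \<theta> "pi/2"] by auto
  have s: "0 < s" "s < 1" using \<theta> cos_gt_zero cos_monotone_0_pi[of 0 \<theta>] by (auto simp: s_def)
  have a: "a > 0" using sin by (simp add: a_def)
  then have bpos: "b > 0" using b by simp
  define x where "x = a / (1 + a)"
  have x: "0 < x" "x < 1" "1 - x = 1 / (1 + a)" "1 / x = (1 + a) / a"
    using a by (auto simp: x_def field_simps)
  \<comment> \<open>\<open>a0\<close> and \<open>b0\<close> are the limits of \<open>gA n k\<close>
    and \<open>gB n k\<close> when \<open>k / n\<close> tends to \<open>b\<close>.\<close>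
  define a0 where "a0 = (1 + b) / (1 + 2 * b)"
  define b0 where "b0 = b / (1 + 2 * b)"
  have ab0: "a0 > 0" "b0 > 0" using bpos by (auto simp: a0_def b0_def)
  define m where "m = 2 * sqrt (a0 * b0)"
  have ms: "m > s"
  proof -
    have "s\<^sup>2 = 1 - (sin \<theta>)\<^sup>2" by (simp add: s_def cos_squared_eq)
    also have "sin \<theta> = 1 / (1 + 2 * a)" using sin by (simp add: a_def field_simps)
    also have "1 - (1 / (1 + 2 * a))\<^sup>2 < 1 - (1 / (1 + 2 * b))\<^sup>2"
    proof -
      have "1 / (1 + 2 * b) < 1 / (1 + 2 * a)" using a b by (simp add: frac_less2)
      then have "(1 / (1 + 2 * b))\<^sup>2 < (1 / (1 + 2 * a))\<^sup>2"
        using bpos by (intro power_strict_mono) auto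
      then show ?thesis by simp
    qed
    also have "\<dots> = 4 * (a0 * b0)"
      using bpos by (simp add: a0_def b0_def power2_eq_square divide_simps) (simp add: algebra_simps)
    also have "\<dots> = m\<^sup>2" using ab0 by (simp add: m_def power_mult_distrib)
    finally show ?thesis using ab0 by (intro power2_less_imp_less[of s m]) (auto simp: m_def)
  qed
  \<comment> \<open>A loss of one factor \<open>e\<close> is allowed in passing to the limits
    \<open>a0\<close> and \<open>b0\<close>, and another for the cosine of \<open>pi / L\<close>.
    Their total effect \<open>e * e * m\<close> is the midpoint of \<open>s\<close> and
    \<open>m\<close>, so the gap \<eta> is positive.\<close>
  define e where "e = sqrt ((1 + s / m) / 2)"
  have q: "s / m < 1" "0 < s / m" using ms s by auto
  have e: "0 < e" "e < 1" "e * e = (1 + s / m) / 2"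
    using q by (auto simp: e_def)
  define \<eta> where "\<eta> = e * e * m - s"
  have \<eta>: "\<eta> > 0" using ms s unfolding \<eta>_def e(3) by (simp add: field_simps)
  \<comment> \<open>The window length \<open>L\<close> does not depend on \<open>n\<close>, so
    summing over the window costs only a constant factor.\<close>
  have "((\<lambda>L. cos (pi / real L)) \<longlongrightarrow> cos 0) sequentially"
    by (intro tendsto_intros lim_const_over_n)
  then have "\<forall>\<^sub>F L in sequentially. e < cos (pi / real L)"
    using e(2) by (intro order_tendstoD(1)) auto
  moreover have "\<forall>\<^sub>F L in sequentially. L \<ge> (2::nat)" by (rule eventually_ge_at_top)
  ultimately obtain L where L: "e < cos (pi / real L)" "2 \<le> L"
    using eventually_happens'[OF sequentially_bot eventually_conj] by blast
  define K where "K = (\<lambda>n. nat \<lfloor>b * real n\<rfloor>)"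
  have K: "real (K n) \<le> b * real n" "b * real n < real (K n) + 1" for n
  proof -
    have "0 \<le> \<lfloor>b * real n\<rfloor>" using bpos by simp
    then have "real (K n) = of_int \<lfloor>b * real n\<rfloor>" by (simp add: K_def)
    then show "real (K n) \<le> b * real n" "b * real n < real (K n) + 1" by linarith+
  qed
  have Kn: "(\<lambda>n. real (K n) / real n) \<longlonglongrightarrow> b"
  proof (rule tendsto_sandwich[of "\<lambda>n. b - 1 / real n" _ _ "\<lambda>n. b"])
    show "\<forall>\<^sub>F n in sequentially. b - 1 / real n \<le> real (K n) / real n"
      using eventually_gt_at_top[of 0]
    proof eventually_elim
      case (elim n)
      have "b - 1 / real n = (b * real n - 1) / real n" using elim by (simp add: field_simps)
      also have "\<dots> \<le> real (K n) / real n" using K(2)[of n] by (intro divide_right_mono) auto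
      finally show ?case .
    qed
    show "\<forall>\<^sub>F n in sequentially. real (K n) / real n \<le> b"
      using eventually_gt_at_top[of 0] by eventually_elim (use K in \<open>auto simp: field_simps\<close>)
    show "(\<lambda>n. b - 1 / real n) \<longlonglongrightarrow> b"
      using tendsto_diff[OF tendsto_const lim_const_over_n[of 1]] by simp
  qed auto
  have Klarge: "\<forall>\<^sub>F n in sequentially. K n \<ge> L"
  proof -
    have "filterlim (\<lambda>n. b * real n) at_top sequentially"
      using bpos by (intro filterlim_tendsto_pos_mult_at_top[OF tendsto_const] filterlim_real_sequentially)
    then have "\<forall>\<^sub>F n in sequentially. b * real n \<ge> real L + 1" by (simp add: filterlim_at_top)
    then show ?thesis by eventually_elim (use K in \<open>smt (verit) of_nat_le_iff\<close>)
  qed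
  have lim: "(\<lambda>n. gA n (k n)) \<longlonglongrightarrow> a0" if k: "(\<lambda>n. real (k n) / real n) \<longlonglongrightarrow> b" for k
  proof -
    have "(\<lambda>n. (real (k n) / real n + 1 - 2 / real n) / (2 * (real (k n) / real n) + 1 - 2 / real n))
       \<longlonglongrightarrow> (b + 1 - 0) / (2 * b + 1 - 0)"
      using bpos by (intro tendsto_intros k lim_const_over_n) auto
    moreover have "\<forall>\<^sub>F n in sequentially. (real (k n) / real n + 1 - 2 / real n) / (2 * (real (k n) / real n) + 1 - 2 / real n) = gA n (k n)"
      using eventually_gt_at_top[of 0]
    proof eventually_elim
      case (elim n)
      have "real (k n) / real n + 1 - 2 / real n = (real (k n) + real n - 2) / real n"
        "2 * (real (k n) / real n) + 1 - 2 / real n = (2 * real (k n) + real n - 2) / real n"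
        using elim by (auto simp: field_simps)
      then show ?case using elim by (simp add: gA_def)
    qed
    ultimately show ?thesis by (simp add: a0_def add.commute filterlim_cong)
  qed
  have limB: "(\<lambda>n. gB n (K n - L)) \<longlonglongrightarrow> b0"
  proof -
    have "(\<lambda>n. real (K n) / real n - real L / real n) \<longlonglongrightarrow> b - 0"
      by (intro tendsto_intros Kn lim_const_over_n)
    moreover have "\<forall>\<^sub>F n in sequentially. real (K n) / real n - real L / real n = real (K n - L) / real n"
      using Klarge by eventually_elim (simp add: of_nat_diff diff_divide_distrib)
    ultimately have "(\<lambda>n. real (K n - L) / real n) \<longlonglongrightarrow> b" by (simp add: filterlim_cong)
    then have "(\<lambda>n. 1 - gA n (K n - L)) \<longlonglongrightarrow> 1 - a0" by (intro tendsto_intros lim)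
    moreover have "1 - a0 = b0" using bpos by (simp add: a0_def b0_def field_simps)
    moreover have "\<forall>\<^sub>F n in sequentially. 1 - gA n (K n - L) = gB n (K n - L)"
      using eventually_ge_at_top[of 3] by eventually_elim (use gA_gB in \<open>auto simp: algebra_simps\<close>)
    ultimately show ?thesis by (simp add: filterlim_cong)
  qed
  have eA: "\<forall>\<^sub>F n in sequentially. e * a0 < gA n (K n)"
    using ab0 e by (intro order_tendstoD(1)[OF lim[OF Kn]]) auto
  have eB: "\<forall>\<^sub>F n in sequentially. e * b0 < gB n (K n - L)"
    using ab0 e by (intro order_tendstoD(1)[OF limB]) auto
  define C where "C = (1 - s) / \<eta> * (real L + 1)"
  have "C > 0" using \<eta> s by (simp add: C_def)
  moreover have "\<forall>\<^sub>F n in sequentially. \<forall>X. spherical_code n (cos \<theta>) X \<longrightarrow>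
     real (card X) \<le> C * (1 + a) ^ n * ((1 + a) / a) powr (b * real n)"
    using eA eB Klarge eventually_ge_at_top[of 3]
  proof eventually_elim
    case (elim n)
    show ?case
    proof (intro allI impI)
      fix X assume X: "spherical_code n (cos \<theta>) X"
      have m': "2 * sqrt ((e * a0) * (e * b0)) = e * m"
      proof -
        have "sqrt ((e * a0) * (e * b0)) = sqrt (e\<^sup>2 * (a0 * b0))" by (simp add: power2_eq_square mult_ac)
        then show ?thesis using e by (simp add: m_def real_sqrt_mult)
      qed
      have "s + \<eta> \<le> 2 * sqrt ((e * a0) * (e * b0)) * cos (pi / real L)"
      proof -
        have "e * m * e \<le> e * m * cos (pi / real L)"
          using L e ms s by (intro mult_left_mono) auto
        then show ?thesis unfolding m' \<eta>_def by (simp add: mult_ac)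
      qed
      then have "real (card X) \<le> (1 - s) / \<eta> * (\<Sum>i\<in>{K n-L..K n}. real (card (mindex n i)))"
        using X elim L e ab0 s \<eta>
        by (intro code_card_bound[of n X s L "K n" "e * a0" "e * b0" \<eta>]) (auto simp: spherical_code_def s_def)
      also have "\<dots> \<le> (1 - s) / \<eta> * (\<Sum>i\<in>{K n-L..K n}. (1 + a) ^ n * ((1 + a) / a) powr (b * real n))"
      proof (intro mult_left_mono sum_mono)
        fix i assume i: "i \<in> {K n-L..K n}"
        have "real (card (mindex n i)) \<le> (1 / (1 - x)) ^ n * (1 / x) ^ i"
          using card_mindex_le[OF x(1,2), of n i] x(1,2) by (simp add: field_simps)
        also have "\<dots> = (1 + a) ^ n * ((1 + a) / a) powr real i"
          using a by (subst powr_realpow) (auto simp: x field_simps)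
        also have "\<dots> \<le> (1 + a) ^ n * ((1 + a) / a) powr (b * real n)"
          using a i K[of n] by (intro mult_left_mono powr_mono) (auto simp: field_simps)
        finally show "real (card (mindex n i)) \<le> (1 + a) ^ n * ((1 + a) / a) powr (b * real n)" .
      qed (use s \<eta> in auto)
      also have "\<dots> = C * (1 + a) ^ n * ((1 + a) / a) powr (b * real n)"
        using elim by (simp add: C_def of_nat_diff)
      finally show "real (card X) \<le> C * (1 + a) ^ n * ((1 + a) / a) powr (b * real n)" .
    qed
  qed
  ultimately show ?thesis by blast
qed

section \<open>Packings and spherical codes in the hyperboloid\<close>

lemma hyp_dist_nonneg: "0 \<le> hyp_dist n x y"
  using lorentz_ge_1(1)[of x n y] by (auto simp: hyp_dist_def)

lemma cosh_hyp_dist: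
  assumes "x \<in> hyp_space n" "y \<in> hyp_space n"
  shows "cosh (hyp_dist n x y) = lorentz n x y"
  using assms lorentz_ge_1(1)[of x n y] by (simp add: hyp_dist_def)

lemma hyp_dist_le_iff:
  assumes "x \<in> hyp_space n" "y \<in> hyp_space n" "0 \<le> r"
  shows "hyp_dist n x y \<le> r \<longleftrightarrow> lorentz n x y \<le> cosh r"
  using cosh_real_nonneg_le_iff[OF hyp_dist_nonneg assms(3), of n x y] cosh_hyp_dist[OF assms(1,2)] by simp

lemma hyp_dist_less_iff:
  assumes "x \<in> hyp_space n" "y \<in> hyp_space n" "0 \<le> r"
  shows "hyp_dist n x y < r \<longleftrightarrow> lorentz n x y < cosh r"
  using cosh_real_nonneg_less_iff[OF hyp_dist_nonneg assms(3), of n x y] cosh_hyp_dist[OF assms(1,2)] by simp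

lemmas in_mcball_hyp = Metric_space.in_mcball[OF Metric_space_hyp]

lemma in_hyp_cball: "0 \<le> r \<Longrightarrow> y \<in> hyp_cball n x r \<longleftrightarrow> x \<in> hyp_space n \<and> y \<in> hyp_space n \<and> lorentz n x y \<le> cosh r"
  by (auto simp: in_mcball_hyp hyp_dist_le_iff)

lemma lorentz_comb:
  "lorentz n (\<lambda>i. a * x i + b * y i) w = a * lorentz n x w + b * lorentz n y w"
  by (simp add: lorentz_def algebra_simps sum.distrib sum_distrib_left)

lemma lorentz_self: "x \<in> hyp_space n \<Longrightarrow> lorentz n x x = 1"
  by (simp add: hyp_space_def)

text \<open>A unit timelike vector lies on one of the two sheets; on the lower sheet its product
  with \<open>x\<close> would be at most \<open>-1\<close>.\<close>

lemma hyp_spaceI_lorentz_pos: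
  assumes "x \<in> hyp_space n" "\<And>i. i > n \<Longrightarrow> z i = 0" "lorentz n z z = 1" "lorentz n z x > 0"
  shows "z \<in> hyp_space n"
proof -
  have "z 0 > 0"
  proof (rule ccontr)
    assume neg: "\<not> z 0 > 0"
    have "(\<Sum>i=1..n. (z i)\<^sup>2) \<ge> 0" by (intro sum_nonneg) auto
    then have "z 0 \<noteq> 0" using assms(3) by (auto simp: lorentz_def power2_eq_square)
    with neg have "z 0 < 0" by simp
    then have "(\<lambda>i. - z i) \<in> hyp_space n"
      using assms by (auto simp: hyp_space_def lorentz_def)
    then have "lorentz n (\<lambda>i. - z i) x \<ge> 1" using assms(1) by (rule lorentz_ge_1(1))
    then show False using assms(4) by (simp add: lorentz_def sum_negf)
  qed
  then show ?thesis using assms by (simp add: hyp_space_def)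
qed

lemma hyp_midpoint:
  assumes "x \<in> hyp_space n" "y \<in> hyp_space n"
  obtains m where "m \<in> hyp_space n" "hyp_dist n x m \<le> hyp_dist n x y / 2" "hyp_dist n y m \<le> hyp_dist n x y / 2"
proof
  define L where "L = lorentz n x y"
  have L: "L \<ge> 1" using lorentz_ge_1(1)[OF assms] by (simp add: L_def)
  \<comment> \<open>\<open>2 + 2 * L\<close> is the Lorentz square of the sum of \<open>x\<close>
    and \<open>y\<close>, so \<open>c\<close> normalizes the sum to a point of the
    hyperboloid.\<close>
  define c where "c = 1 / sqrt (2 + 2 * L)"
  define m where "m = (\<lambda>i. c * x i + c * y i)"
  have c: "c > 0" "c * c * (2 + 2 * L) = 1" using L by (auto simp: c_def)
  have Lm: "lorentz n m w = c * lorentz n x w + c * lorentz n y w" for w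
    by (simp add: m_def lorentz_comb)
  have xm: "lorentz n x m = c * (1 + L)" "lorentz n y m = c * (1 + L)"
    using Lm[of x] Lm[of y] lorentz_self[OF assms(1)] lorentz_self[OF assms(2)]
    by (simp_all add: L_def lorentz_commute[of n y x] lorentz_commute[of n x m] lorentz_commute[of n y m] algebra_simps)
  have "lorentz n m m = 1"
    using Lm[of m] c(2) unfolding xm by (simp add: algebra_simps)
  then show mH: "m \<in> hyp_space n"
    using assms c by (auto simp: hyp_space_def m_def intro!: add_pos_pos mult_pos_pos)
  have "L = 2 * (cosh (hyp_dist n x y / 2))\<^sup>2 - 1"
    using cosh_hyp_dist[OF assms] cosh_double_cosh[of "hyp_dist n x y / 2"] by (simp add: L_def)
  then have "(cosh (hyp_dist n x y / 2))\<^sup>2 = c * c * (2 + 2 * L) * ((1 + L) / 2)"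
    unfolding c(2) by simp
  also have "\<dots> = (c * (1 + L))\<^sup>2"
    by (simp add: power2_eq_square field_simps)
  finally have "(cosh (hyp_dist n x y / 2))\<^sup>2 = (c * (1 + L))\<^sup>2" .
  then have "c * (1 + L) = cosh (hyp_dist n x y / 2)"
    using c L by (simp add: power2_eq_iff_nonneg)
  then show "hyp_dist n x m \<le> hyp_dist n x y / 2" "hyp_dist n y m \<le> hyp_dist n x y / 2"
    using xm assms mH hyp_dist_nonneg[of n x y]
      hyp_dist_le_iff[of x n m "hyp_dist n x y / 2"] hyp_dist_le_iff[of y n m "hyp_dist n x y / 2"] by auto
qed

text \<open>The point \<open>z\<close> continues the geodesic from \<open>y\<close> to \<open>x\<close> beyond \<open>x\<close>.\<close>

lemma hyp_extend:
  assumes "x \<in> hyp_space n" "y \<in> hyp_space n" "x \<noteq> y" "0 \<le> r"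
  obtains z where "z \<in> hyp_space n" "lorentz n x z = cosh r" "lorentz n y z > cosh r"
proof
  define d where "d = hyp_dist n x y"
  have L: "lorentz n x y = cosh d" "lorentz n x x = 1" "lorentz n y y = 1" "lorentz n y x = cosh d"
    using assms lorentz_commute[of n y x] by (simp_all add: d_def cosh_hyp_dist lorentz_self)
  have d: "d > 0"
    using Metric_space.mdist_pos_eq[OF Metric_space_hyp assms(1,2)] assms(3) by (simp add: d_def)
  then have sd: "sinh d > 0" by simp
  \<comment> \<open>With the unit tangent vector at \<open>x\<close> pointing away from
    \<open>y\<close>, namely \<open>(cosh d * x - y) / sinh d\<close>, this is the geodesic point
    \<open>cosh r * x + sinh r * tangent\<close>.\<close>
  define a b where "a = cosh r + sinh r * cosh d / sinh d" and "b = - sinh r / sinh d"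
  define z where "z = (\<lambda>i. a * x i + b * y i)"
  have Lz: "lorentz n z w = a * lorentz n x w + b * lorentz n y w" for w
    by (simp add: z_def lorentz_comb)
  have xz: "lorentz n z x = cosh r" using sd by (simp add: Lz L a_def b_def)
  have yz: "lorentz n z y = cosh (r + d)"
  proof -
    have "lorentz n z y = cosh r * cosh d + sinh r * (((cosh d)\<^sup>2 - 1) / sinh d)"
      by (simp add: Lz L a_def b_def power2_eq_square diff_divide_distrib algebra_simps)
    also have "((cosh d)\<^sup>2 - 1) / sinh d = sinh d"
      using sd cosh_square_eq[of d] by (simp add: power2_eq_square)
    finally show ?thesis by (simp add: cosh_add)
  qed
  have "lorentz n z z = 1"
  proof -
    have "lorentz n z z = a * cosh r + b * cosh (r + d)"
      using Lz[of z] xz yz by (simp add: lorentz_commute[of n x z] lorentz_commute[of n y z])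
    also have "\<dots> = (cosh r)\<^sup>2 - (sinh r)\<^sup>2"
      using sd by (simp add: a_def b_def cosh_add power2_eq_square field_simps)
    finally show ?thesis by (simp add: cosh_square_eq)
  qed
  moreover have "z i = 0" if "i > n" for i
    using that assms by (simp add: z_def hyp_space_def)
  ultimately show "z \<in> hyp_space n"
    using xz by (intro hyp_spaceI_lorentz_pos[OF assms(1)]) (auto intro: less_le_trans[OF _ cosh_real_ge_1])
  show "lorentz n x z = cosh r" using xz by (simp add: lorentz_commute)
  show "lorentz n y z > cosh r"
    using yz d assms(4) cosh_real_nonneg_less_iff[of r "r + d"] by (simp add: lorentz_commute[of n y z])
qed

text \<open>Packings are sets of balls whereas the argument counts centers, so a ball has to
  determine its center. The point of \<open>hyp_extend\<close> lies in the ball about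
  \<open>x\<close> but not in the one about \<open>y\<close>.\<close>

lemma hyp_cball_inj:
  assumes "x \<in> hyp_space n" "y \<in> hyp_space n" "0 \<le> r" "hyp_cball n x r = hyp_cball n y r"
  shows "x = y"
proof (rule ccontr)
  assume "x \<noteq> y"
  then obtain z where z: "z \<in> hyp_space n" "lorentz n x z = cosh r" "lorentz n y z > cosh r"
    using hyp_extend assms by metis
  then have "z \<in> hyp_cball n x r" "z \<notin> hyp_cball n y r"
    using assms(1-3) by (auto simp: in_hyp_cball)
  then show False using assms(4) by simp
qed

text \<open>If two centers were closer than this, their midpoint would be interior to both
  balls.\<close>

lemma centers_separated:
  assumes P: "P \<in> rel_dense_packings n r" and r: "r > 0"
    and x: "x \<in> hyp_space n" "hyp_cball n x r \<in> P" and y: "y \<in> hyp_space n" "hyp_cball n y r \<in> P"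
    and "x \<noteq> y"
  shows "hyp_dist n x y \<ge> 2 * r"
proof (rule ccontr)
  assume "\<not> hyp_dist n x y \<ge> 2 * r"
  then have d: "hyp_dist n x y / 2 < r" by simp
  obtain m where m: "m \<in> hyp_space n" "hyp_dist n x m \<le> hyp_dist n x y / 2" "hyp_dist n y m \<le> hyp_dist n x y / 2"
    using hyp_midpoint x y by metis
  interpret H: Metric_space "hyp_space n" "hyp_dist n" by (rule Metric_space_hyp)
  have sub: "H.mball w r \<subseteq> hyp_topology n interior_of (hyp_cball n w r)" for w
    by (intro interior_of_maximal H.openin_mball) auto
  have "m \<in> H.mball x r" "m \<in> H.mball y r" using m d x y by auto
  then have "hyp_topology n interior_of (hyp_cball n x r) \<inter> hyp_topology n interior_of (hyp_cball n y r) \<noteq> {}"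
    using sub by blast
  moreover have "hyp_cball n x r \<noteq> hyp_cball n y r"
    using hyp_cball_inj x y r \<open>x \<noteq> y\<close> by (metis less_imp_le)
  ultimately show False
    using P x y by (auto simp: rel_dense_packings_def)
qed

section \<open>Angles under which the centers are seen\<close>

lemma hyp_space_norm:
  assumes "x \<in> hyp_space n"
  shows "dotp n x x = x 0 * x 0 - 1" "x 0 \<ge> 1"
proof -
  show 1: "dotp n x x = x 0 * x 0 - 1"
    using assms by (simp add: hyp_space_def lorentz_def)
  have "dotp n x x \<ge> 0" by (intro sum_nonneg) auto
  with 1 have "1\<^sup>2 \<le> (x 0)\<^sup>2" by (simp add: power2_eq_square)
  then show "x 0 \<ge> 1" by (rule power2_le_imp_le) (use assms in \<open>simp add: hyp_space_def\<close>)
qed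

lemma lorentz_origin: "lorentz n hyp_origin x = x 0"
  by (simp add: lorentz_def hyp_origin_def)

text \<open>Replacing \<open>sqrt (1 + p\<^sup>2)\<close> by its chord on \<open>[0, S]\<close> makes the left-hand side bilinear, so only corners matter.\<close>

lemma chord_bound:
  fixes C S s p q T :: real
  assumes CS: "C\<^sup>2 = 1 + S\<^sup>2" "C \<ge> 1" "S > 0"
    and p: "0 \<le> p" "p \<le> S" and q: "0 \<le> q" "q \<le> S"
    and T: "1 \<le> T" "C \<le> T" "C\<^sup>2 - s * S\<^sup>2 \<le> T"
  shows "sqrt (1 + p\<^sup>2) * sqrt (1 + q\<^sup>2) - s * p * q \<le> T"
proof -
  have chord: "sqrt (1 + p\<^sup>2) \<le> (1 - p / S) + p / S * C" if p: "0 \<le> p" "p \<le> S" for p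
  proof -
    define l where "l = p / S"
    have l: "0 \<le> l" "l \<le> 1" "p = l * S" using p CS by (auto simp: l_def)
    have "((1 - l) + l * C)\<^sup>2 - (1 + p\<^sup>2) = 2 * (l * (1 - l) * (C - 1)) + l\<^sup>2 * (C\<^sup>2 - (1 + S\<^sup>2))"
      unfolding l(3) by (simp add: power2_eq_square algebra_simps)
    also have "\<dots> \<ge> 0" using l CS by simp
    finally have "1 + p\<^sup>2 \<le> ((1 - l) + l * C)\<^sup>2" by simp
    moreover have "(1 - l) + l * C \<ge> 0" using l CS by simp
    ultimately show ?thesis unfolding l_def[symmetric] by (intro real_le_lsqrt) auto
  qed
  define l m where "l = p / S" and "m = q / S"
  have l: "0 \<le> l" "l \<le> 1" "p = l * S" using p CS by (auto simp: l_def)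
  have m: "0 \<le> m" "m \<le> 1" "q = m * S" using q CS by (auto simp: m_def)
  have "sqrt (1 + p\<^sup>2) * sqrt (1 + q\<^sup>2) \<le> ((1 - l) + l * C) * ((1 - m) + m * C)"
    using chord[OF p] chord[OF q] CS l m unfolding l_def[symmetric] m_def[symmetric]
    by (intro mult_mono) auto
  then have "sqrt (1 + p\<^sup>2) * sqrt (1 + q\<^sup>2) - s * p * q \<le> ((1 - l) + l * C) * ((1 - m) + m * C) - s * (l * S) * (m * S)"
    using l m by simp
  \<comment> \<open>The corner values are \<open>1\<close>, \<open>C\<close>, \<open>C\<close> and
    \<open>C\<^sup>2 - s * S\<^sup>2\<close>, each of them at most \<open>T\<close>.\<close>
  also have "\<dots> = (1 - l) * (1 - m) * 1 + (l * (1 - m) + (1 - l) * m) * C + l * m * (C\<^sup>2 - s * S\<^sup>2)"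
    by (simp add: algebra_simps power2_eq_square)
  also have "\<dots> \<le> (1 - l) * (1 - m) * T + (l * (1 - m) + (1 - l) * m) * T + l * m * T"
    using T l m by (intro add_mono mult_left_mono) auto
  also have "\<dots> = T" by (simp add: algebra_simps)
  finally show ?thesis .
qed

text \<open>The lower bound on \<open>t\<close> means \<open>sin (t / 2) \<ge> 1 / 2\<close>, hence
  \<open>sinh R \<le> 2 * sinh r < 2 * sinh r * cosh r = sinh (2 * r)\<close>.\<close>

lemma radius_less_double:
  assumes t: "pi / 3 \<le> t" "t \<le> pi" and r: "r > 0" and R: "sinh R * sin (t / 2) = sinh r"
  shows "0 < R" "cosh R < cosh (2 * r)"
proof -
  have th: "sin (t / 2) \<ge> 1 / 2"
    using t sin_monotone_2pi_le[of "pi / 6" "t / 2"] by (simp add: sin_30)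
  have "sinh R * sin (t / 2) > 0" using R r by simp
  then have S0: "sinh R > 0" using th by (simp add: zero_less_mult_iff)
  then show R0: "0 < R" by simp
  have "sinh R \<le> 2 * sinh r"
  proof -
    have "sinh R * (1 / 2) \<le> sinh R * sin (t / 2)" using th S0 by (intro mult_left_mono) auto
    then show ?thesis using R by simp
  qed
  also have "\<dots> < sinh (2 * r)" using r cosh_real_nonneg_less_iff[of 0 r] by (simp add: sinh_double)
  finally have "R < 2 * r" by simp
  then show "cosh R < cosh (2 * r)" using R0 by (simp add: cosh_real_nonneg_less_iff)
qed

text \<open>The square roots are the hyperbolic sines of the distances from the origin. In the
  extremal case both points have distance \<open>R\<close> from the origin and \<open>2 * r\<close>
  from each other, and are seen under the angle \<open>t\<close> exactly; that is the identity
  \<open>T\<close>. All other positions reduce to it by \<open>chord_bound\<close>.\<close>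

lemma separated_angle:
  assumes t: "pi / 3 \<le> t" "t \<le> pi" and r: "r > 0" and R: "sinh R * sin (t / 2) = sinh r"
    and x: "x \<in> hyp_space n" "1 < x 0" "x 0 \<le> cosh R" and y: "y \<in> hyp_space n" "1 < y 0" "y 0 \<le> cosh R"
    and sep: "cosh (2 * r) \<le> lorentz n x y"
  shows "dotp n x y \<le> cos t * (sqrt ((x 0)\<^sup>2 - 1) * sqrt ((y 0)\<^sup>2 - 1))"
proof -
  note lt = radius_less_double(2)[OF t r R]
  define S C where "S = sinh R" and "C = cosh R"
  have S0: "S > 0" using radius_less_double(1)[OF t r R] by (simp add: S_def)
  have CS: "C\<^sup>2 = 1 + S\<^sup>2" by (simp add: C_def S_def cosh_square_eq)
  have C1: "C \<ge> 1" by (simp add: C_def cosh_real_ge_1)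
  define p q where "p = sqrt ((x 0)\<^sup>2 - 1)" and "q = sqrt ((y 0)\<^sup>2 - 1)"
  have pS: "0 < p \<and> p \<le> S \<and> sqrt (1 + p\<^sup>2) = x" if "1 < x" "x \<le> C" "p = sqrt (x\<^sup>2 - 1)" for x p
  proof -
    have "1 < x\<^sup>2" using that by (simp add: power2_eq_square less_1_mult)
    moreover have "x\<^sup>2 \<le> C\<^sup>2" using that by (intro power_mono) auto
    ultimately show ?thesis using that CS S0 by (auto simp: intro!: real_le_lsqrt)
  qed
  have p: "0 < p" "p \<le> S" "sqrt (1 + p\<^sup>2) = x 0" and q: "0 < q" "q \<le> S" "sqrt (1 + q\<^sup>2) = y 0"
    using pS[of "x 0" p] pS[of "y 0" q] x y by (auto simp: p_def q_def C_def)
  have "C\<^sup>2 - cos t * S\<^sup>2 = 1 + 2 * (S * sin (t / 2))\<^sup>2"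
  proof -
    have "cos t = 1 - 2 * (sin (t / 2))\<^sup>2" using cos_double_sin[of "t / 2"] by simp
    then show ?thesis unfolding CS by (simp only:) (simp add: power_mult_distrib algebra_simps)
  qed
  also have "\<dots> = cosh (2 * r)" unfolding S_def R
    by (simp add: cosh_double cosh_square_eq)
  finally have T: "C\<^sup>2 - cos t * S\<^sup>2 = cosh (2 * r)" .
  have "sqrt (1 + p\<^sup>2) * sqrt (1 + q\<^sup>2) - cos t * p * q \<le> cosh (2 * r)"
    using p q T lt C1 S0 by (intro chord_bound[OF CS C1 S0]) (auto simp: C_def cosh_real_ge_1)
  with sep show "dotp n x y \<le> cos t * (sqrt ((x 0)\<^sup>2 - 1) * sqrt ((y 0)\<^sup>2 - 1))"
    using p q by (simp add: lorentz_def p_def[symmetric] q_def[symmetric] mult_ac)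
qed

lemma spherical_code_singleton: "n \<ge> 1 \<Longrightarrow> spherical_code n s {\<lambda>i. if i = 1 then 1 else 0}"
  by (simp add: spherical_code_def if_distrib cong: if_cong)

text \<open>Centers other than the origin are projected radially to the sphere, where they form a
  code. If the origin is a center, no other center lies within distance
  \<open>R < 2 * r\<close>.\<close>

lemma center_count_le:
  assumes n: "n \<ge> 1" and t: "pi / 3 \<le> t" "t \<le> pi" and r: "r > 0" and R: "sinh R * sin (t / 2) = sinh r"
    and M: "\<And>X. spherical_code n (cos t) X \<Longrightarrow> real (card X) \<le> M"
    and P: "P \<in> rel_dense_packings n r"
  shows "center_count n r {x \<in> hyp_space n. x 0 \<le> cosh R} P \<le> ennreal M"
proof -
  define D where "D = {x \<in> hyp_space n. x \<in> {x \<in> hyp_space n. x 0 \<le> cosh R} \<and> hyp_cball n x r \<in> P}"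
  \<comment> \<open>Covers the case in which the origin is the only center.\<close>
  have M1: "M \<ge> 1" using M[OF spherical_code_singleton[OF n]] by simp
  have sepD: "cosh (2 * r) \<le> lorentz n x y" if "x \<in> D" "y \<in> D" "x \<noteq> y" for x y
    using centers_separated[OF P r, of x y] that r hyp_dist_less_iff[of x n y "2 * r"] by (auto simp: D_def not_less)
  have cos1: "cos t < 1"
    using t cos_monotone_0_pi[of 0 t] pi_gt_zero by auto
  have fin: "real (card F) \<le> M" if F: "F \<subseteq> D" "finite F" for F
  proof (cases "hyp_origin \<in> F")
    case True
    have "F \<subseteq> {hyp_origin}"
    proof
      fix x assume x: "x \<in> F"
      show "x \<in> {hyp_origin}"
      proof (rule ccontr)
        assume ne: "x \<notin> {hyp_origin}"
        have le: "cosh (2 * r) \<le> x 0"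
          using sepD[of hyp_origin x] ne x F True by (auto simp: lorentz_origin)
        moreover have "x 0 \<le> cosh R" using x F by (auto simp: D_def)
        ultimately show False
          using radius_less_double(2)[OF t r R] by simp
      qed
    qed
    then have "card F \<le> 1" using card_mono[of "{hyp_origin}" F] by simp
    then show ?thesis using M1 by linarith
  next
    case False
    define u where "u = (\<lambda>(x :: nat \<Rightarrow> real) j. x j / sqrt ((x 0)\<^sup>2 - 1) :: real)"
    have x0: "1 < x 0" "x \<in> hyp_space n" "x 0 \<le> cosh R" if "x \<in> F" for x
    proof -
      show H: "x \<in> hyp_space n" "x 0 \<le> cosh R" using that F by (auto simp: D_def)
      have "x 0 \<noteq> 1"
        using lorentz_ge_1(2)[OF hyp_origin_in_hyp_space H(1)] False that by (auto simp: lorentz_origin)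
      then show "1 < x 0" using hyp_space_norm(2)[OF H(1)] by simp
    qed
    have pos: "sqrt ((x 0)\<^sup>2 - 1) > 0" if "x \<in> F" for x
      using x0[OF that] by (simp add: power2_eq_square less_1_mult)
    have unit: "(\<Sum>j=1..n. u x j * u x j) = 1" if "x \<in> F" for x
    proof -
      have "(\<Sum>j=1..n. u x j * u x j) = dotp n x x / ((x 0)\<^sup>2 - 1)"
        using pos[OF that] by (simp add: u_def sum_divide_distrib)
      then show ?thesis using pos[OF that] hyp_space_norm(1)[OF x0(2)[OF that]] by (simp add: power2_eq_square)
    qed
    have ang: "(\<Sum>j=1..n. u x j * u y j) \<le> cos t" if "x \<in> F" "y \<in> F" "x \<noteq> y" for x y
    proof -
      have "(\<Sum>j=1..n. u x j * u y j) = dotp n x y / (sqrt ((x 0)\<^sup>2 - 1) * sqrt ((y 0)\<^sup>2 - 1))"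
        by (simp add: u_def sum_divide_distrib)
      also have "\<dots> \<le> cos t"
        using separated_angle[OF t r R x0(2,1,3)[OF that(1)] x0(2,1,3)[OF that(2)] sepD] that F pos
        by (auto simp: pos_divide_le_eq)
      finally show ?thesis .
    qed
    have inj: "inj_on u F"
    proof (rule inj_onI, rule ccontr)
      fix x y assume "x \<in> F" "y \<in> F" "u x = u y" "x \<noteq> y"
      then show False using ang[of x y] unit[of y] cos1 by simp
    qed
    have "spherical_code n (cos t) (u ` F)"
      using F unit ang by (auto simp: spherical_code_def)
    then show ?thesis using M inj by (metis card_image)
  qed
  \<comment> \<open>The code bound speaks of finite sets only; an infinite \<open>D\<close> would
    contain finite subsets of any size.\<close>
  have "finite D"
  proof (rule ccontr)
    assume "infinite D"
    then obtain F where "F \<subseteq> D" "finite F" "card F = Suc (nat \<lceil>M\<rceil>)"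
      using infinite_arbitrarily_large by metis
    then show False using fin[of F] by linarith
  qed
  moreover from this have "real (card D) \<le> M" by (intro fin) auto
  ultimately show ?thesis
    unfolding center_count_def D_def[symmetric] by (simp add: ennreal_of_nat_eq_real_of_nat ennreal_leI)
qed

section \<open>The intensity measure of a random packing\<close>

lemmas topspace_hyp = Metric_space.topspace_mtopology[OF Metric_space_hyp]

lemma openin_hyp_subset: "openin (hyp_topology n) U \<Longrightarrow> U \<subseteq> hyp_space n"
  using openin_subset[of "hyp_topology n" U] by (simp add: topspace_hyp)

lemma space_hyp_borel [simp]: "space (hyp_borel n) = hyp_space n"
  unfolding hyp_borel_def using openin_hyp_subset by (intro space_measure_of) auto

lemma sets_hyp_borel: "sets (hyp_borel n) = sigma_sets (hyp_space n) {U. openin (hyp_topology n) U}"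
  unfolding hyp_borel_def using openin_hyp_subset by (intro sets_measure_of) auto

lemma openin_hyp_borel: "openin (hyp_topology n) U \<Longrightarrow> U \<in> sets (hyp_borel n)"
  by (auto simp: sets_hyp_borel)

lemma lorentz_measurable:
  assumes p: "p \<in> hyp_space n"
  shows "lorentz n p \<in> borel_measurable (hyp_borel n)"
proof -
  have "hyp_dist n p \<in> borel_measurable (hyp_borel n)"
    unfolding borel_measurable_iff_less
  proof
    fix a
    have "{x \<in> space (hyp_borel n). hyp_dist n p x < a} = Metric_space.mball (hyp_space n) (hyp_dist n) p a"
      using p by (auto simp: Metric_space.in_mball[OF Metric_space_hyp])
    then show "{x \<in> space (hyp_borel n). hyp_dist n p x < a} \<in> sets (hyp_borel n)"
      by (simp add: openin_hyp_borel Metric_space.openin_mball[OF Metric_space_hyp])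
  qed
  then have "(\<lambda>x. cosh (hyp_dist n p x)) \<in> borel_measurable (hyp_borel n)"
    unfolding cosh_field_def by measurable
  then show ?thesis
    by (rule measurable_cong[THEN iffD1, rotated]) (simp add: cosh_hyp_dist[OF p])
qed

text \<open>Every coordinate is a linear combination of Lorentz products with points of the hyperboloid.\<close>

lemma measurable_hyp_coord: "(\<lambda>x. x i) \<in> borel_measurable (hyp_borel n)"
proof -
  have 0: "(\<lambda>x. x 0) \<in> borel_measurable (hyp_borel n)"
    using lorentz_measurable[OF hyp_origin_in_hyp_space, of n] by (simp add: lorentz_origin[abs_def])
  consider "i = 0" | "1 \<le> i" "i \<le> n" | "i > n" by linarith
  then show ?thesis
  proof cases
    case 2
    define p where "p = (\<lambda>j. if j = 0 then sqrt 2 else if j = i then 1 else 0 :: real)"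
    have L: "lorentz n p x = sqrt 2 * x 0 - x i" for x
    proof -
      have "(\<Sum>j=1..n. p j * x j) = (\<Sum>j=1..n. if j = i then x j else 0)"
        using 2 by (intro sum.cong) (auto simp: p_def)
      then show ?thesis using 2 by (simp add: lorentz_def p_def)
    qed
    have "p \<in> hyp_space n"
      using 2 L[of p] by (simp add: hyp_space_def) (auto simp: p_def)
    from borel_measurable_diff[OF borel_measurable_times[OF borel_measurable_const[of "sqrt 2"] 0] lorentz_measurable[OF this]]
    show ?thesis by (simp add: L)
  next
    case 3
    then have "(\<lambda>x. 0 :: real) \<in> borel_measurable (hyp_borel n) \<longleftrightarrow> (\<lambda>x. x i) \<in> borel_measurable (hyp_borel n)"
      by (intro measurable_cong) (simp add: hyp_space_def)
    then show ?thesis by simp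
  qed (simp add: 0)
qed

section \<open>Isometries acting on packings\<close>

lemma hyp_isometry_homeomorphic:
  assumes g: "g \<in> hyp_isometries n"
  shows "homeomorphic_map (hyp_topology n) (hyp_topology n) g"
proof -
  interpret Metric_space12 "hyp_space n" "hyp_dist n" "hyp_space n" "hyp_dist n"
    by (intro Metric_space12.intro Metric_space_hyp)
  show ?thesis
    using g by (intro isometry_imp_homeomorphic_map) (auto simp: hyp_isometries_def bij_betw_def)
qed

lemma hyp_isometry_measurable:
  assumes g: "g \<in> hyp_isometries n"
  shows "g \<in> measurable (hyp_borel n) (hyp_borel n)"
proof (rule measurable_sigma_sets[OF sets_hyp_borel])
  show "{U. openin (hyp_topology n) U} \<subseteq> Pow (hyp_space n)" using openin_hyp_subset by auto
  show "g \<in> space (hyp_borel n) \<rightarrow> hyp_space n" using g by (auto simp: hyp_isometries_def bij_betw_def)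
  fix U assume "U \<in> {U. openin (hyp_topology n) U}"
  then have "openin (hyp_topology n) {x \<in> topspace (hyp_topology n). g x \<in> U}"
    using homeomorphic_imp_continuous_map[OF hyp_isometry_homeomorphic[OF g]] openin_continuous_map_preimage by blast
  then have "openin (hyp_topology n) (g -` U \<inter> space (hyp_borel n))"
    by (simp add: topspace_hyp vimage_def Int_def conj_commute)
  then show "g -` U \<inter> space (hyp_borel n) \<in> sets (hyp_borel n)"
    by (rule openin_hyp_borel)
qed

lemma hyp_isometry_cball:
  assumes g: "g \<in> hyp_isometries n" and x: "x \<in> hyp_space n"
  shows "g ` hyp_cball n x r = hyp_cball n (g x) r"
proof -
  have bij: "bij_betw g (hyp_space n) (hyp_space n)"
    and iso: "\<And>x y. x \<in> hyp_space n \<Longrightarrow> y \<in> hyp_space n \<Longrightarrow> hyp_dist n (g x) (g y) = hyp_dist n x y"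
    using g by (auto simp: hyp_isometries_def)
  have gH: "g ` hyp_space n = hyp_space n" using bij by (simp add: bij_betw_def)
  show ?thesis
  proof (intro equalityI subsetI)
    fix y assume "y \<in> g ` hyp_cball n x r"
    then show "y \<in> hyp_cball n (g x) r"
      using gH x iso by (auto simp: in_mcball_hyp)
  next
    fix y assume y: "y \<in> hyp_cball n (g x) r"
    then obtain z where "z \<in> hyp_space n" "y = g z"
      using gH by (auto simp: in_mcball_hyp)
    then show "y \<in> g ` hyp_cball n x r"
      using y x iso by (auto simp: in_mcball_hyp)
  qed
qed

lemma rel_dense_packings_subset:
  "P \<in> rel_dense_packings n r \<Longrightarrow> P \<subseteq> (\<lambda>x. hyp_cball n x r) ` hyp_space n"
  by (simp add: rel_dense_packings_def)

lemma hyp_cball_subset: "hyp_cball n x r \<subseteq> hyp_space n"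
  by (auto simp: in_mcball_hyp)

lemma packing_ball_subset: "P \<in> rel_dense_packings n r \<Longrightarrow> B \<in> P \<Longrightarrow> B \<subseteq> hyp_space n"
  using rel_dense_packings_subset[of P n r] hyp_cball_subset[of n _ r] by blast

lemma move_packing_mem_iff:
  assumes g: "g \<in> hyp_isometries n" and P: "P \<in> rel_dense_packings n r" and x: "x \<in> hyp_space n"
  shows "hyp_cball n (g x) r \<in> move_packing g P \<longleftrightarrow> hyp_cball n x r \<in> P"
proof -
  have inj: "inj_on g (hyp_space n)" using g by (auto simp: hyp_isometries_def bij_betw_def)
  have "hyp_cball n (g x) r = g ` B \<Longrightarrow> B \<in> P \<Longrightarrow> hyp_cball n x r = B" for B
    unfolding hyp_isometry_cball[OF g x, symmetric]
    using packing_ball_subset[OF P] hyp_cball_subset by (simp add: inj_on_image_eq_iff[OF inj])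
  then show ?thesis
    unfolding move_packing_def hyp_isometry_cball[OF g x, symmetric] by blast
qed

lemma move_packing_rel_dense:
  assumes g: "g \<in> hyp_isometries n" and P: "P \<in> rel_dense_packings n r"
  shows "move_packing g P \<in> rel_dense_packings n r"
proof -
  have gH: "g ` hyp_space n = hyp_space n" and inj: "inj_on g (hyp_space n)"
    using g by (auto simp: hyp_isometries_def bij_betw_def)
  have P1: "B \<subseteq> hyp_space n" if "B \<in> P" for B
    using packing_ball_subset[OF P that] .
  have int: "hyp_topology n interior_of (g ` B) = g ` (hyp_topology n interior_of B)" if "B \<in> P" for B
    using P1[OF that] by (intro homeomorphic_map_interior_of hyp_isometry_homeomorphic[OF g])
      (simp add: topspace_hyp)
  have "move_packing g P \<subseteq> (\<lambda>x. hyp_cball n x r) ` hyp_space n"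
  proof
    fix B assume "B \<in> move_packing g P"
    then obtain x where "x \<in> hyp_space n" "B = g ` hyp_cball n x r"
      using rel_dense_packings_subset[OF P] by (auto simp: move_packing_def)
    then show "B \<in> (\<lambda>x. hyp_cball n x r) ` hyp_space n"
      using hyp_isometry_cball[OF g, of x r] gH by auto
  qed
  moreover have "hyp_topology n interior_of B \<inter> hyp_topology n interior_of B' = {}"
    if B: "B \<in> move_packing g P" "B' \<in> move_packing g P" "B \<noteq> B'" for B B'
  proof -
    obtain C C' where C: "C \<in> P" "C' \<in> P" "B = g ` C" "B' = g ` C'"
      using B by (auto simp: move_packing_def)
    have "\<forall>B\<in>P. \<forall>B'\<in>P. B \<noteq> B' \<longrightarrow> hyp_topology n interior_of B \<inter> hyp_topology n interior_of B' = {}"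
      using P by (simp add: rel_dense_packings_def)
    moreover have "C \<noteq> C'" using B(3) C by auto
    ultimately have "hyp_topology n interior_of C \<inter> hyp_topology n interior_of C' = {}"
      using C by blast
    moreover have "hyp_topology n interior_of C \<subseteq> hyp_space n" "hyp_topology n interior_of C' \<subseteq> hyp_space n"
      using P1[OF C(1)] P1[OF C(2)] interior_of_subset by fast+
    ultimately show ?thesis
      unfolding C int[OF C(1)] int[OF C(2)] using inj by (auto dest: inj_onD)
  qed
  moreover have "\<exists>B\<in>move_packing g P. hyp_cball n x r \<inter> B \<noteq> {}"
    if x: "x \<in> hyp_space n" "hyp_cball n x r \<notin> move_packing g P" for x
  proof -
    obtain y where y: "y \<in> hyp_space n" "x = g y" using x gH by auto
    then have "hyp_cball n y r \<notin> P" using x move_packing_mem_iff[OF g P] by simp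
    moreover have "\<forall>x\<in>hyp_space n. hyp_cball n x r \<notin> P \<longrightarrow> (\<exists>B\<in>P. hyp_cball n x r \<inter> B \<noteq> {})"
      using P by (simp add: rel_dense_packings_def)
    ultimately obtain B w where B: "B \<in> P" "w \<in> hyp_cball n y r" "w \<in> B"
      using y by blast
    then have "g w \<in> hyp_cball n x r" unfolding y(2) hyp_isometry_cball[OF g y(1), symmetric] by simp
    then have "g w \<in> hyp_cball n x r \<inter> g ` B" using B(3) by simp
    then have "hyp_cball n x r \<inter> g ` B \<noteq> {}" by (metis empty_iff)
    moreover have "g ` B \<in> move_packing g P" using B(1) by (simp add: move_packing_def)
    ultimately show ?thesis by (rule bexI)
  qed
  ultimately show ?thesis unfolding rel_dense_packings_def by simp
qed

lemma center_count_move: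
  assumes g: "g \<in> hyp_isometries n" and P: "P \<in> rel_dense_packings n r"
  shows "center_count n r A (move_packing g P) = center_count n r (g -` A \<inter> hyp_space n) P"
proof -
  have gH: "g ` hyp_space n = hyp_space n" and inj: "inj_on g (hyp_space n)"
    using g by (auto simp: hyp_isometries_def bij_betw_def)
  let ?S = "{x \<in> hyp_space n. x \<in> g -` A \<inter> hyp_space n \<and> hyp_cball n x r \<in> P}"
  have "{x \<in> hyp_space n. x \<in> A \<and> hyp_cball n x r \<in> move_packing g P} = g ` ?S"
  proof (intro equalityI subsetI)
    fix x assume x: "x \<in> {x \<in> hyp_space n. x \<in> A \<and> hyp_cball n x r \<in> move_packing g P}"
    then obtain y where "y \<in> hyp_space n" "x = g y" using gH by auto
    then show "x \<in> g ` ?S" using x move_packing_mem_iff[OF g P] by auto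
  next
    fix x assume "x \<in> g ` ?S"
    then show "x \<in> {x \<in> hyp_space n. x \<in> A \<and> hyp_cball n x r \<in> move_packing g P}"
      using gH move_packing_mem_iff[OF g P] by auto
  qed
  moreover have "inj_on g ?S" using inj by (rule inj_on_subset) auto
  ultimately show ?thesis
    unfolding center_count_def by (simp add: emeasure_count_space finite_image_iff card_image)
qed

lemma space_packing_space: "space (packing_space n r) = rel_dense_packings n r"
  unfolding packing_space_def by (intro space_measure_of) auto

lemma sets_packing_space: "sets (packing_space n r) = sigma_sets (rel_dense_packings n r)
     {center_count n r A -` T \<inter> rel_dense_packings n r | A T. A \<in> sets (hyp_borel n) \<and> T \<in> sets borel}"
  unfolding packing_space_def by (intro sets_measure_of) auto

lemma center_count_measurable [measurable]:
  assumes "A \<in> sets (hyp_borel n)"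
  shows "center_count n r A \<in> borel_measurable (packing_space n r)"
  using assms by (intro measurableI) (auto simp: space_packing_space sets_packing_space)

lemma center_count_measurable':
  assumes "sets \<mu> = sets (packing_space n r)" "A \<in> sets (hyp_borel n)"
  shows "center_count n r A \<in> borel_measurable \<mu>"
  unfolding measurable_cong_sets[OF assms(1) refl] using assms(2) by (rule center_count_measurable)

lemma move_packing_measurable:
  assumes g: "g \<in> hyp_isometries n"
  shows "move_packing g \<in> measurable (packing_space n r) (packing_space n r)"
proof (rule measurable_sigma_sets[OF sets_packing_space])
  show "move_packing g \<in> space (packing_space n r) \<rightarrow> rel_dense_packings n r"
    using move_packing_rel_dense[OF g] by (auto simp: space_packing_space)
  fix Y assume "Y \<in> {center_count n r A -` T \<inter> rel_dense_packings n r | A T. A \<in> sets (hyp_borel n) \<and> T \<in> sets borel}"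
  then obtain A T where Y: "Y = center_count n r A -` T \<inter> rel_dense_packings n r" "A \<in> sets (hyp_borel n)" "T \<in> sets borel"
    by auto
  have "move_packing g -` Y \<inter> space (packing_space n r)
     = center_count n r (g -` A \<inter> hyp_space n) -` T \<inter> space (packing_space n r)"
    using center_count_move[OF g] move_packing_rel_dense[OF g] by (auto simp: Y space_packing_space)
  moreover have "g -` A \<inter> hyp_space n \<in> sets (hyp_borel n)"
    using measurable_sets[OF hyp_isometry_measurable[OF g] Y(2)] by simp
  ultimately show "move_packing g -` Y \<inter> space (packing_space n r) \<in> sets (packing_space n r)"
    using measurable_sets[OF center_count_measurable Y(3)] by metis
qed auto

text \<open>The mean measure of the point process of centers. The formula becomes its value only
  through the countable additivity shown in \<open>emeasure_intensity\<close>.\<close>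

definition intensity :: "nat \<Rightarrow> real \<Rightarrow> (nat \<Rightarrow> real) set set measure \<Rightarrow> (nat \<Rightarrow> real) measure" where
  "intensity n r \<mu> = measure_of (hyp_space n) (sets (hyp_borel n)) (\<lambda>A. \<integral>\<^sup>+P. center_count n r A P \<partial>\<mu>)"

lemma sets_intensity [simp, measurable_cong]: "sets (intensity n r \<mu>) = sets (hyp_borel n)"
  unfolding intensity_def using sets.sets_measure_of_eq[of "hyp_borel n"] by simp

lemma space_intensity [simp]: "space (intensity n r \<mu>) = hyp_space n"
  using sets_eq_imp_space_eq[OF sets_intensity] by simp

lemma emeasure_intensity:
  assumes \<mu>: "sets \<mu> = sets (packing_space n r)" and A: "A \<in> sets (hyp_borel n)"
  shows "emeasure (intensity n r \<mu>) A = (\<integral>\<^sup>+P. center_count n r A P \<partial>\<mu>)"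
proof (rule emeasure_measure_of[OF intensity_def])
  show "sets (hyp_borel n) \<subseteq> Pow (hyp_space n)" using sets.space_closed[of "hyp_borel n"] by simp
  show "positive (sets (intensity n r \<mu>)) (\<lambda>A. \<integral>\<^sup>+P. center_count n r A P \<partial>\<mu>)"
    by (simp add: positive_def center_count_def)
  show "countably_additive (sets (intensity n r \<mu>)) (\<lambda>A. \<integral>\<^sup>+P. center_count n r A P \<partial>\<mu>)"
  proof (rule countably_additiveI)
    fix F :: "nat \<Rightarrow> (nat \<Rightarrow> real) set"
    assume F: "range F \<subseteq> sets (intensity n r \<mu>)" "disjoint_family F"
    have m: "center_count n r (F i) \<in> borel_measurable \<mu>" for i
      using F by (intro center_count_measurable'[OF \<mu>]) auto
    have "(\<Sum>i. \<integral>\<^sup>+P. center_count n r (F i) P \<partial>\<mu>) = (\<integral>\<^sup>+P. (\<Sum>i. center_count n r (F i) P) \<partial>\<mu>)"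
      using m by (intro nn_integral_suminf[symmetric])
    also have "\<dots> = (\<integral>\<^sup>+P. center_count n r (\<Union>i. F i) P \<partial>\<mu>)"
    proof (intro nn_integral_cong)
      fix P
      define D where "D = (\<lambda>A. {x \<in> hyp_space n. x \<in> A \<and> hyp_cball n x r \<in> P})"
      have "disjoint_family (\<lambda>i. D (F i))" using F(2) by (auto simp: disjoint_family_on_def D_def)
      then have "(\<Sum>i. emeasure (count_space UNIV) (D (F i))) = emeasure (count_space UNIV) (\<Union>i. D (F i))"
        by (intro suminf_emeasure) auto
      also have "(\<Union>i. D (F i)) = D (\<Union>i. F i)" by (auto simp: D_def)
      finally show "(\<Sum>i. center_count n r (F i) P) = center_count n r (\<Union>i. F i) P"
        by (simp add: center_count_def D_def)
    qed
    finally show "(\<Sum>i. \<integral>\<^sup>+P. center_count n r (F i) P \<partial>\<mu>) = (\<integral>\<^sup>+P. center_count n r (\<Union>i. F i) P \<partial>\<mu>)" .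
  qed
qed (use A in simp)

lemma invariant_prob_measuresD:
  assumes "\<mu> \<in> invariant_prob_measures n r"
  shows "sets \<mu> = sets (packing_space n r)" "space \<mu> = rel_dense_packings n r" "prob_space \<mu>"
proof -
  show s: "sets \<mu> = sets (packing_space n r)" "prob_space \<mu>"
    using assms by (auto simp: invariant_prob_measures_def)
  show "space \<mu> = rel_dense_packings n r"
    using sets_eq_imp_space_eq[OF s(1)] by (simp add: space_packing_space)
qed

lemma intensity_invariant:
  assumes \<mu>: "\<mu> \<in> invariant_prob_measures n r" and g: "g \<in> hyp_isometries n"
  shows "distr (intensity n r \<mu>) (hyp_borel n) g = intensity n r \<mu>"
proof (rule measure_eqI)
  note s = invariant_prob_measuresD(1)[OF \<mu>] and sp = invariant_prob_measuresD(2)[OF \<mu>]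
  have inv: "distr \<mu> \<mu> (move_packing g) = \<mu>"
    using \<mu> g by (auto simp: invariant_prob_measures_def)
  have gm: "g \<in> measurable (intensity n r \<mu>) (hyp_borel n)"
    using hyp_isometry_measurable[OF g] by (simp add: measurable_cong_sets[OF sets_intensity refl])
  fix A assume A: "A \<in> sets (distr (intensity n r \<mu>) (hyp_borel n) g)"
  then have A': "A \<in> sets (hyp_borel n)" by simp
  have pre: "g -` A \<inter> hyp_space n \<in> sets (hyp_borel n)"
    using measurable_sets[OF hyp_isometry_measurable[OF g] A'] by simp
  have mm: "move_packing g \<in> measurable \<mu> \<mu>"
    using move_packing_measurable[OF g] measurable_cong_sets[OF s s] by auto
  have cm: "center_count n r A \<in> borel_measurable \<mu>"
    by (rule center_count_measurable'[OF s A'])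
  have "emeasure (distr (intensity n r \<mu>) (hyp_borel n) g) A = (\<integral>\<^sup>+P. center_count n r (g -` A \<inter> hyp_space n) P \<partial>\<mu>)"
    using emeasure_distr[OF gm A'] emeasure_intensity[OF s pre] by simp
  also have "\<dots> = (\<integral>\<^sup>+P. center_count n r A (move_packing g P) \<partial>\<mu>)"
    using center_count_move[OF g] by (intro nn_integral_cong) (simp add: sp)
  also have "\<dots> = (\<integral>\<^sup>+P. center_count n r A P \<partial>(distr \<mu> \<mu> (move_packing g)))"
    using mm cm by (simp add: nn_integral_distr)
  also have "\<dots> = emeasure (intensity n r \<mu>) A"
    unfolding inv using emeasure_intensity[OF s A'] by simp
  finally show "emeasure (distr (intensity n r \<mu>) (hyp_borel n) g) A = emeasure (intensity n r \<mu>) A" .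
qed simp

text \<open>A ball about \<open>hyp_origin\<close>: the coordinate \<open>x 0\<close> is the
  hyperbolic cosine of the distance from there.\<close>

definition hyp_ball0 :: "nat \<Rightarrow> real \<Rightarrow> (nat \<Rightarrow> real) set" where
  "hyp_ball0 n R = {x \<in> hyp_space n. x 0 \<le> cosh R}"

lemma hyp_ball0_sets [measurable]: "hyp_ball0 n R \<in> sets (hyp_borel n)"
proof -
  note measurable_hyp_coord[measurable]
  have "{x \<in> space (hyp_borel n). x 0 \<le> cosh R} \<in> sets (hyp_borel n)" by measurable
  then show ?thesis by (simp add: hyp_ball0_def)
qed

text \<open>The origin is covered only if some center lies within \<open>r\<close> of it, and
  Markov's inequality bounds that probability by the expected number of such centers.\<close>

lemma packing_density_le_intensity:
  assumes \<mu>: "\<mu> \<in> invariant_prob_measures n r" and r: "0 < r"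
  shows "packing_density \<mu> \<le> emeasure (intensity n r \<mu>) (hyp_ball0 n r)"
proof -
  note s = invariant_prob_measuresD(1)[OF \<mu>] and sp = invariant_prob_measuresD(2)[OF \<mu>]
  have cm: "center_count n r (hyp_ball0 n r) \<in> borel_measurable \<mu>"
    by (rule center_count_measurable'[OF s hyp_ball0_sets])
  have "{P \<in> space \<mu>. hyp_origin \<in> \<Union>P} \<subseteq> {P \<in> space \<mu>. 1 \<le> 1 * center_count n r (hyp_ball0 n r) P}"
  proof safe
    fix P B assume P: "P \<in> space \<mu>" "B \<in> P" "hyp_origin \<in> B"
    then obtain x where x: "x \<in> hyp_space n" "B = hyp_cball n x r"
      using rel_dense_packings_subset[of P n r] by (auto simp: sp)
    then have "lorentz n hyp_origin x \<le> cosh r"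
      using P(3) r by (simp add: in_hyp_cball lorentz_commute)
    then have "x \<in> {x \<in> hyp_space n. x \<in> hyp_ball0 n r \<and> hyp_cball n x r \<in> P}"
      using x P by (simp add: hyp_ball0_def lorentz_origin)
    then have "emeasure (count_space UNIV) {x} \<le> center_count n r (hyp_ball0 n r) P"
      unfolding center_count_def by (intro emeasure_mono) auto
    then show "1 \<le> 1 * center_count n r (hyp_ball0 n r) P" by simp
  qed
  then have "packing_density \<mu> \<le> emeasure \<mu> {P \<in> space \<mu>. 1 \<le> 1 * center_count n r (hyp_ball0 n r) P}"
    unfolding packing_density_def using cm by (intro emeasure_mono) auto
  also have "\<dots> \<le> 1 * (\<integral>\<^sup>+P. center_count n r (hyp_ball0 n r) P * indicator (space \<mu>) P \<partial>\<mu>)"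
    using cm by (intro nn_integral_Markov_inequality) auto
  also have "\<dots> = (\<integral>\<^sup>+P. center_count n r (hyp_ball0 n r) P \<partial>\<mu>)"
    unfolding mult_1 by (intro nn_integral_cong) simp
  finally show ?thesis by (simp add: emeasure_intensity[OF s])
qed

lemma intensity_ball_le:
  assumes \<mu>: "\<mu> \<in> invariant_prob_measures n r" and n: "n \<ge> 1" and \<theta>: "pi / 3 \<le> \<theta>" "\<theta> \<le> pi"
    and r: "r > 0" and R: "sinh R * sin (\<theta> / 2) = sinh r"
    and M: "\<And>X. spherical_code n (cos \<theta>) X \<Longrightarrow> real (card X) \<le> M"
  shows "emeasure (intensity n r \<mu>) (hyp_ball0 n R) \<le> ennreal M"
proof -
  note s = invariant_prob_measuresD(1)[OF \<mu>] and sp = invariant_prob_measuresD(2)[OF \<mu>]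
  have "emeasure (intensity n r \<mu>) (hyp_ball0 n R) \<le> (\<integral>\<^sup>+P. ennreal M \<partial>\<mu>)"
    unfolding emeasure_intensity[OF s hyp_ball0_sets]
    by (intro nn_integral_mono center_count_le[OF n \<theta> r R, folded hyp_ball0_def]) (use M in \<open>auto simp: sp\<close>)
  also have "\<dots> = ennreal M" using prob_space.emeasure_space_1[OF invariant_prob_measuresD(3)[OF \<mu>]] by simp
  finally show ?thesis .
qed

section \<open>Invariant measures in horospherical coordinates\<close>

text \<open>Points are described by \<open>t = ln (x 0 - x 1)\<close> and the coordinates \<open>2, \<dots>, n\<close>. The group \<open>horo_act\<close>
  acts simply transitively; \<open>horo n\<close> is its left Haar measure and \<open>horo_weight n\<close> the density of a right Haar measure.\<close>

type_synonym horo_point = "real \<times> (nat \<Rightarrow> real)"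

abbreviation LbI :: "nat \<Rightarrow> (nat \<Rightarrow> real) measure" where
  "LbI n \<equiv> Pi\<^sub>M {2..n} (\<lambda>_. lborel)"

abbreviation horo :: "nat \<Rightarrow> horo_point measure" where
  "horo n \<equiv> lborel \<Otimes>\<^sub>M LbI n"

lemma product_sigma_finite_lborel: "product_sigma_finite (\<lambda>_::nat. lborel :: real measure)"
  by (simp add: product_sigma_finite_def sigma_finite_lborel)

lemma sigma_finite_LbI: "sigma_finite_measure (LbI n)"
  by (rule product_sigma_finite.sigma_finite[OF product_sigma_finite_lborel]) simp

lemma sigma_finite_horo: "sigma_finite_measure (horo n)"
  by (intro sigma_finite_pair_measure sigma_finite_lborel sigma_finite_LbI)

lemma nn_integral_horo:
  assumes "f \<in> borel_measurable (horo n)"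
  shows "(\<integral>\<^sup>+z. f z \<partial>horo n) = (\<integral>\<^sup>+t. \<integral>\<^sup>+x. f (t, x) \<partial>LbI n \<partial>lborel)"
  using sigma_finite_measure.nn_integral_fst[OF sigma_finite_LbI assms] by simp

text \<open>Boxes determine the product measure, and on a box the one-dimensional substitution
  applies to each coordinate. The exponent is \<open>card {2..n}\<close>, also for
  \<open>n = 0\<close>.\<close>

lemma LbI_affine:
  assumes c: "c \<noteq> 0" and f: "f \<in> borel_measurable (LbI n)"
  shows "ennreal (\<bar>c\<bar> ^ (n - 1)) * (\<integral>\<^sup>+a. f (\<lambda>i\<in>{2..n}. x i + c * a i) \<partial>LbI n) = (\<integral>\<^sup>+a. f a \<partial>LbI n)"
proof -
  define T where "T = (\<lambda>a::nat \<Rightarrow> real. \<lambda>i\<in>{2..n}. x i + c * a i)"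
  have T: "T \<in> measurable (LbI n) (LbI n)" unfolding T_def by measurable
  define Q where "Q = density (distr (LbI n) (LbI n) T) (\<lambda>_. ennreal (\<bar>c\<bar> ^ (n - 1)))"
  have "Q = LbI n"
  proof (rule product_sigma_finite.PiM_eqI[OF product_sigma_finite_lborel])
    show "sets Q = sets (LbI n)" by (simp add: Q_def)
    fix A :: "nat \<Rightarrow> real set" assume A: "\<And>i. i \<in> {2..n} \<Longrightarrow> A i \<in> sets lborel"
    have PA: "Pi\<^sub>E {2..n} A \<in> sets (LbI n)" using A by (intro sets_PiM_I_finite) auto
    have pre: "T -` Pi\<^sub>E {2..n} A \<inter> space (LbI n) = Pi\<^sub>E {2..n} (\<lambda>i. (\<lambda>t. x i + c * t) -` A i)"
      by (auto simp: T_def space_PiM PiE_iff extensional_def)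
    have pm: "(\<lambda>t. x i + c * t) -` A i \<in> sets lborel" if "i \<in> {2..n}" for i
      using measurable_sets[of "\<lambda>t. x i + c * t" lborel lborel "A i"] A[OF that] by simp
    have one: "emeasure lborel (A i) = ennreal \<bar>c\<bar> * emeasure lborel ((\<lambda>t. x i + c * t) -` A i)" if "i \<in> {2..n}" for i
    proof -
      have Ai: "A i \<in> sets borel" using A[OF that] by simp
      have "emeasure lborel (A i) = emeasure (density (distr lborel borel (\<lambda>t. x i + c * t)) (\<lambda>_. ennreal \<bar>c\<bar>)) (A i)"
        using lborel_real_affine[OF c, of "x i"] by simp
      also have "\<dots> = ennreal \<bar>c\<bar> * emeasure (distr lborel borel (\<lambda>t. x i + c * t)) (A i)"
        using Ai by (subst emeasure_density_const) auto
      also have "\<dots> = ennreal \<bar>c\<bar> * emeasure lborel ((\<lambda>t. x i + c * t) -` A i)"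
        using Ai by (subst emeasure_distr) auto
      finally show ?thesis .
    qed
    have "emeasure Q (Pi\<^sub>E {2..n} A) = ennreal (\<bar>c\<bar> ^ (n - 1)) * emeasure (distr (LbI n) (LbI n) T) (Pi\<^sub>E {2..n} A)"
      unfolding Q_def using PA by (subst emeasure_density_const) auto
    also have "\<dots> = ennreal (\<bar>c\<bar> ^ (n - 1)) * emeasure (LbI n) (Pi\<^sub>E {2..n} (\<lambda>i. (\<lambda>t. x i + c * t) -` A i))"
      using emeasure_distr[OF T PA] pre by simp
    also have "\<dots> = ennreal (\<bar>c\<bar> ^ (n - 1)) * (\<Prod>i\<in>{2..n}. emeasure lborel ((\<lambda>t. x i + c * t) -` A i))"
      using pm by (subst product_sigma_finite.emeasure_PiM[OF product_sigma_finite_lborel]) auto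
    also have "ennreal (\<bar>c\<bar> ^ (n - 1)) = (\<Prod>i\<in>{2..n}. ennreal \<bar>c\<bar>)"
      by (simp add: ennreal_power)
    also have "\<dots> * (\<Prod>i\<in>{2..n}. emeasure lborel ((\<lambda>t. x i + c * t) -` A i)) = (\<Prod>i\<in>{2..n}. emeasure lborel (A i))"
      using one by (simp add: prod.distrib)
    finally show "emeasure Q (Pi\<^sub>E {2..n} A) = (\<Prod>i\<in>{2..n}. emeasure lborel (A i))" .
  qed simp
  then have "(\<integral>\<^sup>+a. f a \<partial>LbI n) = (\<integral>\<^sup>+a. f a \<partial>Q)" by simp
  also have "\<dots> = (\<integral>\<^sup>+a. ennreal (\<bar>c\<bar> ^ (n - 1)) * f a \<partial>distr (LbI n) (LbI n) T)"
    unfolding Q_def using f by (subst nn_integral_density) auto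
  also have "\<dots> = (\<integral>\<^sup>+a. ennreal (\<bar>c\<bar> ^ (n - 1)) * f (T a) \<partial>LbI n)"
    using f T by (subst nn_integral_distr) auto
  also have "\<dots> = ennreal (\<bar>c\<bar> ^ (n - 1)) * (\<integral>\<^sup>+a. f (T a) \<partial>LbI n)"
    using f T by (intro nn_integral_cmult) auto
  finally show ?thesis by (simp add: T_def)
qed

text \<open>Read as the product of \<open>g\<close> and \<open>z\<close> in a semidirect product of
  the line with the translations of the coordinates \<open>2, ..., n\<close>, on which the line acts
  by dilations; \<open>horo_inv_act n g\<close> multiplies by the inverse of \<open>g\<close> from
  the left.\<close>

definition horo_act :: "nat \<Rightarrow> horo_point \<Rightarrow> horo_point \<Rightarrow> horo_point" where
  "horo_act n g z = (fst z + fst g, \<lambda>i\<in>{2..n}. snd z i + exp (fst z) * snd g i)"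

definition horo_inv_act :: "nat \<Rightarrow> horo_point \<Rightarrow> horo_point \<Rightarrow> horo_point" where
  "horo_inv_act n g z = (fst z - fst g, \<lambda>i\<in>{2..n}. snd z i + (- exp (fst z - fst g)) * snd g i)"

lemma horo_inv_act_act:
  assumes "z \<in> space (horo n)"
  shows "horo_inv_act n g (horo_act n g z) = z"
  using assms by (cases z) (auto simp: horo_inv_act_def horo_act_def space_pair_measure space_PiM PiE_iff extensional_def fun_eq_iff)

lemma horo_coord_measurable [measurable]:
  "i \<in> {2..n} \<Longrightarrow> (\<lambda>z. snd z i) \<in> borel_measurable (horo n)"
  using measurable_compose[OF measurable_snd measurable_component_singleton, of i "{2..n}" lborel "\<lambda>_. lborel"] by simp

lemma horo_act_measurable [measurable]:
  "(\<lambda>p. horo_act n (snd p) (fst p)) \<in> measurable (horo n \<Otimes>\<^sub>M horo n) (horo n)"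
  "(\<lambda>p. horo_inv_act n (snd p) (fst p)) \<in> measurable (horo n \<Otimes>\<^sub>M horo n) (horo n)"
proof -
  have c: "(\<lambda>p. snd (fst p) i) \<in> borel_measurable (horo n \<Otimes>\<^sub>M horo n)"
    "(\<lambda>p. snd (snd p) i) \<in> borel_measurable (horo n \<Otimes>\<^sub>M horo n)" if "i \<in> {2..n}" for i
    using measurable_compose[OF measurable_fst horo_coord_measurable[OF that]]
      measurable_compose[OF measurable_snd horo_coord_measurable[OF that]] by auto
  show "(\<lambda>p. horo_act n (snd p) (fst p)) \<in> measurable (horo n \<Otimes>\<^sub>M horo n) (horo n)"
    "(\<lambda>p. horo_inv_act n (snd p) (fst p)) \<in> measurable (horo n \<Otimes>\<^sub>M horo n) (horo n)"
    unfolding horo_act_def horo_inv_act_def using c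
    by (auto intro!: measurable_Pair measurable_restrict borel_measurable_add borel_measurable_times borel_measurable_uminus)
qed

lemma horo_act_measurable1:
  assumes "z \<in> space (horo n)"
  shows "(\<lambda>g. horo_act n g z) \<in> measurable (horo n) (horo n)" "(\<lambda>g. horo_inv_act n g z) \<in> measurable (horo n) (horo n)"
    "horo_act n z \<in> measurable (horo n) (horo n)" "horo_inv_act n z \<in> measurable (horo n) (horo n)"
  using measurable_Pair1'[OF assms, THEN measurable_compose, OF horo_act_measurable(1)]
    measurable_Pair1'[OF assms, THEN measurable_compose, OF horo_act_measurable(2)]
    measurable_Pair2'[OF assms, THEN measurable_compose, OF horo_act_measurable(1)]
    measurable_Pair2'[OF assms, THEN measurable_compose, OF horo_act_measurable(2)] by simp_all

definition horo_weight :: "nat \<Rightarrow> horo_point \<Rightarrow> ennreal" where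
  "horo_weight n g = ennreal (exp (- (real (n - 1) * fst g)))"

lemma horo_weight_measurable [measurable]: "horo_weight n \<in> borel_measurable (horo n)"
  unfolding horo_weight_def by measurable

definition slice :: "nat \<Rightarrow> horo_point set \<Rightarrow> real \<Rightarrow> ennreal" where
  "slice n C t = (\<integral>\<^sup>+a. indicator C (t, a) \<partial>LbI n)"

lemma slice_measurable: "C \<in> sets (horo n) \<Longrightarrow> slice n C \<in> borel_measurable borel"
  unfolding slice_def[abs_def]
  using sigma_finite_measure.borel_measurable_nn_integral_fst[OF sigma_finite_LbI, of "indicator C" lborel n] by simp

text \<open>Shared by the right translations and by the maps sending \<open>g\<close> to the product
  of its inverse with \<open>z\<close>: for fixed \<open>fst g\<close> both are affine in the other
  coordinates, which \<open>LbI_affine\<close> integrates out.\<close>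

lemma weighted_affine_integral:
  assumes C[measurable]: "C \<in> sets (horo n)" and c: "\<And>t. c t \<noteq> 0"
    and T: "(\<lambda>g. (p (fst g), \<lambda>i\<in>{2..n}. x i + c (fst g) * snd g i)) \<in> measurable (horo n) (horo n)"
  shows "(\<integral>\<^sup>+g. horo_weight n g * indicator C (p (fst g), \<lambda>i\<in>{2..n}. x i + c (fst g) * snd g i) \<partial>horo n)
    = (\<integral>\<^sup>+t. ennreal (exp (- (real (n - 1) * t)) / \<bar>c t\<bar> ^ (n - 1)) * slice n C (p t) \<partial>lborel)"
proof -
  have sl: "(\<lambda>a. indicator C (s, a) :: ennreal) \<in> borel_measurable (LbI n)" for s by measurable
  have "(\<integral>\<^sup>+g. horo_weight n g * indicator C (p (fst g), \<lambda>i\<in>{2..n}. x i + c (fst g) * snd g i) \<partial>horo n)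
    = (\<integral>\<^sup>+t. \<integral>\<^sup>+a. horo_weight n (t, a) * indicator C (p (fst (t, a)), \<lambda>i\<in>{2..n}. x i + c (fst (t, a)) * snd (t, a) i) \<partial>LbI n \<partial>lborel)"
    by (intro nn_integral_horo borel_measurable_times_ennreal horo_weight_measurable
        measurable_compose[OF T borel_measurable_indicator[OF C]])
  also have "\<dots> = (\<integral>\<^sup>+t. ennreal (exp (- (real (n - 1) * t)) / \<bar>c t\<bar> ^ (n - 1)) * slice n C (p t) \<partial>lborel)"
  proof (rule nn_integral_cong)
    fix t
    let ?J = "\<integral>\<^sup>+a. indicator C (p t, \<lambda>i\<in>{2..n}. x i + c t * a i) \<partial>LbI n :: ennreal"
    have mm: "(\<lambda>a. \<lambda>i\<in>{2..n}. x i + c t * a i) \<in> measurable (LbI n) (LbI n)" by measurable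
    have "(\<integral>\<^sup>+a. horo_weight n (t, a) * indicator C (p (fst (t, a)), \<lambda>i\<in>{2..n}. x i + c (fst (t, a)) * snd (t, a) i) \<partial>LbI n)
       = ennreal (exp (- (real (n - 1) * t))) * ?J"
      unfolding horo_weight_def fst_conv snd_conv by (intro nn_integral_cmult measurable_compose[OF mm sl])
    also have "ennreal (exp (- (real (n - 1) * t)))
      = ennreal (exp (- (real (n - 1) * t)) / \<bar>c t\<bar> ^ (n - 1)) * ennreal (\<bar>c t\<bar> ^ (n - 1))"
      using c[of t] by (simp flip: ennreal_mult')
    also have "\<dots> * ?J = ennreal (exp (- (real (n - 1) * t)) / \<bar>c t\<bar> ^ (n - 1)) * slice n C (p t)"
      unfolding slice_def mult.assoc LbI_affine[OF c sl] ..
    finally show "(\<integral>\<^sup>+a. horo_weight n (t, a) * indicator C (p (fst (t, a)), \<lambda>i\<in>{2..n}. x i + c (fst (t, a)) * snd (t, a) i) \<partial>LbI n)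
       = ennreal (exp (- (real (n - 1) * t)) / \<bar>c t\<bar> ^ (n - 1)) * slice n C (p t)" .
  qed
  finally show ?thesis .
qed

definition horo_right_haar :: "nat \<Rightarrow> horo_point set \<Rightarrow> ennreal" where
  "horo_right_haar n C = (\<integral>\<^sup>+g. horo_weight n g * indicator C g \<partial>horo n)"

text \<open>Translating by \<open>z\<close> from the right dilates the tail coordinates by the
  exponential of \<open>fst z\<close>, and the weight compensates for this.\<close>

lemma right_translate_integral:
  assumes C[measurable]: "C \<in> sets (horo n)" and z: "z \<in> space (horo n)"
  shows "(\<integral>\<^sup>+g. horo_weight n g * indicator C (horo_act n g z) \<partial>horo n) = horo_right_haar n C"
proof -
  obtain t x where tx: "z = (t, x)" by (cases z)
  let ?w = "\<lambda>s. ennreal (exp (- (real (n - 1) * s)))"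
  have act: "horo_act n g z = (t + fst g, \<lambda>i\<in>{2..n}. x i + exp t * snd g i)" for g
    by (simp add: horo_act_def tx)
  note T = horo_act_measurable1(1)[OF z]
  have "(\<integral>\<^sup>+g. horo_weight n g * indicator C (horo_act n g z) \<partial>horo n)
     = (\<integral>\<^sup>+s. ennreal (exp (- (real (n - 1) * s)) / \<bar>exp t\<bar> ^ (n - 1)) * slice n C (t + s) \<partial>lborel)"
    unfolding act by (intro weighted_affine_integral C T[unfolded act]) simp
  also have "\<dots> = (\<integral>\<^sup>+s. ?w (t + 1 * s) * slice n C (t + 1 * s) \<partial>lborel)"
  proof -
    have "exp (- (real (n - 1) * s)) / \<bar>exp t\<bar> ^ (n - 1) = exp (- (real (n - 1) * (t + 1 * s)))" for s
      by (simp add: exp_of_nat_mult[symmetric] algebra_simps flip: exp_diff)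
    then show ?thesis by simp
  qed
  also have "\<dots> = (\<integral>\<^sup>+s. ?w s * slice n C s \<partial>lborel)"
    using nn_integral_real_affine[of "\<lambda>s. ?w s * slice n C s" 1 t] slice_measurable[OF C] by simp
  also have "\<dots> = (\<integral>\<^sup>+s. \<integral>\<^sup>+a. horo_weight n (s, a) * indicator C (s, a) \<partial>LbI n \<partial>lborel)"
    unfolding slice_def horo_weight_def by (intro nn_integral_cong) (simp add: nn_integral_cmult)
  also have "\<dots> = horo_right_haar n C"
    unfolding horo_right_haar_def by (intro nn_integral_horo[symmetric]) measurable
  finally show ?thesis .
qed

text \<open>Inversion turns the right Haar measure into the left one; the right translation by
  \<open>z\<close> that follows leaves the modular factor \<open>horo_weight n z\<close>.\<close>

lemma inverse_translate_integral:
  assumes A[measurable]: "A \<in> sets (horo n)" and z: "z \<in> space (horo n)"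
  shows "(\<integral>\<^sup>+g. horo_weight n g * indicator A (horo_inv_act n g z) \<partial>horo n) = horo_weight n z * emeasure (horo n) A"
proof -
  obtain t x where tx: "z = (t, x)" by (cases z)
  have act: "horo_inv_act n g z = (t - fst g, \<lambda>i\<in>{2..n}. x i + (- exp (t - fst g)) * snd g i)" for g
    by (simp add: horo_inv_act_def tx)
  note T = horo_act_measurable1(2)[OF z]
  have "(\<integral>\<^sup>+g. horo_weight n g * indicator A (horo_inv_act n g z) \<partial>horo n)
     = (\<integral>\<^sup>+s. ennreal (exp (- (real (n - 1) * s)) / \<bar>- exp (t - s)\<bar> ^ (n - 1)) * slice n A (t - s) \<partial>lborel)"
    unfolding act by (intro weighted_affine_integral A T[unfolded act]) simp
  also have "\<dots> = (\<integral>\<^sup>+s. horo_weight n z * slice n A (t + (-1) * s) \<partial>lborel)"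
  proof -
    have "exp (- (real (n - 1) * s)) / \<bar>- exp (t - s)\<bar> ^ (n - 1) = exp (- (real (n - 1) * t))" for s
      by (simp add: exp_of_nat_mult[symmetric] algebra_simps flip: exp_diff)
    then show ?thesis by (simp add: horo_weight_def tx)
  qed
  also have "\<dots> = horo_weight n z * (\<integral>\<^sup>+s. slice n A (t + (-1) * s) \<partial>lborel)"
    using slice_measurable[OF A] by (intro nn_integral_cmult) simp
  also have "(\<integral>\<^sup>+s. slice n A (t + (-1) * s) \<partial>lborel) = (\<integral>\<^sup>+s. slice n A s \<partial>lborel)"
    using nn_integral_real_affine[of "slice n A" "-1" t] slice_measurable[OF A] by simp
  also have "\<dots> = (\<integral>\<^sup>+g. indicator A g \<partial>horo n)"
    unfolding slice_def by (intro nn_integral_horo[symmetric]) measurable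
  also have "\<dots> = emeasure (horo n) A" by (rule nn_integral_indicator[OF A])
  finally show ?thesis .
qed

text \<open>The uniqueness proof for Haar measure: the integral of \<open>horo_weight n g *
  indicator A z * indicator C (horo_act n g z)\<close> over \<open>z\<close> and \<open>g\<close> is
  computed in both orders. The last factor on the right does not depend on \<open>A\<close>, so
  ratios of measures inside \<open>C\<close> are those of \<open>horo n\<close>.\<close>

lemma invariant_measure_proportional:
  assumes s: "sets L = sets (horo n)"
    and inv: "\<And>g. g \<in> space (horo n) \<Longrightarrow> distr L (horo n) (horo_act n g) = L"
    and C[measurable]: "C \<in> sets (horo n)" and fin: "emeasure L C < \<infinity>"
    and A[measurable]: "A \<in> sets (horo n)" and AC: "A \<subseteq> C"
  shows "emeasure L A * horo_right_haar n C
       = emeasure (horo n) A * (\<integral>\<^sup>+z. horo_weight n z * indicator C z \<partial>L)"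
proof -
  have ms: "measurable L N = measurable (horo n) N" for N :: "'b measure"
    by (rule measurable_cong_sets[OF s refl])
  have sp: "space L = space (horo n)" using sets_eq_imp_space_eq[OF s] .
  \<comment> \<open>\<open>L\<close> is only known to be finite on \<open>C\<close>, so Fubini is
    applied to its restriction to \<open>C\<close>.\<close>
  define V where "V = density L (indicator C)"
  have sV[measurable_cong]: "sets V = sets (horo n)" by (simp add: V_def s)
  have "emeasure V (space V) = emeasure L C"
  proof -
    have "emeasure V (space V) = (\<integral>\<^sup>+z. indicator C z * indicator (space L) z \<partial>L)"
      unfolding V_def space_density using C by (intro emeasure_density) (auto simp: ms)
    also have "\<dots> = (\<integral>\<^sup>+z. indicator C z \<partial>L)"
      by (intro nn_integral_cong) simp
    also have "\<dots> = emeasure L C"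
      using C unfolding s[symmetric] by (rule nn_integral_indicator)
    finally show ?thesis .
  qed
  then have "finite_measure V" using fin by (intro finite_measureI) auto
  then interpret V: finite_measure V .
  interpret pair_sigma_finite V "horo n"
    by (intro pair_sigma_finite.intro V.sigma_finite_measure_axioms sigma_finite_horo)
  have iV: "(\<integral>\<^sup>+z. f z \<partial>V) = (\<integral>\<^sup>+z. indicator C z * f z \<partial>L)" if "f \<in> borel_measurable (horo n)" for f
    unfolding V_def using that by (subst nn_integral_density) (auto simp: ms)
  define h where "h = horo_right_haar n C"
  have "emeasure L A * h = (\<integral>\<^sup>+z. h * indicator A z \<partial>L)"
    using A s by (simp add: nn_integral_cmult_indicator mult.commute)
  also have "\<dots> = (\<integral>\<^sup>+z. indicator C z * (\<integral>\<^sup>+g. horo_weight n g * (indicator A z * indicator C (horo_act n g z)) \<partial>horo n) \<partial>L)"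
  proof (intro nn_integral_cong)
    fix z assume z: "z \<in> space L"
    show "h * indicator A z = indicator C z * (\<integral>\<^sup>+g. horo_weight n g * (indicator A z * indicator C (horo_act n g z)) \<partial>horo n)"
      using AC right_translate_integral[OF C, of z] z sp by (auto simp: h_def split: split_indicator)
  qed
  also have "\<dots> = (\<integral>\<^sup>+z. \<integral>\<^sup>+g. horo_weight n g * (indicator A z * indicator C (horo_act n g z)) \<partial>horo n \<partial>V)"
    by (rule iV[symmetric]) measurable
  also have "\<dots> = (\<integral>\<^sup>+g. \<integral>\<^sup>+z. horo_weight n g * (indicator A z * indicator C (horo_act n g z)) \<partial>V \<partial>horo n)"
    by (rule Fubini'[symmetric]) measurable
  also have "\<dots> = (\<integral>\<^sup>+g. \<integral>\<^sup>+z. horo_weight n g * indicator A (horo_inv_act n g z) \<partial>V \<partial>horo n)"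
  proof (rule nn_integral_cong)
    fix g assume g: "g \<in> space (horo n)"
    note [measurable] = horo_act_measurable1(3,4)[OF g]
    have "(\<integral>\<^sup>+z. horo_weight n g * (indicator A z * indicator C (horo_act n g z)) \<partial>V)
       = (\<integral>\<^sup>+z. indicator C z * (horo_weight n g * (indicator A z * indicator C (horo_act n g z))) \<partial>L)"
      by (rule iV) measurable
    \<comment> \<open>As \<open>A \<subseteq> C\<close>, the factor \<open>indicator C z\<close> can
      go. The integrand then depends on \<open>horo_act n g z\<close> alone, invariance replaces
      that point by \<open>z\<close>, and the other indicator of \<open>C\<close> brings back the
      restriction \<open>V\<close>.\<close>
    also have "\<dots> = (\<integral>\<^sup>+z. indicator C (horo_act n g z) * (horo_weight n g * indicator A (horo_inv_act n g (horo_act n g z))) \<partial>L)"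
      using AC sp by (intro nn_integral_cong) (auto simp: horo_inv_act_act split: split_indicator)
    also have "\<dots> = (\<integral>\<^sup>+z. indicator C z * (horo_weight n g * indicator A (horo_inv_act n g z)) \<partial>distr L (horo n) (horo_act n g))"
      by (subst nn_integral_distr) (auto simp: ms)
    also have "\<dots> = (\<integral>\<^sup>+z. indicator C z * (horo_weight n g * indicator A (horo_inv_act n g z)) \<partial>L)"
      unfolding inv[OF g] ..
    also have "\<dots> = (\<integral>\<^sup>+z. horo_weight n g * indicator A (horo_inv_act n g z) \<partial>V)"
      by (rule iV[symmetric]) measurable
    finally show "(\<integral>\<^sup>+z. horo_weight n g * (indicator A z * indicator C (horo_act n g z)) \<partial>V)
      = (\<integral>\<^sup>+z. horo_weight n g * indicator A (horo_inv_act n g z) \<partial>V)" .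
  qed
  also have "\<dots> = (\<integral>\<^sup>+z. \<integral>\<^sup>+g. horo_weight n g * indicator A (horo_inv_act n g z) \<partial>horo n \<partial>V)"
    by (rule Fubini') measurable
  also have "\<dots> = (\<integral>\<^sup>+z. indicator C z * (\<integral>\<^sup>+g. horo_weight n g * indicator A (horo_inv_act n g z) \<partial>horo n) \<partial>L)"
    by (rule iV) measurable
  also have "\<dots> = (\<integral>\<^sup>+z. emeasure (horo n) A * (horo_weight n z * indicator C z) \<partial>L)"
    using sp by (intro nn_integral_cong) (simp add: inverse_translate_integral[OF A] mult_ac)
  also have "\<dots> = emeasure (horo n) A * (\<integral>\<^sup>+z. horo_weight n z * indicator C z \<partial>L)"
    by (intro nn_integral_cmult) (simp add: ms)
  finally show ?thesis by (simp add: h_def)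
qed

section \<open>Volumes of hyperbolic balls\<close>

abbreviation tail_sq :: "nat \<Rightarrow> (nat \<Rightarrow> real) \<Rightarrow> real" where
  "tail_sq n x \<equiv> \<Sum>i=2..n. (x i)\<^sup>2"

abbreviation hcube :: "nat \<Rightarrow> real \<Rightarrow> (nat \<Rightarrow> real) set" where
  "hcube n b \<equiv> Pi\<^sub>E {2..n} (\<lambda>_. {-b..b})"

text \<open>The image of \<open>hyp_ball0\<close> in these coordinates: \<open>2 * x 0\<close> is
  the sum of \<open>x 0 - x 1\<close> and \<open>x 0 + x 1\<close>, whose product is
  \<open>1 + tail_sq n x\<close>.\<close>

definition horo_ball :: "nat \<Rightarrow> real \<Rightarrow> horo_point set" where
  "horo_ball n r = {z \<in> space (horo n). exp (fst z) + (1 + (tail_sq n (snd z))) * exp (- fst z) \<le> 2 * cosh r}"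

lemma horo_ball_measurable [measurable]: "horo_ball n r \<in> sets (horo n)"
  unfolding horo_ball_def by measurable

text \<open>\<open>w\<close> is the square of the radius; it may be negative, and then the ball is
  empty.\<close>

definition eucl_ball :: "nat \<Rightarrow> real \<Rightarrow> (nat \<Rightarrow> real) set" where
  "eucl_ball n w = {x \<in> space (LbI n). tail_sq n x \<le> w}"

definition eucl_ball_vol :: "nat \<Rightarrow> real \<Rightarrow> ennreal" where
  "eucl_ball_vol n w = emeasure (LbI n) (eucl_ball n w)"

lemma eucl_ball_sets [measurable]: "eucl_ball n w \<in> sets (LbI n)"
  unfolding eucl_ball_def by measurable

lemma eucl_ball_vol_measurable [measurable]: "eucl_ball_vol n \<in> borel_measurable borel"
proof -
  \<comment> \<open>The balls of all radii are the sections of one measurable solid paraboloid, so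
    \<open>slice_measurable\<close> applies.\<close>
  let ?S = "{z \<in> space (horo n). (tail_sq n (snd z)) \<le> fst z}"
  have "slice n ?S w = eucl_ball_vol n w" for w
  proof -
    have "slice n ?S w = (\<integral>\<^sup>+a. indicator (eucl_ball n w) a \<partial>LbI n)"
      unfolding slice_def by (intro nn_integral_cong) (auto simp: eucl_ball_def space_pair_measure split: split_indicator)
    also have "\<dots> = eucl_ball_vol n w"
      unfolding eucl_ball_vol_def by (rule nn_integral_indicator) (rule eucl_ball_sets)
    finally show ?thesis .
  qed
  moreover have "slice n ?S \<in> borel_measurable borel" by (rule slice_measurable) measurable
  ultimately show ?thesis by (simp add: fun_eq_iff[symmetric] ext[of "slice n ?S" "eucl_ball_vol n"])
qed

lemma eucl_ball_vol_neg:
  assumes "w < 0"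
  shows "eucl_ball_vol n w = 0"
proof -
  have "tail_sq n x \<ge> 0" for x :: "nat \<Rightarrow> real" by (intro sum_nonneg) auto
  then have "eucl_ball n w = {}"
    unfolding eucl_ball_def using assms by (auto simp: not_le intro: less_le_trans)
  then show ?thesis by (simp only: eucl_ball_vol_def emeasure_empty)
qed

lemma eucl_ball_vol_scale:
  assumes S: "S > 0"
  shows "eucl_ball_vol n (S\<^sup>2 * w) = ennreal (S ^ (n - 1)) * eucl_ball_vol n w"
proof -
  let ?B = "eucl_ball n"
  have eq: "indicator (?B (S\<^sup>2 * w)) (\<lambda>i\<in>{2..n}. 0 + S * a i) = (indicator (?B w) a :: ennreal)"
    if a: "a \<in> space (LbI n)" for a
  proof -
    have "(\<lambda>i\<in>{2..n}. 0 + S * a i) \<in> space (LbI n)" by (auto simp: space_PiM)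
    moreover have "(\<Sum>i=2..n. ((\<lambda>i\<in>{2..n}. 0 + S * a i) i)\<^sup>2) = S\<^sup>2 * (tail_sq n a)"
      by (simp add: power_mult_distrib sum_distrib_left)
    ultimately show ?thesis using a S by (auto split: split_indicator simp: eucl_ball_def mult_le_cancel_left_pos)
  qed
  have "eucl_ball_vol n (S\<^sup>2 * w) = (\<integral>\<^sup>+a. indicator (?B (S\<^sup>2 * w)) a \<partial>LbI n)"
    unfolding eucl_ball_vol_def by (rule nn_integral_indicator[symmetric]) (rule eucl_ball_sets)
  also have "\<dots> = ennreal (\<bar>S\<bar> ^ (n - 1)) * (\<integral>\<^sup>+a. indicator (?B (S\<^sup>2 * w)) (\<lambda>i\<in>{2..n}. 0 + S * a i) \<partial>LbI n)"
    using S by (intro LbI_affine[symmetric] borel_measurable_indicator eucl_ball_sets) auto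
  also have "(\<integral>\<^sup>+a. indicator (?B (S\<^sup>2 * w)) (\<lambda>i\<in>{2..n}. 0 + S * a i) \<partial>LbI n) = (\<integral>\<^sup>+a. indicator (?B w) a \<partial>LbI n)"
    by (intro nn_integral_cong eq)
  also have "\<dots> = eucl_ball_vol n w"
    unfolding eucl_ball_vol_def by (rule nn_integral_indicator) (rule eucl_ball_sets)
  finally show ?thesis using S by simp
qed

text \<open>The defining inequality is multiplied by \<open>exp t\<close> and the square
  completed.\<close>

lemma horo_ball_section:
  "slice n (horo_ball n r) t = eucl_ball_vol n ((sinh r)\<^sup>2 - (exp t - cosh r)\<^sup>2)"
proof -
  let ?w = "(sinh r)\<^sup>2 - (exp t - cosh r)\<^sup>2"
  have iff: "exp t + (1 + q) * exp (- t) \<le> 2 * cosh r \<longleftrightarrow> q \<le> ?w" for q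
  proof -
    have "exp t + (1 + q) * exp (- t) \<le> 2 * cosh r \<longleftrightarrow> exp t * (exp t + (1 + q) * exp (- t)) \<le> exp t * (2 * cosh r)"
      by (rule mult_le_cancel_left_pos[symmetric]) simp
    also have "exp t * (exp t + (1 + q) * exp (- t)) = (exp t)\<^sup>2 + 1 + q"
      by (simp add: algebra_simps power2_eq_square exp_minus_inverse exp_minus)
    also have "(exp t)\<^sup>2 + 1 + q \<le> exp t * (2 * cosh r) \<longleftrightarrow> q \<le> ?w"
      by (simp add: power2_diff sinh_square_eq algebra_simps)
    finally show ?thesis .
  qed
  have "slice n (horo_ball n r) t
      = (\<integral>\<^sup>+a. indicator (eucl_ball n ?w) a \<partial>LbI n)"
    unfolding slice_def using iff by (intro nn_integral_cong) (auto simp: horo_ball_def eucl_ball_def space_pair_measure split: split_indicator)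
  also have "\<dots> = eucl_ball_vol n ?w"
    unfolding eucl_ball_vol_def by (rule nn_integral_indicator) (rule eucl_ball_sets)
  finally show ?thesis .
qed

text \<open>In the coordinates \<open>exp t\<close> and \<open>x\<close> the ball is Euclidean with center \<open>cosh r\<close> and radius \<open>sinh r\<close>;
  substitute \<open>exp t = cosh r + sinh r * v\<close>.\<close>

lemma horo_ball_volume:
  assumes r: "r > 0"
  shows "emeasure (horo n) (horo_ball n r) = (\<integral>\<^sup>+v. eucl_ball_vol n (1 - v\<^sup>2) * ennreal (sinh r ^ (n - 1))
     * ennreal (sinh r / (cosh r + sinh r * v)) * indicator {-1..1} v \<partial>lborel)"
proof -
  define S c where "S = sinh r" and "c = cosh r"
  have S: "S > 0" using r by (simp add: S_def)
  have cS: "c - S = exp (- r)" "c + S = exp r" by (simp_all add: c_def S_def cosh_minus_sinh cosh_plus_sinh)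
  have pos: "c + S * v > 0" if "v \<in> {-1..1}" for v
  proof -
    have "S * (- 1) \<le> S * v" using that S by (intro mult_left_mono) auto
    moreover have "c - S > 0" unfolding cS by simp
    ultimately show ?thesis by simp
  qed
  define f where "f = (\<lambda>t. eucl_ball_vol n (S\<^sup>2 - (exp t - c)\<^sup>2))"
  define g where "g = (\<lambda>v. ln (c + S * v))"
  have fm: "f \<in> borel_measurable borel"
    using slice_measurable[OF horo_ball_measurable, of n r]
    unfolding horo_ball_section[abs_def] f_def S_def c_def by simp
  have g1: "g (-1) = - r" "g 1 = r" using cS by (simp_all add: g_def)
  \<comment> \<open>The substitution only reaches the values from \<open>-r\<close> to
    \<open>r\<close>; outside, the squared radius is negative and the section empty.\<close>
  have f0: "f t = f t * indicator {g (-1)..g 1} t" for t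
  proof (cases "t \<in> {-r..r}")
    case False
    have "S\<^sup>2 < (exp t - c)\<^sup>2"
    proof (cases "t > r")
      case True
      then have "exp t > c + S" unfolding cS by simp
      then show ?thesis using S by (intro power_strict_mono) auto
    next
      case False
      then have "t < - r" using \<open>t \<notin> {-r..r}\<close> by auto
      then have "exp t < c - S" unfolding cS by simp
      then have "S\<^sup>2 < (c - exp t)\<^sup>2" using S by (intro power_strict_mono) auto
      then show ?thesis by (simp add: power2_commute)
    qed
    then have "f t = 0" by (simp add: f_def eucl_ball_vol_neg)
    then show ?thesis by simp
  qed (simp add: g1)
  have fg: "f (g v) = eucl_ball_vol n (1 - v\<^sup>2) * ennreal (S ^ (n - 1))" if v: "v \<in> {-1..1}" for v
  proof -
    have "S\<^sup>2 - (exp (g v) - c)\<^sup>2 = S\<^sup>2 * (1 - v\<^sup>2)"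
      using pos[OF v] by (simp add: g_def power_mult_distrib right_diff_distrib)
    then show ?thesis by (simp add: f_def eucl_ball_vol_scale[OF S] mult.commute)
  qed
  have "emeasure (horo n) (horo_ball n r) = (\<integral>\<^sup>+z. indicator (horo_ball n r) z \<partial>horo n)"
    by (rule nn_integral_indicator[symmetric]) measurable
  also have "\<dots> = (\<integral>\<^sup>+t. slice n (horo_ball n r) t \<partial>lborel)"
    unfolding slice_def by (intro nn_integral_horo) measurable
  also have "\<dots> = (\<integral>\<^sup>+t. f t * indicator {g (-1)..g 1} t \<partial>lborel)"
    unfolding horo_ball_section f_def[symmetric] S_def[symmetric] c_def[symmetric] f0[symmetric] ..
  also have "\<dots> = (\<integral>\<^sup>+v. f (g v) * ennreal (S / (c + S * v)) * indicator {-1..1} v \<partial>lborel)"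
  proof (rule nn_integral_substitution_aux[OF fm])
    show "(g has_real_derivative S / (c + S * v)) (at v)" if "v \<in> {-1..1}" for v
      unfolding g_def using pos[OF that] by (auto intro!: derivative_eq_intros)
    show "continuous_on {-1..1} (\<lambda>v. S / (c + S * v))"
      using pos by (intro continuous_intros) (auto simp: less_imp_neq[THEN not_sym])
    show "0 \<le> S / (c + S * v)" if "v \<in> {-1..1}" for v
      using pos[OF that] S by simp
  qed auto
  also have "\<dots> = (\<integral>\<^sup>+v. eucl_ball_vol n (1 - v\<^sup>2) * ennreal (S ^ (n - 1)) * ennreal (S / (c + S * v)) * indicator {-1..1} v \<partial>lborel)"
    using fg by (intro nn_integral_cong) (auto split: split_indicator)
  finally show ?thesis by (simp add: S_def c_def)
qed

text \<open>The integrands are compared for each \<open>v\<close>. The power of \<open>sinh\<close>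
  gives the ratio, and the remaining factor \<open>sinh r / (cosh r + sinh r * v)\<close> grows with
  \<open>r\<close> because \<open>tanh\<close> does.\<close>

lemma horo_ball_volume_ratio:
  assumes r: "0 < r" and R: "r \<le> R"
  shows "emeasure (horo n) (horo_ball n r) \<le> ennreal ((sinh r / sinh R) ^ (n - 1)) * emeasure (horo n) (horo_ball n R)"
proof -
  let ?q = "(sinh r / sinh R) ^ (n - 1)"
  let ?h = "\<lambda>r v. eucl_ball_vol n (1 - v\<^sup>2) * ennreal (sinh r ^ (n - 1)) * ennreal (sinh r / (cosh r + sinh r * v)) * indicator {-1..1} v"
  have sp: "sinh r > 0" "sinh R > 0" using r R by auto
  have tanh: "sinh r * cosh R \<le> sinh R * cosh r"
  proof -
    have "0 \<le> sinh (R - r)" using R by simp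
    then show ?thesis unfolding sinh_diff by (simp only: mult.commute diff_ge_0_iff_ge)
  qed
  have frac: "sinh r / (cosh r + sinh r * v) \<le> sinh R / (cosh R + sinh R * v)" if v: "v \<in> {-1..1}" for v
  proof -
    have pos: "cosh s + sinh s * v > 0" if "s > 0" for s
    proof -
      have "sinh s * (- 1) \<le> sinh s * v" using v that by (intro mult_left_mono) auto
      moreover have "cosh s - sinh s > 0" unfolding cosh_minus_sinh by simp
      ultimately show ?thesis by simp
    qed
    show ?thesis
      using tanh pos[OF r] pos[of R] r R by (simp add: divide_simps) (simp add: algebra_simps)
  qed
  have "ennreal ?q * emeasure (horo n) (horo_ball n R) = (\<integral>\<^sup>+v. ennreal ?q * ?h R v \<partial>lborel)"
  proof -
    show ?thesis
      unfolding horo_ball_volume[OF less_le_trans[OF r R]]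
      by (intro nn_integral_cmult[symmetric]) simp
  qed
  moreover have "?h r v \<le> ennreal ?q * ?h R v" for v
  proof (cases "v \<in> {-1..1}")
    case True
    have "ennreal (sinh r ^ (n - 1)) * ennreal (sinh r / (cosh r + sinh r * v)) \<le> ennreal (?q * sinh R ^ (n - 1)) * ennreal (sinh R / (cosh R + sinh R * v))"
      using sp frac[OF True] by (intro mult_mono ennreal_leI) (auto simp: power_divide)
    also have "ennreal (?q * sinh R ^ (n - 1)) = ennreal ?q * ennreal (sinh R ^ (n - 1))"
      using sp by (intro ennreal_mult) auto
    finally have "eucl_ball_vol n (1 - v\<^sup>2) * (ennreal (sinh r ^ (n - 1)) * ennreal (sinh r / (cosh r + sinh r * v)))
      \<le> eucl_ball_vol n (1 - v\<^sup>2) * (ennreal ?q * ennreal (sinh R ^ (n - 1)) * ennreal (sinh R / (cosh R + sinh R * v)))"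
      by (rule mult_left_mono) simp
    then show ?thesis using True by (simp add: mult_ac)
  qed simp
  ultimately show ?thesis
    unfolding horo_ball_volume[OF r] by (metis (no_types, lifting) nn_integral_mono)
qed

section \<open>Right Haar measure of a ball\<close>

lemma horo_box:
  assumes "0 \<le> a" "0 \<le> b"
  shows "{-a..a} \<times> hcube n b \<in> sets (horo n)"
    "emeasure (horo n) ({-a..a} \<times> hcube n b) = ennreal (2 * a) * ennreal (2 * b) ^ (n - 1)"
proof -
  have B: "hcube n b \<in> sets (LbI n)" by (intro sets_PiM_I_finite) auto
  then show "{-a..a} \<times> hcube n b \<in> sets (horo n)" by (intro pair_measureI) auto
  have "emeasure (LbI n) (hcube n b) = (\<Prod>i\<in>{2..n}. emeasure lborel {-b..b})"
    by (intro product_sigma_finite.emeasure_PiM[OF product_sigma_finite_lborel]) auto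
  then have "emeasure (LbI n) (hcube n b) = ennreal (2 * b) ^ (n - 1)"
    using assms by simp
  then show "emeasure (horo n) ({-a..a} \<times> hcube n b) = ennreal (2 * a) * ennreal (2 * b) ^ (n - 1)"
    using sigma_finite_measure.emeasure_pair_measure_Times[OF sigma_finite_LbI _ B, of "{-a..a}" lborel] assms by simp
qed

lemma horo_ball_bounds:
  assumes z: "z \<in> horo_ball n R" and R: "R > 0"
  shows "\<bar>fst z\<bar> \<le> R" and "i \<in> {2..n} \<Longrightarrow> \<bar>snd z i\<bar> \<le> sqrt (2 * cosh R * exp R)"
proof -
  define q where "q = (tail_sq n (snd z))"
  have q: "q \<ge> 0" by (auto simp: q_def intro: sum_nonneg)
  have le: "exp (fst z) + (1 + q) * exp (- fst z) \<le> 2 * cosh R"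
    using z by (simp add: horo_ball_def q_def)
  have "2 * cosh \<bar>fst z\<bar> = exp (fst z) + exp (- fst z)"
    by (cases "fst z \<ge> 0") (simp_all add: cosh_field_def field_simps)
  also have "\<dots> \<le> exp (fst z) + (1 + q) * exp (- fst z)" using q by simp
  finally have "cosh \<bar>fst z\<bar> \<le> cosh R" using le by linarith
  then show t: "\<bar>fst z\<bar> \<le> R" using R by (subst (asm) cosh_real_nonneg_le_iff) auto
  assume i: "i \<in> {2..n}"
  have "(snd z i)\<^sup>2 \<le> q" unfolding q_def using i by (intro member_le_sum) auto
  also have "q = q * exp (- fst z) * exp (fst z)" by (simp add: exp_minus)
  also have "\<dots> \<le> 2 * cosh R * exp R"
  proof (rule mult_mono)
    have "q * exp (- fst z) \<le> (1 + q) * exp (- fst z)" by (simp add: distrib_right)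
    then show "q * exp (- fst z) \<le> 2 * cosh R" using le exp_ge_zero[of "fst z"] by linarith
  qed (use t q in auto)
  finally show "\<bar>snd z i\<bar> \<le> sqrt (2 * cosh R * exp R)"
    using real_le_rsqrt[of "\<bar>snd z i\<bar>"] by simp
qed

text \<open>Both bounds are needed to cancel this factor in \<open>intensity_ball_ratio\<close>. The
  ball lies in a box, which gives finiteness, and contains a smaller box, which gives positivity as
  the weight never vanishes.\<close>

lemma horo_ball_weight:
  assumes R: "R > 0"
  shows "0 < horo_right_haar n (horo_ball n R)"
    and "horo_right_haar n (horo_ball n R) < \<infinity>"
proof -
  let ?B = "sqrt (2 * cosh R * exp R)"
  have B0: "?B \<ge> 0" by (simp add: cosh_real_nonneg)
  have sub: "horo_ball n R \<subseteq> {-R..R} \<times> hcube n ?B"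
  proof
    fix z assume z: "z \<in> horo_ball n R"
    then have "z \<in> space (horo n)" by (simp add: horo_ball_def)
    then show "z \<in> {-R..R} \<times> hcube n ?B"
      using horo_ball_bounds[OF z R] by (cases z) (auto simp: space_pair_measure space_PiM PiE_iff abs_le_iff minus_le_iff)
  qed
  have "horo_right_haar n (horo_ball n R)
    \<le> (\<integral>\<^sup>+g. ennreal (exp (real (n - 1) * R)) * indicator ({-R..R} \<times> hcube n ?B) g \<partial>horo n)"
    unfolding horo_right_haar_def
  proof (intro nn_integral_mono)
    fix g
    show "horo_weight n g * indicator (horo_ball n R) g \<le> ennreal (exp (real (n - 1) * R)) * indicator ({-R..R} \<times> hcube n ?B) g"
    proof (cases "g \<in> horo_ball n R")
      case True
      have "- (real (n - 1) * fst g) \<le> real (n - 1) * R"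
      proof -
        have "real (n - 1) * (- fst g) \<le> real (n - 1) * R"
          using horo_ball_bounds(1)[OF True R] by (intro mult_left_mono) auto
        then show ?thesis by simp
      qed
      then have "horo_weight n g \<le> ennreal (exp (real (n - 1) * R))"
        unfolding horo_weight_def by (intro ennreal_leI) simp
      moreover have "g \<in> {-R..R} \<times> hcube n ?B" using True sub by blast
      ultimately show ?thesis using True by simp
    qed simp
  qed
  also have "\<dots> = ennreal (exp (real (n - 1) * R)) * (ennreal (2 * R) * ennreal (2 * ?B) ^ (n - 1))"
    using horo_box[of R ?B n] B0 R by (subst nn_integral_cmult_indicator) auto
  also have "\<dots> < \<infinity>" by (simp add: ennreal_mult_less_top power_less_top_ennreal)
  finally show "horo_right_haar n (horo_ball n R) < \<infinity>" .
  \<comment> \<open>\<open>e\<close> will be the half-width of a box inside the ball. It exists by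
    continuity, since the estimate on the box tends to \<open>2 < 2 * cosh R\<close>.\<close>
  have "((\<lambda>e. 2 * cosh e + real n * e\<^sup>2 * exp e) \<longlongrightarrow> 2 * cosh 0 + real n * 0\<^sup>2 * exp 0) (at_right (0::real))"
    by (intro tendsto_intros)
  moreover have "2 * cosh 0 + real n * 0\<^sup>2 * exp 0 < 2 * cosh R"
    using R cosh_real_nonneg_less_iff[of 0 R] by simp
  ultimately have "\<forall>\<^sub>F e in at_right 0. 2 * cosh e + real n * e\<^sup>2 * exp e < 2 * cosh R"
    by (rule order_tendstoD(2))
  moreover have "\<forall>\<^sub>F e in at_right (0::real). e > 0" by (rule eventually_at_right_less)
  ultimately obtain e where e: "2 * cosh e + real n * e\<^sup>2 * exp e < 2 * cosh R" "e > 0"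
    using eventually_happens'[OF _ eventually_conj] by (metis (no_types, lifting) trivial_limit_at_right_real)
  have box: "{-e..e} \<times> hcube n e \<subseteq> horo_ball n R"
  proof
    fix z assume z: "z \<in> {-e..e} \<times> hcube n e"
    obtain t x where tx: "z = (t, x)" by (cases z)
    have t: "\<bar>t\<bar> \<le> e" and x: "\<And>i. i \<in> {2..n} \<Longrightarrow> \<bar>x i\<bar> \<le> e" and xe: "x \<in> extensional {2..n}"
      using z by (auto simp: tx PiE_iff abs_le_iff minus_le_iff)
    have "tail_sq n x \<le> (\<Sum>i=2..n. e\<^sup>2)"
    proof (intro sum_mono)
      fix i assume "i \<in> {2..n}"
      then show "(x i)\<^sup>2 \<le> e\<^sup>2" using x[of i] by (simp flip: abs_le_square_iff)
    qed
    also have "\<dots> \<le> real n * e\<^sup>2" by (simp add: mult_right_mono)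
    finally have q: "tail_sq n x \<le> real n * e\<^sup>2" .
    have "exp t + (1 + (tail_sq n x)) * exp (- t) = 2 * cosh \<bar>t\<bar> + tail_sq n x * exp (- t)"
      by (cases "t \<ge> 0") (simp_all add: cosh_field_def field_simps)
    also have "\<dots> \<le> 2 * cosh e + real n * e\<^sup>2 * exp e"
    proof (intro add_mono mult_mono)
      show "cosh \<bar>t\<bar> \<le> cosh e" using t by (subst cosh_real_nonneg_le_iff) auto
    qed (use t q in auto)
    finally show "z \<in> horo_ball n R"
      using e(1) xe by (simp add: horo_ball_def tx space_pair_measure space_PiM PiE_def)
  qed
  have "0 < ennreal (2 * e) * ennreal (2 * e) ^ (n - 1)"
    using e(2) by (simp add: ennreal_zero_less_mult_iff ennreal_power)
  also have "\<dots> = emeasure (horo n) ({-e..e} \<times> hcube n e)"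
    using horo_box(2)[of e e n] e(2) by simp
  also have "\<dots> \<le> emeasure (horo n) (horo_ball n R)"
    by (intro emeasure_mono box) measurable
  finally have pos: "emeasure (horo n) (horo_ball n R) > 0" .
  show "0 < horo_right_haar n (horo_ball n R)"
  proof (rule ccontr)
    assume "\<not> ?thesis"
    then have "horo_right_haar n (horo_ball n R) = 0" by simp
    then have "AE g in horo n. horo_weight n g * indicator (horo_ball n R) g = 0"
      unfolding horo_right_haar_def by (subst (asm) nn_integral_0_iff_AE) auto
    then have "AE g in horo n. g \<notin> horo_ball n R"
      by eventually_elim (auto simp: horo_weight_def)
    then have "emeasure (horo n) (horo_ball n R) = 0"
      by (subst (asm) AE_iff_measurable[OF horo_ball_measurable]) (auto simp: horo_ball_def)
    with pos show False by simp
  qed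
qed

section \<open>Bounding the density by spherical codes\<close>

lemma lorentz_light_cone:
  assumes "n \<ge> 1"
  shows "lorentz n x y = ((x 0 - x 1) * (y 0 + y 1) + (x 0 + x 1) * (y 0 - y 1)) / 2 - (\<Sum>i=2..n. x i * y i)"
proof -
  have "(\<Sum>i=1..n. x i * y i) = x 1 * y 1 + (\<Sum>i=2..n. x i * y i)"
    using assms by (simp add: sum.atLeast_Suc_atMost numeral_2_eq_2)
  then show ?thesis by (simp add: lorentz_def field_simps)
qed

lemma hyp_light_cone:
  assumes n: "n \<ge> 1" and x: "x \<in> hyp_space n"
  shows "x 0 - x 1 > 0" "x 0 + x 1 > 0" "(x 0 - x 1) * (x 0 + x 1) = 1 + (tail_sq n x)"
proof -
  show e: "(x 0 - x 1) * (x 0 + x 1) = 1 + (tail_sq n x)"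
    using lorentz_self[OF x] lorentz_light_cone[OF n, of x x] by (simp add: power2_eq_square algebra_simps)
  have "tail_sq n x \<ge> 0" by (intro sum_nonneg) auto
  then have p: "(x 0 - x 1) * (x 0 + x 1) > 0" unfolding e by linarith
  have "x 0 > 0" using x by (simp add: hyp_space_def)
  with p show "x 0 - x 1 > 0" "x 0 + x 1 > 0"
    by (auto simp: zero_less_mult_iff)
qed

definition horo_coords :: "nat \<Rightarrow> (nat \<Rightarrow> real) \<Rightarrow> horo_point" where
  "horo_coords n x = (ln (x 0 - x 1), \<lambda>i\<in>{2..n}. x i)"

lemma hyp_eqI_light_cone:
  assumes n: "n \<ge> 1" and x: "x \<in> hyp_space n" and y: "y \<in> hyp_space n"
    and u: "x 0 - x 1 = y 0 - y 1" and i: "\<And>i. i \<in> {2..n} \<Longrightarrow> x i = y i"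
  shows "x = y"
proof -
  have "(x 0 - x 1) * (x 0 + x 1) = (x 0 - x 1) * (y 0 + y 1)"
    using hyp_light_cone(3)[OF n x] hyp_light_cone(3)[OF n y] i u by simp
  then have v: "x 0 + x 1 = y 0 + y 1" using hyp_light_cone(1)[OF n x] by simp
  have "x j = y j" for j
  proof -
    consider "j = 0" | "j = 1" | "j \<in> {2..n}" | "j > n" by fastforce
    then show ?thesis using u v i x y by cases (auto simp: hyp_space_def)
  qed
  then show ?thesis by auto
qed

text \<open>A parabolic motion by \<open>snd g\<close> followed by a boost by \<open>fst g\<close>;
  \<open>u\<close> and \<open>v\<close> are the new values of \<open>x 0 - x 1\<close> and
  \<open>x 0 + x 1\<close>. Given the other coordinates, \<open>v\<close> is what preserves the
  Lorentz form.\<close>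

definition horo_motion :: "nat \<Rightarrow> horo_point \<Rightarrow> (nat \<Rightarrow> real) \<Rightarrow> (nat \<Rightarrow> real)" where
  "horo_motion n g x =
    (let u = exp (fst g) * (x 0 - x 1);
         v = exp (- fst g) * (x 0 + x 1 + 2 * (\<Sum>i=2..n. snd g i * x i) + (tail_sq n (snd g)) * (x 0 - x 1))
     in (\<lambda>i. if i = 0 then (v + u) / 2 else if i = 1 then (v - u) / 2
             else if i \<le> n then x i + (x 0 - x 1) * snd g i else 0))"

lemma horo_motion_coords:
  "horo_motion n g x 0 - horo_motion n g x 1 = exp (fst g) * (x 0 - x 1)"
  "horo_motion n g x 0 + horo_motion n g x 1 =
     exp (- fst g) * (x 0 + x 1 + 2 * (\<Sum>i=2..n. snd g i * x i) + (tail_sq n (snd g)) * (x 0 - x 1))"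
  "i \<in> {2..n} \<Longrightarrow> horo_motion n g x i = x i + (x 0 - x 1) * snd g i"
  by (simp_all add: horo_motion_def Let_def field_simps)

lemma lorentz_horo_motion:
  assumes n: "n \<ge> 1"
  shows "lorentz n (horo_motion n g x) (horo_motion n g y) = lorentz n x y"
proof -
  have e: "exp (fst g) * exp (- fst g) = 1" by (simp add: exp_minus)
  define u v where "u = x 0 - x 1" and "v = x 0 + x 1"
  define u' v' where "u' = y 0 - y 1" and "v' = y 0 + y 1"
  define a where "a = snd g"
  define xa ya aa where "xa = (\<Sum>i=2..n. a i * x i)" and "ya = (\<Sum>i=2..n. a i * y i)" and "aa = (tail_sq n a)"
  have s: "(\<Sum>i=2..n. horo_motion n g x i * horo_motion n g y i) = (\<Sum>i=2..n. x i * y i) + u' * xa + u * ya + u * u' * aa"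
  proof -
    have "(\<Sum>i=2..n. horo_motion n g x i * horo_motion n g y i) = (\<Sum>i=2..n. (x i + u * a i) * (y i + u' * a i))"
      by (intro sum.cong refl) (simp add: horo_motion_coords(3) u_def u'_def a_def)
    then show ?thesis
      by (simp add: xa_def ya_def aa_def algebra_simps sum.distrib sum_distrib_left power2_eq_square)
  qed
  have "lorentz n (horo_motion n g x) (horo_motion n g y) =
      ((exp (fst g) * u) * (exp (- fst g) * (v' + 2 * ya + aa * u')) + (exp (- fst g) * (v + 2 * xa + aa * u)) * (exp (fst g) * u')) / 2
      - ((\<Sum>i=2..n. x i * y i) + u' * xa + u * ya + u * u' * aa)"
    unfolding lorentz_light_cone[OF n] s horo_motion_coords(1,2)
    by (simp add: u_def v_def u'_def v'_def xa_def ya_def aa_def a_def)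
  also have "\<dots> = ((exp (fst g) * exp (- fst g)) * (u * (v' + 2 * ya + aa * u')) + (exp (fst g) * exp (- fst g)) * ((v + 2 * xa + aa * u) * u')) / 2
      - ((\<Sum>i=2..n. x i * y i) + u' * xa + u * ya + u * u' * aa)"
    by (simp only: ac_simps)
  also have "\<dots> = lorentz n x y"
    unfolding e lorentz_light_cone[OF n] by (simp add: u_def v_def u'_def v'_def field_simps)
  finally show ?thesis .
qed

lemma horo_motion_mem:
  assumes n: "n \<ge> 1" and x: "x \<in> hyp_space n"
  shows "horo_motion n g x \<in> hyp_space n"
proof -
  let ?y = "horo_motion n g x"
  have L: "lorentz n ?y ?y = 1" using lorentz_horo_motion[OF n] lorentz_self[OF x] by simp
  have u: "?y 0 - ?y 1 > 0" unfolding horo_motion_coords using hyp_light_cone(1)[OF n x] by simp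
  have "(?y 0 - ?y 1) * (?y 0 + ?y 1) = 1 + (\<Sum>i=2..n. (?y i)\<^sup>2)"
    using L lorentz_light_cone[OF n, of ?y ?y] by (simp add: power2_eq_square algebra_simps)
  also have "\<dots> > 0" by (intro add_pos_nonneg sum_nonneg) auto
  finally have "?y 0 + ?y 1 > 0" using u by (simp add: zero_less_mult_iff)
  with u have "?y 0 > 0" by linarith
  moreover have "?y i = 0" if "i > n" for i using that n by (simp add: horo_motion_def Let_def)
  ultimately show ?thesis using L by (simp add: hyp_space_def)
qed

lemma horo_motion_isometry:
  assumes n: "n \<ge> 1"
  shows "horo_motion n g \<in> hyp_isometries n"
proof -
  have dist: "hyp_dist n (horo_motion n g x) (horo_motion n g y) = hyp_dist n x y"
    if "x \<in> hyp_space n" "y \<in> hyp_space n" for x y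
    using that horo_motion_mem[OF n] by (simp add: hyp_dist_def lorentz_horo_motion[OF n])
  have "inj_on (horo_motion n g) (hyp_space n)"
  proof (rule inj_onI)
    fix x y assume xy: "x \<in> hyp_space n" "y \<in> hyp_space n" "horo_motion n g x = horo_motion n g y"
    then have "hyp_dist n x y = 0"
      using dist[of x y] Metric_space.zero[OF Metric_space_hyp horo_motion_mem[OF n xy(2)] horo_motion_mem[OF n xy(2)]] by metis
    then show "x = y" using Metric_space.zero[OF Metric_space_hyp xy(1,2)] by simp
  qed
  moreover have "horo_motion n g ` hyp_space n = hyp_space n"
  proof (intro equalityI subsetI)
    fix x assume x: "x \<in> hyp_space n"
    \<comment> \<open>The group inverse of \<open>g\<close>, which provides the preimage of
      \<open>x\<close>.\<close>
    define g' where "g' = (- fst g, \<lambda>i. - snd g i * exp (- fst g))"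
    define y where "y = horo_motion n g' x"
    have y: "y \<in> hyp_space n" unfolding y_def by (rule horo_motion_mem[OF n x])
    have e: "exp (fst g) * (exp (- fst g) * t) = t" for t by (simp add: exp_minus)
    have u: "y 0 - y 1 = exp (- fst g) * (x 0 - x 1)"
      unfolding y_def horo_motion_coords by (simp add: g'_def)
    have "horo_motion n g y = x"
    proof (rule hyp_eqI_light_cone[OF n horo_motion_mem[OF n y] x])
      show "horo_motion n g y 0 - horo_motion n g y 1 = x 0 - x 1"
        unfolding horo_motion_coords(1) u by (rule e)
      fix i assume i: "i \<in> {2..n}"
      have "y i = x i + (x 0 - x 1) * (- snd g i * exp (- fst g))"
        unfolding y_def horo_motion_coords(3)[OF i] by (simp add: g'_def)
      then show "horo_motion n g y i = x i"
        unfolding horo_motion_coords(3)[OF i] u by (simp add: algebra_simps)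
    qed
    then show "x \<in> horo_motion n g ` hyp_space n" using y by (intro image_eqI[of _ _ y]) auto
  next
    fix x assume "x \<in> horo_motion n g ` hyp_space n"
    then show "x \<in> hyp_space n" using horo_motion_mem[OF n] by blast
  qed
  ultimately show ?thesis
    using dist by (auto simp: hyp_isometries_def bij_betw_def)
qed

lemma horo_coords_motion:
  assumes n: "n \<ge> 1" and x: "x \<in> hyp_space n"
  shows "horo_coords n (horo_motion n g x) = horo_act n g (horo_coords n x)"
proof -
  have u: "x 0 - x 1 > 0" by (rule hyp_light_cone(1)[OF n x])
  then have "ln (exp (fst g) * (x 0 - x 1)) = ln (x 0 - x 1) + fst g"
    by (simp add: ln_mult)
  then show ?thesis
    using u unfolding horo_coords_def horo_act_def horo_motion_coords(1)
    by (auto simp: horo_motion_coords(3) intro!: restrict_ext)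
qed

lemma horo_coords_measurable: "horo_coords n \<in> measurable (hyp_borel n) (horo n)"
proof -
  note measurable_hyp_coord[measurable]
  show ?thesis
    unfolding horo_coords_def
    by (intro measurable_Pair measurable_restrict) (simp_all add: measurable_hyp_coord)
qed

lemma horo_coords_ball:
  assumes n: "n \<ge> 1"
  shows "horo_coords n -` horo_ball n R \<inter> hyp_space n = hyp_ball0 n R"
proof -
  have "horo_coords n x \<in> horo_ball n R \<longleftrightarrow> x 0 \<le> cosh R" if x: "x \<in> hyp_space n" for x
  proof -
    have u: "x 0 - x 1 > 0" and uv: "(x 0 - x 1) * (x 0 + x 1) = 1 + (tail_sq n x)"
      using hyp_light_cone[OF n x] by auto
    have "exp (- ln (x 0 - x 1)) = 1 / (x 0 - x 1)"
      using u by (simp add: exp_minus inverse_eq_divide)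
    then have "(1 + (tail_sq n x)) * exp (- ln (x 0 - x 1)) = x 0 + x 1"
      unfolding uv[symmetric] using u by simp
    moreover have "horo_coords n x \<in> space (horo n)"
      using measurable_space[OF horo_coords_measurable] x by simp
    ultimately show ?thesis
      using u by (simp add: horo_ball_def) (simp add: horo_coords_def)
  qed
  then show ?thesis unfolding hyp_ball0_def by blast
qed

text \<open>In horospherical coordinates the intensity is invariant under \<open>horo_act\<close>,
  because \<open>horo_coords\<close> intertwines it with isometries. The balls of radius
  \<open>r\<close> and \<open>R\<close> then obey the same proportionality, with the same constants
  \<open>h\<close> and \<open>K\<close>.\<close>

lemma intensity_ball_ratio:
  assumes \<mu>: "\<mu> \<in> invariant_prob_measures n r'" and n: "n \<ge> 1" and r: "0 < r" "r \<le> R"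
    and fin: "emeasure (intensity n r' \<mu>) (hyp_ball0 n R) < \<infinity>"
  shows "emeasure (intensity n r' \<mu>) (hyp_ball0 n r)
    \<le> ennreal ((sinh r / sinh R) ^ (n - 1)) * emeasure (intensity n r' \<mu>) (hyp_ball0 n R)"
proof -
  let ?I = "intensity n r' \<mu>"
  define L where "L = distr ?I (horo n) (horo_coords n)"
  have cm: "horo_coords n \<in> measurable ?I (horo n)"
    using horo_coords_measurable by (simp add: measurable_cong_sets[OF sets_intensity refl])
  have ball: "emeasure L (horo_ball n s) = emeasure ?I (hyp_ball0 n s)" for s
    unfolding L_def using emeasure_distr[OF cm horo_ball_measurable] horo_coords_ball[OF n] by simp
  have inv: "distr L (horo n) (horo_act n g) = L" if g: "g \<in> space (horo n)" for g
  proof -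
    have mot: "horo_motion n g \<in> measurable ?I (hyp_borel n)"
      using hyp_isometry_measurable[OF horo_motion_isometry[OF n]] by (simp add: measurable_cong_sets[OF sets_intensity refl])
    have "distr L (horo n) (horo_act n g) = distr ?I (horo n) (horo_act n g \<circ> horo_coords n)"
      unfolding L_def by (rule distr_distr[OF horo_act_measurable1(3)[OF g] cm])
    also have "\<dots> = distr ?I (horo n) (horo_coords n \<circ> horo_motion n g)"
      by (intro distr_cong refl) (simp add: horo_coords_motion[OF n])
    also have "\<dots> = distr (distr ?I (hyp_borel n) (horo_motion n g)) (horo n) (horo_coords n)"
      by (rule distr_distr[OF horo_coords_measurable mot, symmetric])
    also have "\<dots> = L"
      unfolding intensity_invariant[OF \<mu> horo_motion_isometry[OF n]] L_def ..
    finally show ?thesis .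
  qed
  have R: "R > 0" using r by simp
  define h where "h = horo_right_haar n (horo_ball n R)"
  define K where "K = (\<integral>\<^sup>+z. horo_weight n z * indicator (horo_ball n R) z \<partial>L)"
  define q where "q = ennreal ((sinh r / sinh R) ^ (n - 1))"
  have sub: "horo_ball n r \<subseteq> horo_ball n R"
  proof -
    have "cosh r \<le> cosh R" using r by (simp add: cosh_real_nonneg_le_iff)
    then show ?thesis by (auto simp: horo_ball_def)
  qed
  have proportional: "emeasure L (horo_ball n s) * h = emeasure (horo n) (horo_ball n s) * K"
    if "horo_ball n s \<subseteq> horo_ball n R" for s
    unfolding h_def K_def
  proof (rule invariant_measure_proportional[OF _ inv horo_ball_measurable _ horo_ball_measurable that])
    show "sets L = sets (horo n)" by (simp add: L_def)
    show "emeasure L (horo_ball n R) < \<infinity>" using fin by (simp add: ball)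
  qed
  have "emeasure L (horo_ball n r) * h = emeasure (horo n) (horo_ball n r) * K"
    by (rule proportional[OF sub])
  also have "\<dots> \<le> (q * emeasure (horo n) (horo_ball n R)) * K"
    unfolding q_def by (intro mult_right_mono horo_ball_volume_ratio r) simp
  also have "\<dots> = (q * emeasure L (horo_ball n R)) * h"
    using proportional[of R] by (simp add: mult.assoc)
  finally have "h * emeasure L (horo_ball n r) \<le> h * (q * emeasure L (horo_ball n R))"
    by (simp add: mult.commute)
  moreover have "0 < h" "h < \<infinity>" using horo_ball_weight[OF R] by (auto simp: h_def)
  ultimately have "emeasure L (horo_ball n r) \<le> q * emeasure L (horo_ball n R)"
    by (simp add: ennreal_mult_le_mult_iff)
  then show ?thesis by (simp add: ball q_def)
qed

theorem optimal_density_le: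
  assumes n: "n \<ge> 1" and r: "r > 0" and \<theta>: "pi / 3 \<le> \<theta>" "\<theta> \<le> pi"
    and M: "\<And>X. spherical_code n (cos \<theta>) X \<Longrightarrow> real (card X) \<le> M"
  shows "optimal_density n r \<le> ennreal (sin (\<theta> / 2) ^ (n - 1) * M)"
  unfolding optimal_density_def
proof (rule SUP_least)
  fix \<mu> assume \<mu>: "\<mu> \<in> invariant_prob_measures n r"
  have s: "sin (\<theta> / 2) > 0" using \<theta> pi_gt_zero by (intro sin_gt_zero) linarith+
  define R where "R = arsinh (sinh r / sin (\<theta> / 2))"
  have R: "sinh R * sin (\<theta> / 2) = sinh r" using s by (simp add: R_def)
  have sr: "sinh r > 0" using r by simp
  have "sinh r \<le> sinh R"
  proof -
    have "sinh R * sin (\<theta> / 2) \<le> sinh R * 1"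
      using radius_less_double(1)[OF \<theta> r R] by (intro mult_left_mono) auto
    then show ?thesis using R by simp
  qed
  then have rR: "r \<le> R" by simp
  have SR: "sinh R > 0" using r rR by simp
  have ball: "emeasure (intensity n r \<mu>) (hyp_ball0 n R) \<le> ennreal M"
    by (rule intensity_ball_le[OF \<mu> n \<theta> r R M])
  have "packing_density \<mu> \<le> emeasure (intensity n r \<mu>) (hyp_ball0 n r)"
    by (rule packing_density_le_intensity[OF \<mu> r])
  also have "\<dots> \<le> ennreal ((sinh r / sinh R) ^ (n - 1)) * emeasure (intensity n r \<mu>) (hyp_ball0 n R)"
    using ball by (intro intensity_ball_ratio[OF \<mu> n r rR]) (auto intro: le_less_trans)
  also have "sinh r / sinh R = sin (\<theta> / 2)" using R SR by (simp add: field_simps)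
  also have "ennreal (sin (\<theta> / 2) ^ (n - 1)) * emeasure (intensity n r \<mu>) (hyp_ball0 n R)
      \<le> ennreal (sin (\<theta> / 2) ^ (n - 1)) * ennreal M"
    by (intro mult_left_mono ball) simp
  also have "\<dots> = ennreal (sin (\<theta> / 2) ^ (n - 1) * M)"
    using s by (simp add: ennreal_mult')
  finally show "packing_density \<mu> \<le> ennreal (sin (\<theta> / 2) ^ (n - 1) * M)" .
qed

section \<open>The minimum of the exponent\<close>

text \<open>At arguments near \<open>1.1\<close> the remainders are below \<open>10^-8\<close>,
  enough for the enclosures of sine and cosine that follow.\<close>

lemma sin_cos_taylor:
  fixes x :: real
  defines "P \<equiv> x - x^3/6 + x^5/120 - x^7/5040 + x^9/362880 - x^11/39916800"
    and "Q \<equiv> 1 - x^2/2 + x^4/24 - x^6/720 + x^8/40320 - x^10/3628800"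
  shows "sin x \<in> {P - \<bar>x\<bar>^13 / fact 13..P + \<bar>x\<bar>^13 / fact 13}"
    and "cos x \<in> {Q - \<bar>x\<bar>^12 / fact 12..Q + \<bar>x\<bar>^12 / fact 12}"
proof -
  have P: "(\<Sum>m<13. sin_coeff m * x ^ m) = P"
    by (simp add: P_def sin_coeff_def lessThan_nat_numeral fact_numeral)
  show "sin x \<in> {P - \<bar>x\<bar>^13 / fact 13..P + \<bar>x\<bar>^13 / fact 13}"
    using Maclaurin_sin_bound[of x 13] unfolding P by (simp add: abs_le_iff divide_inverse mult.commute)
  obtain t where t: "cos x = (\<Sum>m<12. cos_coeff m * x ^ m) + (cos (t + 1/2 * real 12 * pi) / fact 12) * x ^ 12"
    using Maclaurin_cos_expansion[of x 12] by blast
  have Q: "(\<Sum>m<12. cos_coeff m * x ^ m) = Q"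
    by (simp add: Q_def cos_coeff_def lessThan_nat_numeral fact_numeral)
  have "\<bar>(cos (t + 1/2 * real 12 * pi) / fact 12) * x ^ 12\<bar> = \<bar>cos (t + 1/2 * real 12 * pi)\<bar> * (\<bar>x\<bar>^12 / fact 12)"
    by (simp only: abs_mult power_abs abs_divide) simp
  also have "\<dots> \<le> 1 * (\<bar>x\<bar>^12 / fact 12)"
    by (intro mult_right_mono abs_cos_le_one) simp
  finally show "cos x \<in> {Q - \<bar>x\<bar>^12 / fact 12..Q + \<bar>x\<bar>^12 / fact 12}"
    using t unfolding Q atLeastAtMost_iff by linarith
qed

lemma sin_cos_10995:
  "sin (1.0995 :: real) \<in> {0.89098044..0.89098046}" "cos (1.0995 :: real) \<in> {0.45404165..0.45404168}"
proof -
  show "sin (1.0995 :: real) \<in> {0.89098044..0.89098046}"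
    using sin_cos_taylor(1)[of "1.0995"] by (simp add: power_divide fact_numeral)
  show "cos (1.0995 :: real) \<in> {0.45404165..0.45404168}"
    using sin_cos_taylor(2)[of "1.0995"] by (simp add: power_divide fact_numeral)
qed

lemma sin_cos_10996:
  "sin (1.0996 :: real) \<in> {0.89102584..0.89102586}" "cos (1.0996 :: real) \<in> {0.45395255..0.45395258}"
proof -
  show "sin (1.0996 :: real) \<in> {0.89102584..0.89102586}"
    using sin_cos_taylor(1)[of "1.0996"] by (simp add: power_divide fact_numeral)
  show "cos (1.0996 :: real) \<in> {0.45395255..0.45395258}"
    using sin_cos_taylor(2)[of "1.0996"] by (simp add: power_divide fact_numeral)
qed

lemma ln2_bounds: "ln (2::real) \<in> {0.69314718..0.69314719}"
  using ln_approx_bounds[of 2 9] by (simp add: lessThan_nat_numeral power_divide)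

abbreviation log_ratio :: "real \<Rightarrow> real" where
  "log_ratio s \<equiv> ln ((1 + s) / (1 - s))"

abbreviation KL_factor :: "real \<Rightarrow> real" where
  "KL_factor t \<equiv> cos t / (2 * (sin t)\<^sup>2 * ln 2)"

definition KL_slope :: "real \<Rightarrow> real" where
  "KL_slope t = tan t + sin t - log_ratio (sin t)"

section \<open>Derivative and monotonicity of the exponent\<close>

lemma sin_cos_acute:
  fixes t :: real
  assumes "0 < t" "t < pi / 2"
  shows "0 < sin t" "sin t < 1" "0 < cos t" "cos t < 1"
  using assms sin_gt_zero[of t] cos_gt_zero[of t] sin_monotone_2pi[of t "pi/2"] cos_monotone_0_pi[of 0 t] by auto

text \<open>Factored so that on the acute angles the sign is that of
  \<open>1 - cos t - (cos t)\<^sup>2\<close>, which changes only once, where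
  \<open>cos t = (sqrt 5 - 1) / 2\<close>.\<close>

lemma KL_slope_deriv:
  assumes "-(pi / 2) < t" "t < pi / 2"
  shows "(KL_slope has_real_derivative (1 - cos t) * (1 - cos t - (cos t)\<^sup>2) / (cos t)\<^sup>2) (at t)"
proof -
  have c: "cos t > 0" using assms by (intro cos_gt_zero_pi) auto
  have "(sin t)\<^sup>2 < 1" using c by (simp add: sin_squared_eq)
  then have s: "-1 < sin t" "sin t < 1" by (auto simp: abs_square_less_1)
  have 1: "(1 - sin t) * (1 + sin t) = (cos t)\<^sup>2"
    by (simp add: cos_squared_eq algebra_simps power2_eq_square)
  have "((\<lambda>t. log_ratio (sin t)) has_real_derivative 2 / cos t) (at t)"
  proof -
    have "((cos t * (1 - sin t) - (1 + sin t) * (- cos t)) / ((1 - sin t) * (1 - sin t))) / ((1 + sin t) / (1 - sin t)) = 2 * cos t / ((1 - sin t) * (1 + sin t))"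
      using s by (simp add: divide_simps) (simp add: algebra_simps)
    also have "\<dots> = 2 / cos t" unfolding 1 using c by (simp add: power2_eq_square)
    finally have e: "((cos t * (1 - sin t) - (1 + sin t) * (- cos t)) / ((1 - sin t) * (1 - sin t))) / ((1 + sin t) / (1 - sin t)) = 2 / cos t" .
    show ?thesis
      by (rule DERIV_cong[OF _ e]) (use s in \<open>auto intro!: derivative_eq_intros divide_pos_pos simp: field_simps\<close>)
  qed
  then have "(KL_slope has_real_derivative inverse ((cos t)\<^sup>2) + cos t - 2 / cos t) (at t)"
    unfolding KL_slope_def using c by (intro DERIV_add DERIV_diff DERIV_tan DERIV_sin) auto
  moreover have "inverse ((cos t)\<^sup>2) + cos t - 2 / cos t = (1 - cos t) * (1 - cos t - (cos t)\<^sup>2) / (cos t)\<^sup>2"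
    using c by (simp add: divide_simps power2_eq_square) (simp add: algebra_simps)
  ultimately show ?thesis by simp
qed

text \<open>The two ratios \<open>p\<close> and \<open>q\<close> differ by \<open>1\<close> and so
  have equal derivatives; the constants from differentiating \<open>x * ln x\<close> cancel and only
  \<open>ln (p t) - ln (q t)\<close> survives.\<close>

lemma KL_fun_deriv:
  assumes t: "0 < t" "t < pi / 2"
  shows "(KL_fun has_real_derivative KL_factor t * KL_slope t) (at t)"
proof -
  note sc = sin_cos_acute[OF t]
  have sh: "sin (t / 2) > 0" using t by (intro sin_gt_zero) auto
  have xlnx: "((\<lambda>t. p t * log 2 (p t)) has_real_derivative p' * (ln (p t) + 1) / ln 2) (at t)"
    if "(p has_real_derivative p') (at t)" "p t > 0" for p :: "real \<Rightarrow> real" and p'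
    unfolding log_def using that by (auto intro!: derivative_eq_intros simp: field_simps)
  define p where "p = (\<lambda>t::real. (1 + sin t) / (2 * sin t))"
  define q where "q = (\<lambda>t::real. (1 - sin t) / (2 * sin t))"
  have p: "(p has_real_derivative - cos t / (2 * (sin t)\<^sup>2)) (at t)" "p t > 0"
    unfolding p_def using sc by (auto intro!: derivative_eq_intros simp: field_simps power2_eq_square)
  have q: "(q has_real_derivative - cos t / (2 * (sin t)\<^sup>2)) (at t)" "q t > 0"
    unfolding q_def using sc by (auto intro!: derivative_eq_intros simp: field_simps power2_eq_square)
  have l: "((\<lambda>t. log 2 (sin (t / 2))) has_real_derivative (1 + cos t) / (2 * sin t * ln 2)) (at t)"
  proof -
    have half: "sin t = 2 * sin (t / 2) * cos (t / 2)" "1 + cos t = 2 * (cos (t / 2))\<^sup>2"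
      using sin_double[of "t / 2"] cos_double_cos[of "t / 2"] by simp_all
    have ch: "cos (t / 2) > 0" using t by (intro cos_gt_zero) auto
    have "(1 + cos t) / (2 * sin t * ln 2) = cos (t / 2) / (2 * sin (t / 2) * ln 2)"
      unfolding half using ch sh by (simp add: power2_eq_square)
    moreover have "((\<lambda>t. log 2 (sin (t / 2))) has_real_derivative cos (t / 2) / (2 * sin (t / 2) * ln 2)) (at t)"
      unfolding log_def using sh by (auto intro!: derivative_eq_intros simp: field_simps)
    ultimately show ?thesis by simp
  qed
  have "(KL_fun has_real_derivative (1 + cos t) / (2 * sin t * ln 2)
      + - cos t / (2 * (sin t)\<^sup>2) * (ln (p t) + 1) / ln 2 - - cos t / (2 * (sin t)\<^sup>2) * (ln (q t) + 1) / ln 2) (at t)"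
    using DERIV_diff[OF DERIV_add[OF l xlnx[OF p]] xlnx[OF q]] by (simp add: KL_fun_def[abs_def] p_def q_def)
  moreover have "ln (p t) - ln (q t) = log_ratio (sin t)"
    using sc by (simp add: p_def q_def ln_div)
  moreover have "tan t = sin t / cos t" by (simp add: tan_def)
  ultimately show ?thesis
    using sc by (elim DERIV_cong) (simp add: KL_slope_def divide_simps power2_eq_square, simp add: algebra_simps)
qed

lemma KL_slope_increasing:
  assumes "0 < x" "x < y" "y < pi / 2" and x: "1 - cos x - (cos x)\<^sup>2 \<ge> 0"
  shows "KL_slope x < KL_slope y"
proof (rule DERIV_pos_imp_increasing_open[OF assms(2)])
  fix z assume z: "x < z" "z < y"
  have z': "0 < z" "z < pi / 2" using z assms by auto
  note c = sin_cos_acute[OF z']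
  have "cos z < cos x" using z assms by (intro cos_monotone_0_pi) auto
  moreover from this have "(cos z)\<^sup>2 < (cos x)\<^sup>2" using c by (intro power_strict_mono) auto
  ultimately have "0 < (1 - cos z) * (1 - cos z - (cos z)\<^sup>2) / (cos z)\<^sup>2"
    using c x by (intro divide_pos_pos mult_pos_pos) auto
  then show "\<exists>d. (KL_slope has_real_derivative d) (at z) \<and> d > 0"
    using KL_slope_deriv[of z] z' by auto
next
  show "continuous_on {x..y} KL_slope"
    using assms by (auto intro!: DERIV_continuous_on[OF has_field_derivative_at_within[OF KL_slope_deriv]])
qed

lemma KL_slope_neg:
  assumes "0 < x" "x < pi / 2" and x: "1 - cos x - (cos x)\<^sup>2 < 0"
  shows "KL_slope x < 0"
proof -
  have "KL_slope x < KL_slope 0"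
  proof (rule DERIV_neg_imp_decreasing_open[OF assms(1)])
    fix z assume z: "0 < z" "z < x"
    have z': "0 < z" "z < pi / 2" using z assms by auto
    note c = sin_cos_acute[OF z'] sin_cos_acute[OF assms(1,2)]
    have "cos x < cos z" using z assms by (intro cos_monotone_0_pi) auto
    moreover from this have "(cos x)\<^sup>2 < (cos z)\<^sup>2" using c by (intro power_strict_mono) auto
    ultimately have "(1 - cos z) * (1 - cos z - (cos z)\<^sup>2) / (cos z)\<^sup>2 < 0"
      using c x by (intro divide_neg_pos mult_pos_neg) auto
    then show "\<exists>d. (KL_slope has_real_derivative d) (at z) \<and> d < 0"
      using KL_slope_deriv[of z] z' by auto
  next
    show "continuous_on {0..x} KL_slope"
      using assms by (auto intro!: DERIV_continuous_on[OF has_field_derivative_at_within[OF KL_slope_deriv]])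
  qed
  then show ?thesis by (simp add: KL_slope_def)
qed

text \<open>Either the slope has so far only decreased from its value \<open>0\<close> at the
  origin, or it is already increasing strictly towards its zero \<open>z\<close>.\<close>

lemma KL_slope_before_zero:
  assumes "0 < x" "x < z" "z < pi / 2" "KL_slope z = 0"
  shows "KL_slope x < 0"
  using KL_slope_neg[of x] KL_slope_increasing[of x z] assms by fastforce

section \<open>Numerical value and location of the minimum\<close>

lemma ln_log_ratio_bounds:
  fixes s l u :: real
  assumes "l \<le> s" "s \<le> u" "-1 < l" "u < 1"
  shows "ln ((1 + s) / (1 - s)) \<in> {ln ((1 + l) / (1 - l))..ln ((1 + u) / (1 - u))}"
  using assms by (auto intro!: ln_mono divide_pos_pos frac_le)

text \<open>Outward roundings, at the two test angles, of \<open>(1 + sin t) / (1 - sin t)\<close>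
  divided by \<open>16\<close>, and at \<open>1.0995\<close> of \<open>1 / (1 - cos t)\<close> and
  \<open>(1 + sin t) / (2 * sin t)\<close>. Splitting off \<open>16\<close> brings the argument near
  \<open>1\<close>, where few terms of the series suffice.\<close>

lemma ln_numerics:
  "ln (1.08408 :: real) \<ge> 0.0807316"
  "ln (1.08409 :: real) \<le> 0.080741"
  "ln (1.08457 :: real) \<le> 0.0811836"
  "ln (1.83164 :: real) \<ge> 0.6052114"
  "ln (1.83165 :: real) \<le> 0.6052173"
  "ln (1.061179 :: real) \<ge> 0.05938"
  "ln (1.06118 :: real) \<le> 0.0593815"
proof -
  show "ln (1.08408 :: real) \<ge> 0.0807316"
    using ln_approx_bounds[of "1.08408" 2] by (simp add: lessThan_nat_numeral power_divide)
  show "ln (1.08409 :: real) \<le> 0.080741"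
    using ln_approx_bounds[of "1.08409" 2] by (simp add: lessThan_nat_numeral power_divide)
  show "ln (1.08457 :: real) \<le> 0.0811836"
    using ln_approx_bounds[of "1.08457" 2] by (simp add: lessThan_nat_numeral power_divide)
  show "ln (1.83164 :: real) \<ge> 0.6052114"
    using ln_approx_bounds[of "1.83164" 5] by (simp add: lessThan_nat_numeral power_divide)
  show "ln (1.83165 :: real) \<le> 0.6052173"
    using ln_approx_bounds[of "1.83165" 5] by (simp add: lessThan_nat_numeral power_divide)
  show "ln (1.061179 :: real) \<ge> 0.05938"
    using ln_approx_bounds[of "1.061179" 2] by (simp add: lessThan_nat_numeral power_divide)
  show "ln (1.06118 :: real) \<le> 0.0593815"
    using ln_approx_bounds[of "1.06118" 2] by (simp add: lessThan_nat_numeral power_divide)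
qed

lemma pi_half_bounds: "1.1 < pi / 2"
  using pi_gt3 by simp

lemma ln_16: "ln (16 :: real) = 4 * ln 2"
  using ln_realpow[of "2::real" 4] by simp

lemma log_ratio_10995: "log_ratio (sin 1.0995) \<in> {2.85332..(2.85333::real)}"
proof -
  have "(16 * 1.08408 :: real) \<le> (1 + 0.89098044) / (1 - 0.89098044)" by simp
  then have "ln (16 * 1.08408 :: real) \<le> ln ((1 + 0.89098044) / (1 - 0.89098044))" by (intro ln_mono) auto
  moreover have "(1 + 0.89098046) / (1 - 0.89098046) \<le> (16 * 1.08409 :: real)" by simp
  then have "ln ((1 + 0.89098046) / (1 - 0.89098046)) \<le> ln (16 * 1.08409 :: real)" by (intro ln_mono) auto
  moreover have "ln (16 * 1.08408 :: real) \<ge> 2.85332"  "ln (16 * 1.08409 :: real) \<le> 2.85333"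
    using ln_numerics ln2_bounds ln_mult[of 16 "1.08408 :: real"] ln_mult[of 16 "1.08409 :: real"] ln_16 by auto
  moreover have "log_ratio (sin 1.0995)
      \<in> {ln ((1 + 0.89098044) / (1 - 0.89098044))..ln ((1 + 0.89098046) / (1 - 0.89098046 :: real))}"
    using sin_cos_10995 by (intro ln_log_ratio_bounds) auto
  ultimately show ?thesis
    unfolding atLeastAtMost_iff by linarith
qed

lemma tan_bounds:
  fixes s c :: real
  assumes "s \<in> {ls..us}" "c \<in> {lc..uc}" "0 < lc" "0 < ls"
  shows "s / c \<in> {ls / uc..us / lc}"
  using assms by (auto intro!: frac_le)

lemma mult_bounds:
  fixes x y :: real
  assumes "x \<in> {a..b}" "y \<in> {c..d}" "0 \<le> a" "0 \<le> c"
  shows "x * y \<in> {a * c..b * d}"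
  using assms by (auto intro!: mult_mono)

lemma KL_slope_10995: "KL_slope 1.0995 \<in> {-0.0001..<0}"
proof -
  have "tan (1.0995 :: real) \<in> {0.89098044 / 0.45404168..0.89098046 / 0.45404165}"
    unfolding tan_def by (rule tan_bounds[OF sin_cos_10995]) auto
  then show ?thesis using log_ratio_10995 sin_cos_10995 by (auto simp: KL_slope_def)
qed

lemma KL_slope_10996: "KL_slope 1.0996 > 0"
proof -
  have "(1 + 0.89102586) / (1 - 0.89102586) \<le> (16 * 1.08457 :: real)" by simp
  then have "ln ((1 + 0.89102586) / (1 - 0.89102586)) \<le> ln (16 * 1.08457 :: real)" by (intro ln_mono) auto
  moreover have "ln (16 * 1.08457 :: real) \<le> 2.8537724"
    using ln_numerics(3) ln2_bounds ln_mult[of 16 "1.08457 :: real"] ln_16 by auto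
  moreover have "log_ratio (sin 1.0996)
      \<in> {ln ((1 + 0.89102584) / (1 - 0.89102584))..ln ((1 + 0.89102586) / (1 - 0.89102586 :: real))}"
    using sin_cos_10996 by (intro ln_log_ratio_bounds) auto
  from this have "log_ratio (sin 1.0996) \<le> ln ((1 + 0.89102586) / (1 - 0.89102586 :: real))"
    unfolding atLeastAtMost_iff by linarith
  ultimately have "log_ratio (sin 1.0996) \<le> (2.8537724::real)" by linarith
  moreover have "tan (1.0996 :: real) \<in> {0.89102584 / 0.45395258..0.89102586 / 0.45395255}"
    unfolding tan_def by (rule tan_bounds[OF sin_cos_10996]) auto
  ultimately show ?thesis using sin_cos_10996 by (auto simp: KL_slope_def)
qed

text \<open>The half angle is eliminated by \<open>1 - cos t = 2 * (sin (t / 2))\<^sup>2\<close>, so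
  that only logarithms with available enclosures are left.\<close>

lemma KL_fun_alt:
  assumes t: "0 < t" "t < pi / 2"
  shows "KL_fun t * ln 2 = - (ln 2 + ln (1 / (1 - cos t))) / 2 + ln ((1 + sin t) / (2 * sin t))
     + (1 - sin t) / (2 * sin t) * log_ratio (sin t)"
proof -
  note sc = sin_cos_acute[OF t]
  have sh: "sin (t / 2) > 0" using t by (intro sin_gt_zero) auto
  have "1 - cos t = 2 * (sin (t / 2))\<^sup>2" using cos_double_sin[of "t / 2"] by simp
  then have "ln (1 - cos t) = ln 2 + 2 * ln (sin (t / 2))"
    using sh by (simp add: ln_mult ln_realpow)
  then have 1: "ln (sin (t / 2)) = - (ln 2 + ln (1 / (1 - cos t))) / 2"
    using sc by (simp add: ln_div)
  have 2: "log_ratio (sin t) = ln ((1 + sin t) / (2 * sin t)) - ln ((1 - sin t) / (2 * sin t))"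
    using sc by (simp add: ln_div)
  have 3: "(1 + sin t) / (2 * sin t) = 1 + (1 - sin t) / (2 * sin t)"
    using sc by (simp add: field_simps)
  have "KL_fun t * ln 2 = ln (sin (t / 2)) + (1 + sin t) / (2 * sin t) * ln ((1 + sin t) / (2 * sin t))
     - (1 - sin t) / (2 * sin t) * ln ((1 - sin t) / (2 * sin t))"
    by (simp add: KL_fun_def log_def add_divide_distrib diff_divide_distrib distrib_right left_diff_distrib)
  also have "(1 + sin t) / (2 * sin t) * ln ((1 + sin t) / (2 * sin t)) =
    ln ((1 + sin t) / (2 * sin t)) + (1 - sin t) / (2 * sin t) * ln ((1 + sin t) / (2 * sin t))"
    using 3 by (metis distrib_right mult_1)
  finally show ?thesis unfolding 1 2 by (simp add: right_diff_distrib)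
qed

lemma KL_fun_10995: "KL_fun 1.0995 \<in> {-0.59907..-0.5990}"
proof -
  define K where "K = KL_fun 1.0995"
  have t: "0 < (1.0995::real)" "1.0995 < pi / 2" using pi_half_bounds by auto
  have c: "ln (1 / (1 - cos 1.0995)) \<in> {0.6052114..(0.6052173::real)}"
  proof -
    have "1 / (1 - cos 1.0995) \<in> {1 / (1 - 0.45404165)..1 / (1 - 0.45404168::real)}"
      using sin_cos_10995 unfolding atLeastAtMost_iff by (intro conjI divide_left_mono mult_pos_pos) simp_all
    then have a: "1.83164 \<le> 1 / (1 - cos (1.0995::real))" "1 / (1 - cos 1.0995) \<le> (1.83165::real)"
      by auto
    have "ln 1.83164 \<le> ln (1 / (1 - cos (1.0995::real)))" using a(1) by (intro ln_mono) auto
    moreover have "ln (1 / (1 - cos (1.0995::real))) \<le> ln 1.83165"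
    proof (rule ln_mono)
      show "0 < 1 / (1 - cos (1.0995::real))" by (rule less_le_trans[OF _ a(1)]) simp
    qed (rule a(2))
    ultimately show ?thesis using ln_numerics by auto
  qed
  have q: "(1 + sin 1.0995) / (2 * sin 1.0995) \<in> {1.061179..1.06118::real}"
    "(1 - sin 1.0995) / (2 * sin 1.0995) \<in> {0.061179..0.06118::real}"
    using sin_cos_10995 by (auto simp: divide_simps)
  have p: "ln ((1 + sin 1.0995) / (2 * sin 1.0995)) \<in> {0.05938..0.0593815::real}"
  proof -
    have "ln 1.061179 \<le> ln ((1 + sin 1.0995) / (2 * sin (1.0995::real)))" using q(1) by (intro ln_mono) auto
    moreover have "ln ((1 + sin 1.0995) / (2 * sin (1.0995::real))) \<le> ln 1.06118" using q(1) by (intro ln_mono) (auto simp del: divide_le_eq_numeral1 le_divide_eq_numeral1 dest: less_le_trans)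
    ultimately show ?thesis using ln_numerics by auto
  qed
  have m: "(1 - sin 1.0995) / (2 * sin 1.0995) * log_ratio (sin 1.0995) \<in> {0.061179 * 2.85332..0.06118 * (2.85333::real)}"
    by (rule mult_bounds[OF q(2) log_ratio_10995]) auto
  have arith: "- (l + u) / 2 + v + w \<in> {-0.41524..-0.41523}"
    if "u \<in> {0.6052114..0.6052173}" "v \<in> {0.05938..0.0593815}"
      "w \<in> {0.061179 * 2.85332..0.06118 * 2.85333}" "l \<in> {0.69314718..0.69314719}"
    for l u v w :: real
  proof -
    have "0.6052114 \<le> u" "u \<le> 0.6052173" "0.05938 \<le> v" "v \<le> 0.0593815"
      "0.174563 \<le> w" "w \<le> 0.1745668" "0.69314718 \<le> l" "l \<le> 0.69314719"
      using that by auto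
    then show ?thesis by (simp add: add_divide_distrib diff_divide_distrib)
  qed
  have e: "K * ln 2 \<in> {-0.41524..-0.41523}"
    unfolding K_def KL_fun_alt[OF t] by (rule arith[OF c p m ln2_bounds])
  have "K \<le> -0.5990"
  proof (rule ccontr)
    assume "\<not> K \<le> -0.5990"
    then have "-0.5990 * ln 2 < K * ln 2" by (intro mult_strict_right_mono) auto
    then show False using e ln2_bounds by auto
  qed
  moreover have "K \<ge> -0.59907"
  proof (rule ccontr)
    assume "\<not> K \<ge> -0.59907"
    then have "K * ln 2 < -0.59907 * ln 2" by (intro mult_strict_right_mono) auto
    then show False using e ln2_bounds by auto
  qed
  ultimately show ?thesis by (simp add: K_def)
qed

theorem KL_minimum:
  obtains t where "1.0995 < t" "t < 1.0996"
    "is_arg_min KL_fun (\<lambda>t. 0 < t \<and> t < pi / 2) t" "KL_const = - KL_fun t"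
    "0.5990 \<le> KL_const" "KL_const < 0.5991"
proof -
  have cont: "continuous_on {1.0995..1.0996} KL_slope"
    using pi_half_bounds by (auto intro!: DERIV_continuous_on[OF has_field_derivative_at_within[OF KL_slope_deriv]])
  obtain z where z: "1.0995 \<le> z" "z \<le> 1.0996" "KL_slope z = 0"
    using IVT'[OF _ _ _ cont, of 0] KL_slope_10995 KL_slope_10996 by auto
  have "KL_slope z \<noteq> KL_slope 1.0995" "KL_slope z \<noteq> KL_slope 1.0996"
    using z(3) KL_slope_10995 KL_slope_10996 by auto
  then have "z \<noteq> 1.0995" "z \<noteq> 1.0996" by metis+
  with z have z': "1.0995 < z" "z < 1.0996" by auto
  have z2: "0 < z" "z < pi / 2" using z' pi_half_bounds by auto
  have cz: "1 - cos y - (cos y)\<^sup>2 > 0" if "1.0995 \<le> y" "y < pi / 2" for y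
  proof -
    have c: "cos y \<le> cos 1.0995" "0 \<le> cos y" using that pi_half_bounds cos_gt_zero[of y]
      by (auto intro!: cos_monotone_0_pi_le)
    then have "cos y \<le> 0.4541" using sin_cos_10995 by auto
    moreover from this have "(cos y)\<^sup>2 \<le> 0.4541\<^sup>2" using c by (intro power_mono) auto
    ultimately show ?thesis by (simp add: power2_eq_square)
  qed
  have sgn: "KL_factor y > 0" if "0 < y" "y < pi / 2" for y
    using sin_cos_acute[OF that] by (intro divide_pos_pos mult_pos_pos) auto
  have min: "KL_fun z \<le> KL_fun y" if y: "0 < y" "y < pi / 2" for y
  proof (cases y z rule: linorder_cases)
    case less
    have "KL_fun z < KL_fun y"
    proof (rule DERIV_neg_imp_decreasing_open[OF less])
      fix x assume x: "y < x" "x < z"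
      have "KL_factor x * KL_slope x < 0"
        using x y z2 z(3) by (intro mult_pos_neg sgn KL_slope_before_zero[of x z]) auto
      then show "\<exists>d. (KL_fun has_real_derivative d) (at x) \<and> d < 0"
        using KL_fun_deriv[of x] x y z2 by auto
    next
      show "continuous_on {y..z} KL_fun"
        using y z2 by (auto intro!: DERIV_continuous_on[OF has_field_derivative_at_within[OF KL_fun_deriv]])
    qed
    then show ?thesis by simp
  next
    case greater
    have "KL_fun z < KL_fun y"
    proof (rule DERIV_pos_imp_increasing_open[OF greater])
      fix x assume x: "z < x" "x < y"
      have "KL_slope x > KL_slope z"
        using x y z2 z' cz[of z] by (intro KL_slope_increasing) auto
      then have "KL_factor x * KL_slope x > 0"
        using x y z2 z(3) by (intro mult_pos_pos sgn) auto
      then show "\<exists>d. (KL_fun has_real_derivative d) (at x) \<and> d > 0"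
        using KL_fun_deriv[of x] x y z2 by auto
    next
      show "continuous_on {z..y} KL_fun"
        using y z2 by (auto intro!: DERIV_continuous_on[OF has_field_derivative_at_within[OF KL_fun_deriv]])
    qed
    then show ?thesis by simp
  qed auto
  have K: "KL_const = - KL_fun z"
    unfolding KL_const_def using z2 min
    by (simp, intro cInf_eq_minimum) auto
  have t1: "0 < (1.0995::real)" "1.0995 < pi / 2" using pi_half_bounds by auto
  have up: "KL_fun z \<le> -0.5990" using min[OF t1] KL_fun_10995 by auto
  \<comment> \<open>The value at the minimum is recovered from the one at \<open>1.0995\<close> by
    the mean value theorem: interval length and slope are both at most \<open>10^-4\<close> in size
    and the factor is at most \<open>1\<close>, so the two values differ by at most
    \<open>10^-8\<close>.\<close>
  obtain w where w: "1.0995 < w" "w < z"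
    "KL_fun z - KL_fun 1.0995 = (z - 1.0995) * (KL_factor w * KL_slope w)"
    using MVT2[OF z'(1), of KL_fun "\<lambda>w. KL_factor w * KL_slope w"] KL_fun_deriv z2 by auto
  have w2: "0 < w" "w < pi / 2" using w z2 by auto
  have sl: "-0.0001 \<le> KL_slope w" "KL_slope w \<le> 0"
    using KL_slope_increasing[of "1.0995" w] KL_slope_10995 KL_slope_before_zero[of w z] w w2 z2 z(3) cz[of "1.0995"] t1 by auto
  have q1: "KL_factor w \<le> 1"
  proof -
    have "sin w \<ge> sin 1.0995" using w w2 z2 pi_half_bounds by (intro sin_monotone_2pi_le) auto
    then have "sin w \<ge> 0.89" using sin_cos_10995 by auto
    then have "(sin w)\<^sup>2 \<ge> 0.89\<^sup>2" by (intro power_mono) auto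
    then have "2 * (sin w)\<^sup>2 * ln 2 \<ge> 2 * 0.89\<^sup>2 * 0.69" using ln2_bounds by (intro mult_mono) auto
    then have "2 * (sin w)\<^sup>2 * ln 2 \<ge> 1" by (simp add: power2_eq_square)
    then show ?thesis using sin_cos_acute[OF w2] by (simp add: divide_le_eq)
  qed
  have "\<bar>KL_fun z - KL_fun 1.0995\<bar>
      = \<bar>z - 1.0995\<bar> * (\<bar>KL_factor w\<bar> * \<bar>KL_slope w\<bar>)"
    unfolding w(3) abs_mult ..
  also have "\<dots> \<le> 0.0001 * (1 * 0.0001)"
  proof (intro mult_mono)
    show "\<bar>KL_factor w\<bar> \<le> 1" using q1 sgn[OF w2] by linarith
    show "\<bar>KL_slope w\<bar> \<le> 0.0001" using sl by linarith
  qed (use z' in auto)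
  finally have "\<bar>KL_fun z - KL_fun 1.0995\<bar> \<le> 0.0001 * (1 * 0.0001)" .
  then have "KL_fun 1.0995 - KL_fun z \<le> 0.0001 * (1 * 0.0001)"
    by (simp only: abs_le_iff minus_diff_eq)
  then have lo: "KL_fun z > -0.5991" using KL_fun_10995 by simp
  show ?thesis
    by (rule that[OF z' _ K]) (use min z2 up lo K in \<open>auto simp: is_arg_min_linorder\<close>)
qed

section \<open>The asymptotic bound\<close>

text \<open>The right side is the growth per dimension of the volume ratio times the code bound in
  the limiting case \<open>b = a\<close>.\<close>

lemma KL_fun_powr:
  assumes "0 < t" "t < pi / 2"
  defines "a \<equiv> (1 - sin t) / (2 * sin t)"
  shows "2 powr KL_fun t = sin (t / 2) * (1 + a) * ((1 + a) / a) powr a"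
proof -
  note sc = sin_cos_acute[OF assms(1,2)]
  have sh: "sin (t / 2) > 0" using assms by (intro sin_gt_zero) auto
  have a: "a > 0" using sc by (simp add: a_def)
  have e: "(1 + sin t) / (2 * sin t) = 1 + a" using sc by (simp add: a_def field_simps)
  have "KL_fun t = log 2 (sin (t / 2)) + log 2 (1 + a) + a * log 2 ((1 + a) / a)"
    unfolding KL_fun_def e a_def[symmetric] using a by (simp add: log_divide algebra_simps)
  then show ?thesis
    using sh a by (simp add: powr_add powr_powr[symmetric] mult.commute[of a])
qed

lemma optimal_density_eventually_le:
  assumes t: "pi / 3 \<le> t" "t < pi / 2" and d: "d > 0"
  shows "\<forall>\<^sub>F n in sequentially. (SUP r\<in>{0<..}. optimal_density n r) \<le> ennreal (2 powr ((KL_fun t + d) * real n))"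
proof -
  have t0: "0 < t" using t pi_gt_zero by linarith
  note sc = sin_cos_acute[OF t0 t(2)]
  have sh: "sin (t / 2) > 0" using t0 t by (intro sin_gt_zero) auto
  define a where "a = (1 - sin t) / (2 * sin t)"
  have a: "a > 0" using sc by (simp add: a_def)
  define L where "L = log 2 ((1 + a) / a)"
  have L: "L > 0" using a by (simp add: L_def field_simps)
  have Lp: "2 powr L = (1 + a) / a" using a by (simp add: L_def)
  \<comment> \<open>Half of \<open>d\<close> pays for taking \<open>b\<close> larger than
    \<open>a\<close>, the other half for the constant \<open>D\<close>.\<close>
  define b where "b = a + d / (2 * L)"
  have b: "a < b" using d L by (simp add: b_def)
  obtain C where C: "C > 0" and ev: "\<forall>\<^sub>F n in sequentially. \<forall>X. spherical_code n (cos t) X \<longrightarrow>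
     real (card X) \<le> C * (1 + a) ^ n * ((1 + a) / a) powr (b * real n)"
    using kabatiansky_levenshtein[OF t0 t(2) b[unfolded a_def]] unfolding a_def[symmetric] by blast
  \<comment> \<open>The division turns the exponent \<open>n - 1\<close> of the volume ratio into
    \<open>n\<close>.\<close>
  define D where "D = C / sin (t / 2)"
  have "D > 0" using C sh by (simp add: D_def)
  have evD: "\<forall>\<^sub>F n in sequentially. D \<le> 2 powr (d / 2 * real n)"
    using eventually_ge_at_top[of "nat \<lceil>2 * log 2 D / d\<rceil>"]
  proof eventually_elim
    case (elim n)
    then have "2 * log 2 D / d \<le> real n" by linarith
    then have "log 2 D \<le> d / 2 * real n" using d by (simp add: field_simps)
    then have "2 powr log 2 D \<le> 2 powr (d / 2 * real n)" by (intro powr_mono) auto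
    then show ?case using \<open>D > 0\<close> by simp
  qed
  show ?thesis
    using ev evD eventually_ge_at_top[of 1]
  proof eventually_elim
    case (elim n)
    define M where "M = C * (1 + a) ^ n * ((1 + a) / a) powr (b * real n)"
    have "sin (t / 2) ^ (n - 1) * M = D * (sin (t / 2) ^ n * (1 + a) ^ n * ((1 + a) / a) powr (b * real n))"
      using elim(3) sh by (cases n) (auto simp: M_def D_def)
    also have "((1 + a) / a) powr (b * real n) = (((1 + a) / a) powr a) ^ n * 2 powr (d / 2 * real n)"
    proof -
      have "((1 + a) / a) powr (b * real n) = ((1 + a) / a) powr (a * real n) * ((1 + a) / a) powr (d / (2 * L) * real n)"
        by (simp add: b_def distrib_right powr_add)
      also have "((1 + a) / a) powr (d / (2 * L) * real n) = 2 powr (d / 2 * real n)"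
        unfolding Lp[symmetric] powr_powr using L by simp
      also have "((1 + a) / a) powr (a * real n) = (((1 + a) / a) powr a) ^ n"
        using a by (simp add: powr_realpow[symmetric] powr_powr)
      finally show ?thesis .
    qed
    also have "D * (sin (t / 2) ^ n * (1 + a) ^ n * ((((1 + a) / a) powr a) ^ n * 2 powr (d / 2 * real n)))
        = D * ((2 powr KL_fun t) ^ n * 2 powr (d / 2 * real n))"
      unfolding KL_fun_powr[OF t0 t(2), folded a_def] by (simp add: power_mult_distrib mult.assoc)
    also have "\<dots> \<le> 2 powr (d / 2 * real n) * ((2 powr KL_fun t) ^ n * 2 powr (d / 2 * real n))"
      by (intro mult_right_mono elim(2)) simp
    also have "\<dots> = 2 powr ((KL_fun t + d) * real n)"
      by (simp add: powr_realpow[symmetric] powr_powr powr_add[symmetric] algebra_simps)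
    finally have le: "sin (t / 2) ^ (n - 1) * M \<le> 2 powr ((KL_fun t + d) * real n)" .
    have "optimal_density n r \<le> ennreal (2 powr ((KL_fun t + d) * real n))" if "r > 0" for r
    proof -
      have "optimal_density n r \<le> ennreal (sin (t / 2) ^ (n - 1) * M)"
        using elim(1,3) t that pi_gt_zero by (intro optimal_density_le) (auto simp: M_def)
      also have "\<dots> \<le> ennreal (2 powr ((KL_fun t + d) * real n))" by (intro ennreal_leI le)
      finally show ?thesis .
    qed
    then show ?case by (intro SUP_least) auto
  qed
qed

text \<open>Only an upper bound on \<^term>\<open>S\<close> is wanted, so the exponent may be truncated at \<open>0\<close> from above.\<close>

lemma exponent_of_eventual_bounds:
  fixes S :: "nat \<Rightarrow> ennreal"
  assumes "\<And>d. d > 0 \<Longrightarrow> \<forall>\<^sub>F n in sequentially. S n \<le> ennreal (2 powr ((d - c) * real n))"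
  obtains \<epsilon> :: "nat \<Rightarrow> real" where "\<epsilon> \<in> o(\<lambda>_. 1)"
    "\<forall>\<^sub>F n in sequentially. S n \<le> ennreal (2 powr (- (c + \<epsilon> n) * real n))"
proof
  \<comment> \<open>For \<open>S n = 0\<close> every exponent is admissible, while the logarithm
    would only give a default value.\<close>
  define \<epsilon> where "\<epsilon> = (\<lambda>n. if S n = 0 then 0 else min 0 (- log 2 (enn2real (S n)) / real n - c))"
  have "\<epsilon> \<longlonglongrightarrow> 0"
  proof (rule LIMSEQ_I)
    fix d :: real assume d: "d > 0"
    have "\<forall>\<^sub>F n in sequentially. norm (\<epsilon> n - 0) < d"
      using assms[OF half_gt_zero[OF d]] eventually_gt_at_top[of 0]
    proof eventually_elim
      case (elim n)
      show ?case
      proof (cases "S n = 0")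
        case False
        then have "0 < S n" by (simp only: zero_less_iff_neq_zero not_False_eq_True)
        then have pos: "enn2real (S n) > 0"
          using le_less_trans[OF elim(1) ennreal_less_top] by (simp only: enn2real_positive_iff)
        have le: "enn2real (S n) \<le> 2 powr ((d / 2 - c) * real n)"
          by (rule enn2real_leI[OF _ elim(1)]) simp
        have "log 2 (enn2real (S n)) \<le> log 2 (2 powr ((d / 2 - c) * real n))"
          using pos le by (intro log_mono) auto
        then have "log 2 (enn2real (S n)) \<le> (d / 2 - c) * real n" by simp
        then have "- log 2 (enn2real (S n)) / real n - c \<ge> - (d / 2)"
          using elim by (simp add: field_simps)
        then show ?thesis using d False by (auto simp: \<epsilon>_def min_def)
      qed (use d in \<open>simp add: \<epsilon>_def\<close>)
    qed
    then show "\<exists>no. \<forall>n\<ge>no. norm (\<epsilon> n - 0) < d" by (simp add: eventually_sequentially)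
  qed
  then show "\<epsilon> \<in> o(\<lambda>_. 1)" by (intro smalloI_tendsto) auto
  show "\<forall>\<^sub>F n in sequentially. S n \<le> ennreal (2 powr (- (c + \<epsilon> n) * real n))"
    using assms[OF zero_less_one] eventually_gt_at_top[of 0]
  proof eventually_elim
    case (elim n)
    show ?case
    proof (cases "S n = 0")
      case False
      then have "0 < S n" by (simp only: zero_less_iff_neq_zero not_False_eq_True)
      moreover have fin: "S n < top" by (rule le_less_trans[OF elim(1) ennreal_less_top])
      ultimately have pos: "enn2real (S n) > 0" by (simp only: enn2real_positive_iff)
      have "\<epsilon> n \<le> - log 2 (enn2real (S n)) / real n - c" using False by (simp add: \<epsilon>_def)
      then have "log 2 (enn2real (S n)) \<le> - (c + \<epsilon> n) * real n" using elim by (simp add: field_simps)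
      then have "2 powr log 2 (enn2real (S n)) \<le> 2 powr (- (c + \<epsilon> n) * real n)"
        by (intro powr_mono) auto
      then have "enn2real (S n) \<le> 2 powr (- (c + \<epsilon> n) * real n)" using pos by simp
      then have "ennreal (enn2real (S n)) \<le> ennreal (2 powr (- (c + \<epsilon> n) * real n))" by (rule ennreal_leI)
      then show ?thesis using fin by simp
    qed simp
  qed
qed

theorem corollary4p2:
  shows "(\<exists>\<epsilon> :: nat \<Rightarrow> real. \<epsilon> \<in> o(\<lambda>_. 1) \<and>
            (\<forall>\<^sub>F n in sequentially.
               (SUP r\<in>{0<..}. optimal_density n r)
                 \<le> ennreal (2 powr (- (KL_const + \<epsilon> n) * real n))))
         \<and> (\<exists>\<theta>. is_arg_min KL_fun (\<lambda>\<theta>. 0 < \<theta> \<and> \<theta> < pi / 2) \<theta>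
                \<and> 1.0995 \<le> \<theta> \<and> \<theta> < 1.0996)
         \<and> 0.5990 \<le> KL_const \<and> KL_const < 0.5991"
proof -
  obtain \<theta> where \<theta>: "1.0995 < \<theta>" "\<theta> < 1.0996"
    and min: "is_arg_min KL_fun (\<lambda>\<theta>. 0 < \<theta> \<and> \<theta> < pi / 2) \<theta>" and K: "KL_const = - KL_fun \<theta>"
    and bounds: "0.5990 \<le> KL_const" "KL_const < 0.5991"
    by (rule KL_minimum)
  have "\<theta> < pi / 2" using min by (simp add: is_arg_min_def)
  \<comment> \<open>Places the minimizer in the range where the density bound applies:
    \<open>cos 1.0995\<close> is about \<open>0.454\<close>, less than
    \<open>cos (pi / 3) = 1 / 2\<close>.\<close>
  moreover have "pi / 3 \<le> \<theta>"
  proof -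
    have "cos \<theta> \<le> cos 1.0995"
      using \<theta> pi_gt3 by (intro cos_monotone_0_pi_le) auto
    also have "\<dots> < cos (pi / 3)" using sin_cos_10995(2) by (simp add: cos_60)
    finally show ?thesis
      using cos_monotone_0_pi_le[of \<theta> "pi / 3"] \<theta> pi_gt_zero by fastforce
  qed
  ultimately have "\<forall>\<^sub>F n in sequentially. (SUP r\<in>{0<..}. optimal_density n r)
      \<le> ennreal (2 powr ((d - KL_const) * real n))" if "d > 0" for d
    using optimal_density_eventually_le[of \<theta> d] that unfolding K by (simp add: add.commute)
  then obtain \<epsilon> :: "nat \<Rightarrow> real" where "\<epsilon> \<in> o(\<lambda>_. 1)"
    "\<forall>\<^sub>F n in sequentially. (SUP r\<in>{0<..}. optimal_density n r) \<le> ennreal (2 powr (- (KL_const + \<epsilon> n) * real n))"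
    by (rule exponent_of_eventual_bounds)
  then show ?thesis using \<theta> min bounds by (intro conjI) (blast, auto)
qed

end
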